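(* Let $\beta\ge1$ be an integer, $L>0$, and let $f\in\mathcal S^p_L(\beta)$ be a probability density on $[0,1]^d$ with $X_1,\dots,X_n$ i.i.d. of density $f$, and $\rho>0$. There exist $C_1>0$ depending on $\beta$ and $L$, and $C_2>0$ depending on $\beta$, $d$ and $\|f\|_\infty$, such that if $\min\{n,n\sqrt{\rho/\log_2 n}\}\ge C_2$, then the estimator $\hat f_{\hat M}$ of the selection procedure (context) run with $\mathcal M=\{1,2,4,\dots,2^{\lfloor\log_2((n^{1/d}-1)/2)\rfloor}\}$ is $\rho$-zCDP and $$\mathbb E\left(\|f-\hat f_{\hat M}\|^2\right)\le C_1\max\left\{n^{-\frac{2\beta}{2\beta+d}},\left(\frac{n\sqrt\rho}{\sqrt{\log_2 n}}\right)^{-\frac{2\beta}{\beta+d}}\right\}.$$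
   Context: Selection procedure: $\phi_k(x)=e^{i2\pi\langle k,x\rangle}$; $S_M=\mathrm{span}(\phi_k)_{k\in\{-M,\dots,M\}^d}$ with orthogonal projection $\Pi_{S_M}$. For each $M\in\mathcal M$, $\hat f_M=\sum_{k\in\{-M,\dots,M\}^d}(\tilde\theta_k+\sigma_M\xi_k)\phi_k$, $\tilde\theta_k=\frac1n\sum_j\overline{\phi_k(X_j)}$, $\sigma_M=\frac{2\sqrt{(2M+1)^d}}{n\sqrt{\rho/|\mathcal M|}}$, $\xi_k$ i.i.d. $\mathcal N(0,1)+i\mathcal N(0,1)$ (independent across $k$, $M$, data). $\Lambda^{(1)}(M)=\frac{96(2M+1)^d}{n}+\frac{96(2M+1)^{2d}}{n^2\rho/|\mathcal M|}$, $\Lambda^{(2)}(M)=\Lambda^{(1)}(M)+\frac{16(2M+1)^{2d}}{n^2\rho/|\mathcal M|}$, $B^2(M)=\max_{M'\in\mathcal M}\{\|\Pi_{S_{M'}}\hat f_M-\hat f_{M'}\|^2-\Lambda^{(1)}(M')\}$, $\hat M\in\arg\min_{M\in\mathcal M}\{B^2(M)+\Lambda^{(2)}(M)\}$. $\|\cdot\|$ is the $L^2([0,1]^d)$ norm. $\mathcal S^p_L(\beta)$: $f\in\mathcal C^\beta([0,1]^d)$ with $\sum_{|\alpha|=\beta}\int|\partial^\alpha f|^2\le L^2$ and $\partial^\alpha f(x)=\partial^\alpha f(x_1,\dots,1-x_i,\dots,x_d)$ whenever $|\alpha|<\beta$ and $x_i\in\{0,1\}$. $\rho$-zCDP: for datasets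 differing in at most one entry, Rényi divergence of order $\alpha$ between output laws $\le\rho\alpha$ for all $\alpha>1$. *)

theory Defs
  imports "HOL-Probability.Probability"
begin

definition cube :: "nat \<Rightarrow> (nat \<Rightarrow> real) set" where
  "cube d = PiE {..<d} (\<lambda>_. {0..1})"

definition leb :: "nat \<Rightarrow> (nat \<Rightarrow> real) measure" where
  "leb d = PiM {..<d} (\<lambda>_. lborel)"

definition l2sq :: "nat \<Rightarrow> ((nat \<Rightarrow> real) \<Rightarrow> complex) \<Rightarrow> real" where
  "l2sq d g = set_lebesgue_integral (leb d) (cube d) (\<lambda>x. (cmod (g x))^2)"

definition l2inner :: "nat \<Rightarrow> ((nat \<Rightarrow> real) \<Rightarrow> complex) \<Rightarrow> ((nat \<Rightarrow> real) \<Rightarrow> complex) \<Rightarrow> complex" where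
  "l2inner d g h = set_lebesgue_integral (leb d) (cube d) (\<lambda>x. g x * cnj (h x))"

definition supnorm :: "nat \<Rightarrow> ((nat \<Rightarrow> real) \<Rightarrow> real) \<Rightarrow> real" where
  "supnorm d f = (SUP x\<in>cube d. \<bar>f x\<bar>)"

definition phi :: "nat \<Rightarrow> (nat \<Rightarrow> int) \<Rightarrow> (nat \<Rightarrow> real) \<Rightarrow> complex" where
  "phi d k x = exp (2 * complex_of_real pi * \<i> * complex_of_real (\<Sum>i<d. real_of_int (k i) * x i))"

definition Kset :: "nat \<Rightarrow> nat \<Rightarrow> (nat \<Rightarrow> int) set" where
  "Kset d M = PiE {..<d} (\<lambda>_. {- int M..int M})"

definition Kall :: "nat \<Rightarrow> (nat \<Rightarrow> int) set" where
  "Kall d = PiE {..<d} (\<lambda>_. UNIV)"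

definition proj :: "nat \<Rightarrow> nat \<Rightarrow> ((nat \<Rightarrow> real) \<Rightarrow> complex) \<Rightarrow> (nat \<Rightarrow> real) \<Rightarrow> complex" where
  "proj d M g = (\<lambda>x. \<Sum>k\<in>Kset d M. l2inner d g (phi d k) * phi d k x)"

definition pd :: "nat \<Rightarrow> ((nat \<Rightarrow> real) \<Rightarrow> real) \<Rightarrow> (nat \<Rightarrow> real) \<Rightarrow> real" where
  "pd i g x = vector_derivative (\<lambda>t. g (x(i := t))) (at (x i) within {0..1})"

definition pdl :: "nat list \<Rightarrow> ((nat \<Rightarrow> real) \<Rightarrow> real) \<Rightarrow> (nat \<Rightarrow> real) \<Rightarrow> real" where
  "pdl is g = foldr pd is g"

definition Cbeta :: "nat \<Rightarrow> nat \<Rightarrow> ((nat \<Rightarrow> real) \<Rightarrow> real) \<Rightarrow> bool" where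
  "Cbeta d \<beta> g \<longleftrightarrow>
     (\<forall>is. set is \<subseteq> {..<d} \<and> length is \<le> \<beta> \<longrightarrow>
        continuous_on (cube d) (pdl is g) \<and>
        (length is < \<beta> \<longrightarrow> (\<forall>i<d. \<forall>x\<in>cube d.
           ((\<lambda>t. pdl is g (x(i := t))) has_vector_derivative pd i (pdl is g) x) (at (x i) within {0..1}))))"

definition MI :: "nat \<Rightarrow> nat \<Rightarrow> (nat \<Rightarrow> nat) set" where
  "MI d m = {\<alpha>. (\<forall>i\<ge>d. \<alpha> i = 0) \<and> (\<Sum>i<d. \<alpha> i) = m}"

definition pdiff :: "nat \<Rightarrow> (nat \<Rightarrow> nat) \<Rightarrow> ((nat \<Rightarrow> real) \<Rightarrow> real) \<Rightarrow> (nat \<Rightarrow> real) \<Rightarrow> real" where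
  "pdiff d \<alpha> g = pdl (concat (map (\<lambda>i. replicate (\<alpha> i) i) [0..<d])) g"

definition sobolev_per :: "nat \<Rightarrow> nat \<Rightarrow> real \<Rightarrow> ((nat \<Rightarrow> real) \<Rightarrow> real) \<Rightarrow> bool" where
  "sobolev_per d \<beta> L f \<longleftrightarrow>
     Cbeta d \<beta> f \<and>
     (\<Sum>\<alpha>\<in>MI d \<beta>. set_lebesgue_integral (leb d) (cube d) (\<lambda>x. (pdiff d \<alpha> f x)^2)) \<le> L^2 \<and>
     (\<forall>m<\<beta>. \<forall>\<alpha>\<in>MI d m. \<forall>x\<in>cube d. \<forall>i<d. x i \<in> {0,1} \<longrightarrow>
        pdiff d \<alpha> f x = pdiff d \<alpha> f (x(i := 1 - x i)))"

definition is_density :: "nat \<Rightarrow> ((nat \<Rightarrow> real) \<Rightarrow> real) \<Rightarrow> bool" where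
  "is_density d f \<longleftrightarrow> f \<in> borel_measurable (leb d) \<and> (\<forall>x\<in>cube d. 0 \<le> f x) \<and>
     set_lebesgue_integral (leb d) (cube d) f = 1"

definition std_normal :: "real measure" where
  "std_normal = density lborel (\<lambda>x. ennreal (std_normal_density x))"

definition cgauss :: "complex measure" where
  "cgauss = distr (pair_measure std_normal std_normal) borel (\<lambda>(a, b). Complex a b)"

definition obs_law :: "nat \<Rightarrow> ((nat \<Rightarrow> real) \<Rightarrow> real) \<Rightarrow> (nat \<Rightarrow> real) measure" where
  "obs_law d f = density (leb d) (\<lambda>x. ennreal (indicator (cube d) x * f x))"

definition sample_law :: "nat \<Rightarrow> nat \<Rightarrow> ((nat \<Rightarrow> real) \<Rightarrow> real) \<Rightarrow> (nat \<Rightarrow> (nat \<Rightarrow> real)) measure" where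
  "sample_law d n f = PiM {..<n} (\<lambda>_. obs_law d f)"

definition noise_law :: "nat \<Rightarrow> nat set \<Rightarrow> (nat \<times> (nat \<Rightarrow> int) \<Rightarrow> complex) measure" where
  "noise_law d Ms = PiM (Sigma Ms (\<lambda>M. Kset d M)) (\<lambda>_. cgauss)"

definition Mgrid :: "nat \<Rightarrow> nat \<Rightarrow> nat set" where
  "Mgrid d n = {2 ^ j | j::nat. int j \<le> \<lfloor>log 2 ((real n powr (1 / real d) - 1) / 2)\<rfloor>}"

definition theta_emp :: "nat \<Rightarrow> nat \<Rightarrow> (nat \<Rightarrow> (nat \<Rightarrow> real)) \<Rightarrow> (nat \<Rightarrow> int) \<Rightarrow> complex" where
  "theta_emp d n X k = (\<Sum>j<n. cnj (phi d k (X j))) / of_nat n"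

definition sigmaM :: "nat \<Rightarrow> nat \<Rightarrow> real \<Rightarrow> nat set \<Rightarrow> nat \<Rightarrow> real" where
  "sigmaM d n \<rho> Ms M = 2 * sqrt ((2 * real M + 1) ^ d) / (real n * sqrt (\<rho> / real (card Ms)))"

definition coef :: "nat \<Rightarrow> nat \<Rightarrow> real \<Rightarrow> nat set \<Rightarrow> (nat \<Rightarrow> (nat \<Rightarrow> real)) \<Rightarrow>
    (nat \<times> (nat \<Rightarrow> int) \<Rightarrow> complex) \<Rightarrow> nat \<Rightarrow> (nat \<Rightarrow> int) \<Rightarrow> complex" where
  "coef d n \<rho> Ms X \<xi> M k = theta_emp d n X k + complex_of_real (sigmaM d n \<rho> Ms M) * \<xi> (M, k)"

definition fhat :: "nat \<Rightarrow> nat \<Rightarrow> real \<Rightarrow> nat set \<Rightarrow> (nat \<Rightarrow> (nat \<Rightarrow> real)) \<Rightarrow>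
    (nat \<times> (nat \<Rightarrow> int) \<Rightarrow> complex) \<Rightarrow> nat \<Rightarrow> (nat \<Rightarrow> real) \<Rightarrow> complex" where
  "fhat d n \<rho> Ms X \<xi> M = (\<lambda>x. \<Sum>k\<in>Kset d M. coef d n \<rho> Ms X \<xi> M k * phi d k x)"

definition Lam1 :: "nat \<Rightarrow> nat \<Rightarrow> real \<Rightarrow> nat set \<Rightarrow> nat \<Rightarrow> real" where
  "Lam1 d n \<rho> Ms M = 96 * (2 * real M + 1) ^ d / real n
      + 96 * (2 * real M + 1) ^ (2 * d) / ((real n)^2 * \<rho> / real (card Ms))"

definition Lam2 :: "nat \<Rightarrow> nat \<Rightarrow> real \<Rightarrow> nat set \<Rightarrow> nat \<Rightarrow> real" where
  "Lam2 d n \<rho> Ms M = Lam1 d n \<rho> Ms M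
      + 16 * (2 * real M + 1) ^ (2 * d) / ((real n)^2 * \<rho> / real (card Ms))"

definition B2 :: "nat \<Rightarrow> nat \<Rightarrow> real \<Rightarrow> nat set \<Rightarrow> (nat \<Rightarrow> (nat \<Rightarrow> real)) \<Rightarrow>
    (nat \<times> (nat \<Rightarrow> int) \<Rightarrow> complex) \<Rightarrow> nat \<Rightarrow> real" where
  "B2 d n \<rho> Ms X \<xi> M = Max ((\<lambda>M'. l2sq d (\<lambda>x. proj d M' (fhat d n \<rho> Ms X \<xi> M) x - fhat d n \<rho> Ms X \<xi> M' x)
                                   - Lam1 d n \<rho> Ms M') ` Ms)"

definition Mhat :: "nat \<Rightarrow> nat \<Rightarrow> real \<Rightarrow> nat set \<Rightarrow> (nat \<Rightarrow> (nat \<Rightarrow> real)) \<Rightarrow>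
    (nat \<times> (nat \<Rightarrow> int) \<Rightarrow> complex) \<Rightarrow> nat" where
  "Mhat d n \<rho> Ms X \<xi> = (LEAST M. M \<in> Ms \<and> (\<forall>M'\<in>Ms.
      B2 d n \<rho> Ms X \<xi> M + Lam2 d n \<rho> Ms M \<le> B2 d n \<rho> Ms X \<xi> M' + Lam2 d n \<rho> Ms M'))"

definition fsel :: "nat \<Rightarrow> nat \<Rightarrow> real \<Rightarrow> nat set \<Rightarrow> (nat \<Rightarrow> (nat \<Rightarrow> real)) \<Rightarrow>
    (nat \<times> (nat \<Rightarrow> int) \<Rightarrow> complex) \<Rightarrow> (nat \<Rightarrow> real) \<Rightarrow> complex" where
  "fsel d n \<rho> Ms X \<xi> = fhat d n \<rho> Ms X \<xi> (Mhat d n \<rho> Ms X \<xi>)"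

text \<open>Fourier coefficient family (indexed by Z^d) of fhat_{Mhat}; this determines fhat_{Mhat}\<close>
definition fsel_coefs :: "nat \<Rightarrow> nat \<Rightarrow> real \<Rightarrow> nat set \<Rightarrow> (nat \<Rightarrow> (nat \<Rightarrow> real)) \<Rightarrow>
    (nat \<times> (nat \<Rightarrow> int) \<Rightarrow> complex) \<Rightarrow> (nat \<Rightarrow> int) \<Rightarrow> complex" where
  "fsel_coefs d n \<rho> Ms X \<xi> = (\<lambda>k\<in>Kall d.
      if k \<in> Kset d (Mhat d n \<rho> Ms X \<xi>) then coef d n \<rho> Ms X \<xi> (Mhat d n \<rho> Ms X \<xi>) k else 0)"

definition mech :: "nat \<Rightarrow> nat \<Rightarrow> real \<Rightarrow> nat set \<Rightarrow> (nat \<Rightarrow> (nat \<Rightarrow> real)) \<Rightarrow> ((nat \<Rightarrow> int) \<Rightarrow> complex) measure" where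
  "mech d n \<rho> Ms X = distr (noise_law d Ms) (PiM (Kall d) (\<lambda>_. borel)) (fsel_coefs d n \<rho> Ms X)"

definition risk :: "nat \<Rightarrow> nat \<Rightarrow> real \<Rightarrow> nat set \<Rightarrow> ((nat \<Rightarrow> real) \<Rightarrow> real) \<Rightarrow> ennreal" where
  "risk d n \<rho> Ms f = (\<integral>\<^sup>+ p. ennreal (l2sq d (\<lambda>x. complex_of_real (f x) - fsel d n \<rho> Ms (fst p) (snd p) x))
      \<partial>(pair_measure (sample_law d n f) (noise_law d Ms)))"

definition renyi :: "real \<Rightarrow> 'a measure \<Rightarrow> 'a measure \<Rightarrow> ereal" where
  "renyi \<alpha> P Q = (if absolutely_continuous Q P then
      (let I = (\<integral>\<^sup>+ x. ennreal (enn2real (RN_deriv Q P x) powr \<alpha>) \<partial>Q) in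
        if I = \<top> then \<infinity> else ereal (ln (enn2real I) / (\<alpha> - 1)))
    else \<infinity>)"

definition zCDP :: "nat \<Rightarrow> nat \<Rightarrow> real \<Rightarrow> ((nat \<Rightarrow> (nat \<Rightarrow> real)) \<Rightarrow> 'a measure) \<Rightarrow> bool" where
  "zCDP d n \<rho> A \<longleftrightarrow> (\<forall>X X'. (\<forall>j<n. X j \<in> cube d) \<and> (\<forall>j<n. X' j \<in> cube d) \<and>
      (\<exists>j0. \<forall>j<n. j \<noteq> j0 \<longrightarrow> X j = X' j) \<longrightarrow>
      (\<forall>\<alpha>>1. renyi \<alpha> (A X) (A X') \<le> ereal (\<rho> * \<alpha>)))"

end

theory Submission
  imports Defs
begin

text \<open>
  \<^emph>\<open>Privacy.\<close> All noisy coefficients together form one Gaussian vector, and replacing one observation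
  moves its mean by a vector whose squared length, weighted by the inverse noise variances, is at most
  \<open>\<rho>\<close>. The selected estimator is a post-processing of that vector, and post-processing does not increase
  Renyi divergences.

  \<^emph>\<open>Risk.\<close> Comparing the selected \<open>Mhat\<close> with a fixed grid element \<open>m\<close> (the spaces are nested, so one
  projection is trivial) bounds the loss by a multiple of bias and variance at \<open>m\<close> plus the excess, summed
  over the grid, of the empirical and Gaussian fluctuations over their penalties. The Gaussian excess is
  controlled by an exponential moment, the empirical one by the second moment of a degenerate U-statistic.
  The squared bias at \<open>m\<close> is at most \<open>L\<^sup>2 (2 \<pi> m)\<^sup>-\<^sup>2\<^sup>\<beta>\<close> by Parseval and integration by parts, and for
  the largest dyadic \<open>m\<close> with \<open>2 m + 1\<close> below the oracle frequency all terms have the claimed order with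
  constants that do not depend on \<open>d\<close>.
\<close>

section \<open>Data processing for Renyi divergences\<close>

text \<open>Two restrictions on the constants shape the estimates. \<open>C1\<close> may not involve
  \<open>d\<close>, so nothing may be lost to a power \<open>d\<close>: the dimension at the
  reference element is bounded by \<open>T ^ d\<close> without a constant, the bias uses a single
  large coordinate of the frequency, and rounding \<open>T\<close> down to a dyadic number is paid
  for by the factor 2 \<pi> of differentiation. The sup norm may enter only the threshold
  \<open>C2\<close>, so it may multiply only terms of smaller order: the empirical excess at each
  grid element is at most \<open>supnorm d f / (40 * real n)\<close>, and the at most
  \<open>log 2 (real n)\<close> such terms fall below the rate for large \<open>n\<close>. This
  needs the empirical kernel as a quadratic form of norm at most the sup norm; its trivial norm, the
  dimension, reaches order \<open>n\<close> at the top of the grid and would leave an excess that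
  does not vanish. The penalties fit these bounds: the first 96 is 4 times 24, the second 4 times 6
  times 4, where the leading 4 comes from splitting squares, 24 and 6 are the levels above which the
  excesses are counted, and the last 4 comes from the noise variance.\<close>

lemma young_powr:
  fixes r h \<alpha> :: real
  assumes "\<alpha> > 1" "r \<ge> 0" "h \<ge> 0"
  shows "\<alpha> * (r powr (\<alpha> - 1) * h) \<le> (\<alpha> - 1) * r powr \<alpha> + h powr \<alpha>"
proof (cases "r = 0 \<or> h = 0")
  case True
  then show ?thesis using assms by auto
next
  case False
  then have rh: "r > 0" "h > 0" using assms by auto
  have "r powr (\<alpha> - 1) * h = (r powr \<alpha>) powr ((\<alpha> - 1) / \<alpha>) * (h powr \<alpha>) powr (1 / \<alpha>)"
    using rh assms by (simp add: powr_powr)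
  also have "\<dots> \<le> (\<alpha> - 1) / \<alpha> * r powr \<alpha> + 1 / \<alpha> * h powr \<alpha>"
    using rh assms by (intro Youngs_inequality_0) (auto simp: divide_simps)
  finally have "\<alpha> * (r powr (\<alpha> - 1) * h) \<le> \<alpha> * ((\<alpha> - 1) / \<alpha> * r powr \<alpha> + 1 / \<alpha> * h powr \<alpha>)"
    using assms by (intro mult_left_mono) auto
  also have "\<dots> = (\<alpha> - 1) * r powr \<alpha> + h powr \<alpha>" using assms by (simp add: distrib_left)
  finally show ?thesis .
qed

text \<open>With \<open>D\<close> the derivative of \<open>P\<close> by \<open>Q\<close>, the
  integral J of \<open>D powr \<alpha>\<close> over \<open>Q\<close> equals the integral over \<nu>
  of \<open>h\<close> times the power \<alpha> - 1 of \<open>D\<close> composed with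
  \<open>g\<close>. By \<open>young_powr\<close>, \<alpha> J is at most (\<alpha> - 1) J + c, and J
  cancels. No conditional expectation along \<open>g\<close> is involved.\<close>

lemma nn_integral_RN_deriv_powr_le:
  fixes h :: "'a \<Rightarrow> real"
  assumes "prob_space \<nu>" and [measurable]: "h \<in> borel_measurable \<nu>" and h0: "\<And>x. h x \<ge> 0"
    and pm: "prob_space (density \<nu> (\<lambda>x. ennreal (h x)))"
    and g[measurable]: "g \<in> measurable \<nu> N" and \<alpha>: "\<alpha> > 1"
    and I: "(\<integral>\<^sup>+x. ennreal (h x powr \<alpha>) \<partial>\<nu>) \<le> ennreal c" 
    and Q: "Q = distr \<nu> N g" and P: "P = distr (density \<nu> (\<lambda>x. ennreal (h x))) N g"
  shows "absolutely_continuous Q P"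
    and "(\<integral>\<^sup>+ x. ennreal (enn2real (RN_deriv Q P x) powr \<alpha>) \<partial>Q) \<le> ennreal c"
proof -
  interpret \<nu>: prob_space \<nu> by fact
  interpret \<mu>: prob_space "density \<nu> (\<lambda>x. ennreal (h x))" by fact
  interpret Q: prob_space Q unfolding Q by (intro \<nu>.prob_space_distr g)
  interpret P: prob_space P unfolding P by (intro \<mu>.prob_space_distr) measurable
  have sQ[measurable_cong]: "sets Q = sets N" and sP[measurable_cong]: "sets P = sets N" by (auto simp: Q P)
  show ac: "absolutely_continuous Q P"
    unfolding absolutely_continuous_def
  proof
    fix A assume "A \<in> null_sets Q"
    then have A[measurable]: "A \<in> sets N" and e: "emeasure \<nu> (g -` A \<inter> space \<nu>) = 0"
      by (auto simp: Q null_sets_def emeasure_distr)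
    have n: "g -` A \<inter> space \<nu> \<in> null_sets \<nu>" using e by (auto simp: null_sets_def)
    have "g -` A \<inter> space \<nu> \<in> null_sets (density \<nu> (\<lambda>x. ennreal (h x)))"
      using n absolutely_continuousI_density[of "\<lambda>x. ennreal (h x)" \<nu>]
      unfolding absolutely_continuous_def by auto
    then show "A \<in> null_sets P" by (auto simp: P null_sets_def emeasure_distr)
  qed
  obtain D where D[measurable]: "D \<in> borel_measurable Q"
    and DR: "AE x in Q. RN_deriv Q P x = ennreal (D x)" and D0: "\<And>x. 0 \<le> D x"
    using Q.real_RN_deriv[OF P.finite_measure_axioms ac] by (metis sP sQ)
  have DP: "density Q (\<lambda>x. ennreal (D x)) = P"
  proof -
    have "density Q (\<lambda>x. ennreal (D x)) = density Q (RN_deriv Q P)"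
      using DR by (intro density_cong) auto
    then show ?thesis using Q.density_RN_deriv[OF ac] sP sQ by simp
  qed
  have DN[measurable]: "D \<in> borel_measurable N" using D by (simp cong: measurable_cong_sets add: sQ)
  \<comment> \<open>Truncation makes the integral finite, so that its multiple by \<alpha> - 1 can
    be subtracted; monotone convergence removes the truncation at the end.\<close>
  define r where "r n x = min (D x) (real n)" for n x
  have r0: "r n x \<ge> 0" for n x using D0 by (auto simp: r_def)
  have [measurable]: "r n \<in> borel_measurable N" for n unfolding r_def by measurable
  have bound: "(\<integral>\<^sup>+ x. ennreal (r n x powr \<alpha>) \<partial>Q) \<le> ennreal c" for n
  proof -
    let ?J = "\<integral>\<^sup>+ x. ennreal (r n x powr \<alpha>) \<partial>Q"
    have "?J \<le> (\<integral>\<^sup>+ x. ennreal (real n powr \<alpha>) \<partial>Q)"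
      using \<alpha> r0 by (intro nn_integral_mono ennreal_leI powr_mono2) (auto simp: r_def)
    also have "\<dots> = ennreal (real n powr \<alpha>)" by (simp add: Q.emeasure_space_1)
    finally have Jf: "?J < \<top>" by (simp add: le_less_trans)
    have "?J \<le> (\<integral>\<^sup>+ x. ennreal (D x) * ennreal (r n x powr (\<alpha> - 1)) \<partial>Q)"
    proof (intro nn_integral_mono)
      fix x
      have "r n x powr \<alpha> = r n x powr (1 + (\<alpha> - 1))" by simp
      also have "\<dots> = r n x powr 1 * r n x powr (\<alpha> - 1)" by (rule powr_add)
      also have "\<dots> \<le> D x * r n x powr (\<alpha> - 1)"
        using r0 by (intro mult_right_mono) (auto simp: r_def)
      finally show "ennreal (r n x powr \<alpha>) \<le> ennreal (D x) * ennreal (r n x powr (\<alpha> - 1))"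
        by (simp add: ennreal_mult'[symmetric] D0)
    qed
    also have "\<dots> = (\<integral>\<^sup>+ x. ennreal (r n x powr (\<alpha> - 1)) \<partial>P)"
      unfolding DP[symmetric] by (subst nn_integral_density) auto
    also have "\<dots> = (\<integral>\<^sup>+ x. ennreal (h x) * ennreal (r n (g x) powr (\<alpha> - 1)) \<partial>\<nu>)"
      unfolding P by (subst nn_integral_distr) (auto simp: nn_integral_density)
    finally have 1: "ennreal \<alpha> * ?J \<le> ennreal \<alpha> * (\<integral>\<^sup>+ x. ennreal (h x) * ennreal (r n (g x) powr (\<alpha> - 1)) \<partial>\<nu>)"
      by (intro mult_left_mono) auto
    also have "\<dots> = (\<integral>\<^sup>+ x. ennreal \<alpha> * (ennreal (h x) * ennreal (r n (g x) powr (\<alpha> - 1))) \<partial>\<nu>)"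
      by (subst nn_integral_cmult) auto
    also have "\<dots> \<le> (\<integral>\<^sup>+ x. ennreal (\<alpha> - 1) * ennreal (r n (g x) powr \<alpha>) + ennreal (h x powr \<alpha>) \<partial>\<nu>)"
    proof (intro nn_integral_mono)
      fix x
      show "ennreal \<alpha> * (ennreal (h x) * ennreal (r n (g x) powr (\<alpha> - 1)))
        \<le> ennreal (\<alpha> - 1) * ennreal (r n (g x) powr \<alpha>) + ennreal (h x powr \<alpha>)"
        using young_powr[OF \<alpha> r0 h0, of n "g x" x] \<alpha> h0 
        by (simp add: ennreal_mult'[symmetric] ennreal_plus[symmetric] mult_ac del: ennreal_plus)
    qed
    also have "\<dots> = ennreal (\<alpha> - 1) * (\<integral>\<^sup>+ x. ennreal (r n (g x) powr \<alpha>) \<partial>\<nu>) + (\<integral>\<^sup>+ x. ennreal (h x powr \<alpha>) \<partial>\<nu>)"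
      by (subst nn_integral_add) (auto simp: nn_integral_cmult)
    also have "(\<integral>\<^sup>+ x. ennreal (r n (g x) powr \<alpha>) \<partial>\<nu>) = ?J"
      unfolding Q by (subst nn_integral_distr) auto
    finally have 2: "ennreal \<alpha> * ?J \<le> ennreal (\<alpha> - 1) * ?J + ennreal c"
      using I by (meson add_left_mono order_trans)
    obtain j where j: "?J = ennreal j" "j \<ge> 0" using Jf by (metis ennreal_cases less_irrefl top.not_eq_extremum infinity_ennreal_def)
    show ?thesis
    proof (cases "c \<ge> 0")
      case True
      have "ennreal (\<alpha> * j) \<le> ennreal ((\<alpha> - 1) * j + c)"
        using 2 \<alpha> True j by (simp add: ennreal_mult' ennreal_plus)
      then have "\<alpha> * j \<le> (\<alpha> - 1) * j + c" using True j \<alpha> by (subst (asm) ennreal_le_iff) auto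
      then show ?thesis using j by (simp add: algebra_simps ennreal_leI)
    next
      \<comment> \<open>Here \<open>ennreal c\<close> is \<open>0\<close>, and the same cancellation
        forces \<open>j\<close> to be \<open>0\<close>.\<close>
      case False
      then have "ennreal \<alpha> * ?J \<le> ennreal (\<alpha> - 1) * ?J" using 2 by (simp add: ennreal_neg)
      then have "\<alpha> * j \<le> (\<alpha> - 1) * j" using j \<alpha> by (simp add: ennreal_mult'[symmetric] ennreal_le_iff)
      then show ?thesis using j by (simp add: algebra_simps)
    qed
  qed
  have "(\<integral>\<^sup>+ x. ennreal (enn2real (RN_deriv Q P x) powr \<alpha>) \<partial>Q) = (\<integral>\<^sup>+ x. ennreal (D x powr \<alpha>) \<partial>Q)"
    using DR by (intro nn_integral_cong_AE) (auto simp: D0)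
  also have "\<dots> = (\<integral>\<^sup>+ x. (SUP n. ennreal (r n x powr \<alpha>)) \<partial>Q)"
  proof (intro nn_integral_cong)
    fix x
    obtain m where m: "D x \<le> real m" using real_arch_simple by blast
    show "ennreal (D x powr \<alpha>) = (SUP n. ennreal (r n x powr \<alpha>))"
    proof (rule antisym)
      show "ennreal (D x powr \<alpha>) \<le> (SUP n. ennreal (r n x powr \<alpha>))"
        by (rule SUP_upper2[of m]) (use m in \<open>auto simp: r_def\<close>)
      show "(SUP n. ennreal (r n x powr \<alpha>)) \<le> ennreal (D x powr \<alpha>)"
        using \<alpha> r0 by (intro SUP_least ennreal_leI powr_mono2) (auto simp: r_def)
    qed
  qed
  also have "\<dots> = (SUP n. \<integral>\<^sup>+ x. ennreal (r n x powr \<alpha>) \<partial>Q)"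
    using \<alpha> D0 by (intro nn_integral_monotone_convergence_SUP)
      (auto simp: incseq_def le_fun_def r_def intro!: ennreal_leI powr_mono2)
  also have "\<dots> \<le> ennreal c" using bound by (intro SUP_least)
  finally show "(\<integral>\<^sup>+ x. ennreal (enn2real (RN_deriv Q P x) powr \<alpha>) \<partial>Q) \<le> ennreal c" .
qed

lemma renyi_distr_density_le:
  fixes h :: "'a \<Rightarrow> real"
  assumes "prob_space \<nu>" and "h \<in> borel_measurable \<nu>" and "\<And>x. h x \<ge> 0"
    and "prob_space (density \<nu> (\<lambda>x. ennreal (h x)))"
    and "g \<in> measurable \<nu> N" and \<alpha>: "\<alpha> > 1"
    and "(\<integral>\<^sup>+x. ennreal (h x powr \<alpha>) \<partial>\<nu>) \<le> ennreal (exp ((\<alpha> - 1) * c))" and c: "c \<ge> 0"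
  shows "renyi \<alpha> (distr (density \<nu> (\<lambda>x. ennreal (h x))) N g) (distr \<nu> N g) \<le> ereal c"
proof -
  let ?P = "distr (density \<nu> (\<lambda>x. ennreal (h x))) N g" and ?Q = "distr \<nu> N g"
  note * = nn_integral_RN_deriv_powr_le[OF assms(1-7) refl refl]
  define I where "I = (\<integral>\<^sup>+ x. ennreal (enn2real (RN_deriv ?Q ?P x) powr \<alpha>) \<partial>?Q)"
  have I: "I \<le> ennreal (exp ((\<alpha> - 1) * c))" using *(2) by (simp add: I_def)
  then have "I \<noteq> \<top>" using neq_top_trans by force
  moreover have "ln (enn2real I) / (\<alpha> - 1) \<le> c"
  proof (cases "enn2real I > 0")
    case True
    have "enn2real I \<le> exp ((\<alpha> - 1) * c)" using I by (simp add: enn2real_leI)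
    then have "ln (enn2real I) \<le> (\<alpha> - 1) * c" using True by (metis ln_exp ln_le_cancel_iff exp_gt_zero)
    then show ?thesis using \<alpha> by (simp add: divide_simps mult.commute)
  next
    \<comment> \<open>\<open>ln 0\<close> is \<open>0\<close>, so \<open>c \<ge> 0\<close> settles
      this degenerate case.\<close>
    case False
    then have "enn2real I = 0" by (simp add: order.antisym leI)
    then show ?thesis using c by simp
  qed
  ultimately show ?thesis using *(1) by (simp add: renyi_def I_def[symmetric] Let_def)
qed

section \<open>Gaussian noise\<close>

lemma prob_space_std_normal: "prob_space std_normal"
  unfolding std_normal_def by (rule prob_space_normal_density) simp

lemma sets_std_normal [simp, measurable_cong]: "sets std_normal = sets borel"
  by (simp add: std_normal_def)

lemma space_std_normal [simp]: "space std_normal = UNIV"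
  by (simp add: std_normal_def)

lemma prob_space_cgauss: "prob_space cgauss"
proof -
  interpret std_normal: prob_space std_normal by (rule prob_space_std_normal)
  interpret pair_prob_space std_normal std_normal ..
  show ?thesis unfolding cgauss_def by (rule prob_space_distr) (simp add: Complex_eq case_prod_beta')
qed

lemma sets_cgauss [simp, measurable_cong]: "sets cgauss = sets borel"
  by (simp add: cgauss_def)

lemma space_cgauss [simp]: "space cgauss = UNIV"
  by (simp add: cgauss_def)

lemma nn_integral_std_normal:
  assumes [measurable]: "u \<in> borel_measurable borel"
  shows "(\<integral>\<^sup>+a. u a \<partial>std_normal) = (\<integral>\<^sup>+a. ennreal (std_normal_density a) * u a \<partial>lborel)"
  unfolding std_normal_def by (subst nn_integral_density) auto

lemma nn_integral_cgauss:
  assumes [measurable]: "u \<in> borel_measurable borel"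
  shows "(\<integral>\<^sup>+z. u z \<partial>cgauss) = (\<integral>\<^sup>+a. \<integral>\<^sup>+b. u (Complex a b) \<partial>std_normal \<partial>std_normal)"
proof -
  interpret std_normal: prob_space std_normal by (rule prob_space_std_normal)
  interpret pair_prob_space std_normal std_normal ..
  have [measurable]: "(\<lambda>x. Complex (fst x) (snd x)) \<in> borel_measurable (std_normal \<Otimes>\<^sub>M std_normal)"
    by (simp add: Complex_eq)
  show ?thesis
    unfolding cgauss_def
    by (simp add: nn_integral_distr case_prod_beta' std_normal.nn_integral_fst[symmetric])
qed

text \<open>Cameron-Martin formula in dimension one: completing the square turns a translation into
  an exponential tilt.\<close>

lemma nn_integral_std_normal_shift:
  assumes [measurable]: "u \<in> borel_measurable borel"
  shows "(\<integral>\<^sup>+a. u (a + s) \<partial>std_normal) = (\<integral>\<^sup>+a. ennreal (exp (s * a - s\<^sup>2 / 2)) * u a \<partial>std_normal)"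
proof -
  have "(\<integral>\<^sup>+a. ennreal (exp (s * a - s\<^sup>2 / 2)) * u a \<partial>std_normal)
      = (\<integral>\<^sup>+a. ennreal (std_normal_density a) * (ennreal (exp (s * a - s\<^sup>2 / 2)) * u a) \<partial>lborel)"
    by (subst nn_integral_std_normal) auto
  also have "\<dots> = (\<integral>\<^sup>+a. ennreal (std_normal_density (s + a)) * (ennreal (exp (s * (s + a) - s\<^sup>2 / 2)) * u (s + a)) \<partial>lborel)"
    by (subst nn_integral_real_affine[where c=1 and t=s]) auto
  also have "\<dots> = (\<integral>\<^sup>+a. ennreal (std_normal_density a) * u (a + s) \<partial>lborel)"
  proof (intro nn_integral_cong)
    fix a
    have "std_normal_density (s + a) * exp (s * (s + a) - s\<^sup>2 / 2) = std_normal_density a"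
      by (simp add: std_normal_density_def exp_add[symmetric] field_simps power2_eq_square)
    then show "ennreal (std_normal_density (s + a)) * (ennreal (exp (s * (s + a) - s\<^sup>2 / 2)) * u (s + a))
       = ennreal (std_normal_density a) * u (a + s)"
      by (simp add: mult.assoc[symmetric] ennreal_mult''[symmetric] add.commute)
  qed
  also have "\<dots> = (\<integral>\<^sup>+a. u (a + s) \<partial>std_normal)"
    by (subst nn_integral_std_normal) auto
  finally show ?thesis by simp
qed

text \<open>Likelihood ratio of the standard complex Gaussian translated by \<open>s\<close> to the
  untranslated one; the inner product is that of the real plane.\<close>

definition gauss_ratio :: "complex \<Rightarrow> complex \<Rightarrow> real" where
  "gauss_ratio s z = exp (s \<bullet> z - (cmod s)\<^sup>2 / 2)"

lemma gauss_ratio_pos: "gauss_ratio s z > 0" by (simp add: gauss_ratio_def)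

lemma borel_measurable_gauss_ratio [measurable]: "gauss_ratio s \<in> borel_measurable borel"
  unfolding gauss_ratio_def by measurable

lemma nn_integral_cgauss_shift:
  assumes [measurable]: "u \<in> borel_measurable borel"
  shows "(\<integral>\<^sup>+z. u (z + s) \<partial>cgauss) = (\<integral>\<^sup>+z. ennreal (gauss_ratio s z) * u z \<partial>cgauss)"
proof -
  interpret std_normal: prob_space std_normal by (rule prob_space_std_normal)
  have [measurable]: "(\<lambda>x. Complex (f x) (g x)) \<in> borel_measurable M"
    if "f \<in> borel_measurable M" "g \<in> borel_measurable M" for f g and M :: "'z measure"
    using that by (simp add: Complex_eq)
  have "(\<integral>\<^sup>+z. u (z + s) \<partial>cgauss)
     = (\<integral>\<^sup>+a. \<integral>\<^sup>+b. u (Complex (a + Re s) (b + Im s)) \<partial>std_normal \<partial>std_normal)"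
    by (subst nn_integral_cgauss) (auto simp: complex_eq_iff plus_complex.code intro!: nn_integral_cong arg_cong[where f=u])
  also have "\<dots> = (\<integral>\<^sup>+a. ennreal (exp (Re s * a - (Re s)\<^sup>2 / 2)) *
      (\<integral>\<^sup>+b. u (Complex a (b + Im s)) \<partial>std_normal) \<partial>std_normal)"
    by (subst nn_integral_std_normal_shift) auto
  also have "\<dots> = (\<integral>\<^sup>+a. ennreal (exp (Re s * a - (Re s)\<^sup>2 / 2)) *
      (\<integral>\<^sup>+b. ennreal (exp (Im s * b - (Im s)\<^sup>2 / 2)) * u (Complex a b) \<partial>std_normal) \<partial>std_normal)"
    by (subst nn_integral_std_normal_shift) auto
  also have "\<dots> = (\<integral>\<^sup>+a. (\<integral>\<^sup>+b. ennreal (exp (Re s * a - (Re s)\<^sup>2 / 2)) *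
      (ennreal (exp (Im s * b - (Im s)\<^sup>2 / 2)) * u (Complex a b)) \<partial>std_normal) \<partial>std_normal)"
    by (subst nn_integral_cmult) auto
  also have "\<dots> = (\<integral>\<^sup>+a. (\<integral>\<^sup>+b. ennreal (gauss_ratio s (Complex a b)) * u (Complex a b) \<partial>std_normal) \<partial>std_normal)"
  proof (intro nn_integral_cong)
    fix a b
    have "gauss_ratio s (Complex a b) = exp ((Re s * a - (Re s)\<^sup>2 / 2) + (Im s * b - (Im s)\<^sup>2 / 2))"
      unfolding gauss_ratio_def by (rule arg_cong[where f=exp]) (simp add: inner_complex_def cmod_power2 field_simps)
    then show "ennreal (exp (Re s * a - (Re s)\<^sup>2 / 2)) * (ennreal (exp (Im s * b - (Im s)\<^sup>2 / 2)) * u (Complex a b))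
       = ennreal (gauss_ratio s (Complex a b)) * u (Complex a b)"
      by (simp only: exp_add ennreal_mult'[OF exp_ge_zero] mult.assoc)
  qed
  also have "\<dots> = (\<integral>\<^sup>+z. ennreal (gauss_ratio s z) * u z \<partial>cgauss)"
    by (subst nn_integral_cgauss) auto
  finally show ?thesis .
qed

lemma nn_integral_gauss_ratio: "(\<integral>\<^sup>+z. ennreal (gauss_ratio s z) \<partial>cgauss) = 1"
proof -
  interpret cgauss: prob_space cgauss by (rule prob_space_cgauss)
  show ?thesis using nn_integral_cgauss_shift[of "\<lambda>_. 1" s] cgauss.emeasure_space_1 by simp
qed

text \<open>A power of the ratio is, up to a constant, the ratio for the shift multiplied by
  \<alpha>, and that one integrates to 1. The constant is what produces the Renyi divergence
  \<alpha> |s|^2 / 2.\<close>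

lemma gauss_ratio_powr:
  "gauss_ratio s z powr \<alpha> = exp (\<alpha> * (\<alpha> - 1) / 2 * (cmod s)\<^sup>2) * gauss_ratio (\<alpha> *\<^sub>R s) z"
  by (simp add: gauss_ratio_def powr_def exp_add[symmetric] power_mult_distrib field_simps power2_eq_square)

lemma nn_integral_gauss_ratio_powr:
  "(\<integral>\<^sup>+z. ennreal (gauss_ratio s z powr \<alpha>) \<partial>cgauss) = ennreal (exp (\<alpha> * (\<alpha> - 1) / 2 * (cmod s)\<^sup>2))"
proof -
  have "(\<integral>\<^sup>+z. ennreal (gauss_ratio s z powr \<alpha>) \<partial>cgauss)
     = (\<integral>\<^sup>+z. ennreal (exp (\<alpha> * (\<alpha> - 1) / 2 * (cmod s)\<^sup>2)) * ennreal (gauss_ratio (\<alpha> *\<^sub>R s) z) \<partial>cgauss)"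
    unfolding gauss_ratio_powr by (intro nn_integral_cong ennreal_mult) (auto intro: less_imp_le gauss_ratio_pos)
  also have "\<dots> = ennreal (exp (\<alpha> * (\<alpha> - 1) / 2 * (cmod s)\<^sup>2))"
    by (subst nn_integral_cmult) (auto simp: nn_integral_gauss_ratio)
  finally show ?thesis .
qed

lemma prob_space_PiM_cgauss: "prob_space (PiM I (\<lambda>_. cgauss))"
  by (intro prob_space_PiM prob_space_cgauss)

text \<open>Both sides agree on boxes with the product of the tilted laws \<open>?N i\<close>, which
  determines them.\<close>

lemma distr_PiM_cgauss_shift:
  assumes fin: "finite I"
  shows "distr (PiM I (\<lambda>_. cgauss)) (PiM I (\<lambda>_. cgauss)) (\<lambda>x. \<lambda>i\<in>I. x i + s i)
     = density (PiM I (\<lambda>_. cgauss)) (\<lambda>x. ennreal (\<Prod>i\<in>I. gauss_ratio (s i) (x i)))"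
    (is "?D = ?E")
proof -
  interpret cgauss: prob_space cgauss by (rule prob_space_cgauss)
  interpret G: product_prob_space "\<lambda>_. cgauss" I by standard
  interpret G: finite_product_prob_space "\<lambda>_. cgauss" I by standard fact
  let ?N = "\<lambda>i. density cgauss (\<lambda>z. ennreal (gauss_ratio (s i) z))"
  have pN: "prob_space (?N i)" for i
    by (rule prob_spaceI) (simp add: emeasure_density nn_integral_gauss_ratio)
  interpret N: product_sigma_finite ?N
    unfolding product_sigma_finite_def using pN by (auto intro: prob_space_imp_sigma_finite)
  have sN: "sets (PiM I (\<lambda>_. cgauss)) = sets (PiM I ?N)" by (intro sets_PiM_cong) auto
  have m[measurable]: "(\<lambda>x. \<lambda>i\<in>I. x i + s i) \<in> measurable (PiM I (\<lambda>_. cgauss)) (PiM I (\<lambda>_. cgauss))"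
    by (intro measurable_restrict) measurable
  have "?D = PiM I ?N"
  proof (rule N.PiM_eqI[OF fin])
    show "sets ?D = sets (PiM I ?N)" using sN by simp
    fix A assume A: "\<And>i. i \<in> I \<Longrightarrow> A i \<in> sets (?N i)"
    then have A'[measurable]: "i \<in> I \<Longrightarrow> A i \<in> sets borel" for i by simp
    have vm: "(\<lambda>z. z + s i) -` A i \<in> sets borel" if "i \<in> I" for i
      using measurable_sets[of "\<lambda>z. z + s i" borel borel "A i"] A'[OF that] by simp
    have "emeasure ?D (Pi\<^sub>E I A) = emeasure (PiM I (\<lambda>_. cgauss)) (Pi\<^sub>E I (\<lambda>i. (\<lambda>z. z + s i) -` A i \<inter> space cgauss))"
      using A' by (subst emeasure_distr) (auto intro!: sets_PiM_I_finite fin arg_cong2[where f=emeasure] simp: space_PiM PiE_iff extensional_def)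
    also have "\<dots> = (\<Prod>i\<in>I. emeasure cgauss ((\<lambda>z. z + s i) -` A i \<inter> space cgauss))"
      using A' by (subst G.emeasure_PiM) (auto simp: fin vm)
    also have "\<dots> = (\<Prod>i\<in>I. emeasure (?N i) (A i))"
    proof (intro prod.cong refl)
      fix i assume i: "i \<in> I"
      note [measurable] = A'[OF i]
      have "emeasure cgauss ((\<lambda>z. z + s i) -` A i \<inter> space cgauss) = (\<integral>\<^sup>+z. indicator (A i) (z + s i) \<partial>cgauss)"
        using vm[OF i] by (subst nn_integral_indicator[symmetric]) (auto intro!: nn_integral_cong simp: indicator_def simp del: nn_integral_indicator)
      also have "\<dots> = emeasure (?N i) (A i)"
        by (subst nn_integral_cgauss_shift) (auto simp: emeasure_density)
      finally show "emeasure cgauss ((\<lambda>z. z + s i) -` A i \<inter> space cgauss) = emeasure (?N i) (A i)" .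
    qed
    finally show "emeasure ?D (Pi\<^sub>E I A) = (\<Prod>i\<in>I. emeasure (?N i) (A i))" .
  qed
  moreover have "?E = PiM I ?N"
  proof (rule N.PiM_eqI[OF fin])
    show "sets ?E = sets (PiM I ?N)" using sN by simp
    fix A assume A: "\<And>i. i \<in> I \<Longrightarrow> A i \<in> sets (?N i)"
    then have A'[measurable]: "i \<in> I \<Longrightarrow> A i \<in> sets borel" for i by simp
    have "emeasure ?E (Pi\<^sub>E I A) = (\<integral>\<^sup>+x. ennreal (\<Prod>i\<in>I. gauss_ratio (s i) (x i)) * indicator (Pi\<^sub>E I A) x \<partial>PiM I (\<lambda>_. cgauss))"
      using A' by (subst emeasure_density) (auto intro!: sets_PiM_I_finite fin)
    also have "\<dots> = (\<integral>\<^sup>+x. (\<Prod>i\<in>I. ennreal (gauss_ratio (s i) (x i)) * indicator (A i) (x i)) \<partial>PiM I (\<lambda>_. cgauss))"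
    proof (intro nn_integral_cong)
      fix x assume "x \<in> space (PiM I (\<lambda>_. cgauss))"
      then have "indicator (Pi\<^sub>E I A) x = (\<Prod>i\<in>I. indicator (A i) (x i) :: ennreal)"
        using fin by (auto simp: indicator_def PiE_iff space_PiM prod_zero_iff)
      then show "ennreal (\<Prod>i\<in>I. gauss_ratio (s i) (x i)) * indicator (Pi\<^sub>E I A) x =
          (\<Prod>i\<in>I. ennreal (gauss_ratio (s i) (x i)) * indicator (A i) (x i))"
        by (simp add: prod.distrib prod_ennreal less_imp_le[OF gauss_ratio_pos])
    qed
    also have "\<dots> = (\<Prod>i\<in>I. emeasure (?N i) (A i))"
      using A' fin by (subst G.product_nn_integral_prod) (auto simp: emeasure_density)
    finally show "emeasure ?E (Pi\<^sub>E I A) = (\<Prod>i\<in>I. emeasure (?N i) (A i))" .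
  qed
  ultimately show ?thesis by simp
qed

lemma nn_integral_prod_gauss_ratio_powr:
  assumes fin: "finite I"
  shows "(\<integral>\<^sup>+x. ennreal ((\<Prod>i\<in>I. gauss_ratio (s i) (x i)) powr \<alpha>) \<partial>PiM I (\<lambda>_. cgauss))
     = ennreal (exp (\<alpha> * (\<alpha> - 1) / 2 * (\<Sum>i\<in>I. (cmod (s i))\<^sup>2)))"
proof -
  interpret cgauss: prob_space cgauss by (rule prob_space_cgauss)
  interpret G: product_prob_space "\<lambda>_. cgauss" I by standard
  have "(\<integral>\<^sup>+x. ennreal ((\<Prod>i\<in>I. gauss_ratio (s i) (x i)) powr \<alpha>) \<partial>PiM I (\<lambda>_. cgauss))
     = (\<integral>\<^sup>+x. (\<Prod>i\<in>I. ennreal (gauss_ratio (s i) (x i) powr \<alpha>)) \<partial>PiM I (\<lambda>_. cgauss))"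
    by (intro nn_integral_cong) (simp add: prod_ennreal prod_powr_distrib less_imp_le[OF gauss_ratio_pos])
  also have "\<dots> = (\<Prod>i\<in>I. ennreal (exp (\<alpha> * (\<alpha> - 1) / 2 * (cmod (s i))\<^sup>2)))"
    using fin by (subst G.product_nn_integral_prod) (auto simp: nn_integral_gauss_ratio_powr)
  finally show ?thesis using fin by (simp add: prod_ennreal exp_sum sum_distrib_left)
qed

section \<open>Exponential moment of the noise and its excess over the penalty level\<close>

lemma nn_integral_std_normal_exp_square:
  "(\<integral>\<^sup>+a. ennreal (exp (a\<^sup>2 / 4)) \<partial>std_normal) = ennreal (sqrt 2)"
proof -
  interpret N: prob_space "density lborel (\<lambda>x. ennreal (normal_density 0 (sqrt 2) x))"
    by (rule prob_space_normal_density) simp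
  have "(\<integral>\<^sup>+a. ennreal (exp (a\<^sup>2 / 4)) \<partial>std_normal)
     = (\<integral>\<^sup>+a. ennreal (std_normal_density a) * ennreal (exp (a\<^sup>2 / 4)) \<partial>lborel)"
    by (subst nn_integral_std_normal) auto
  also have "\<dots> = (\<integral>\<^sup>+a. ennreal (sqrt 2) * ennreal (normal_density 0 (sqrt 2) a) \<partial>lborel)"
  proof (intro nn_integral_cong)
    fix a :: real
    \<comment> \<open>The factor doubles the variance from 1 to 2; \<open>sqrt 2\<close> is the
      quotient of the normalising constants.\<close>
    have "std_normal_density a * exp (a\<^sup>2 / 4) = sqrt 2 * normal_density 0 (sqrt 2) a"
      by (simp add: normal_density_def exp_add[symmetric] real_sqrt_mult field_simps)
    then show "ennreal (std_normal_density a) * ennreal (exp (a\<^sup>2 / 4)) = ennreal (sqrt 2) * ennreal (normal_density 0 (sqrt 2) a)"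
      by (simp add: ennreal_mult'[symmetric])
  qed
  also have "\<dots> = ennreal (sqrt 2)"
    using N.emeasure_space_1 by (subst nn_integral_cmult) (auto simp: emeasure_density)
  finally show ?thesis .
qed

lemma nn_integral_cgauss_exp_square:
  "(\<integral>\<^sup>+z. ennreal (exp ((cmod z)\<^sup>2 / 4)) \<partial>cgauss) = 2"
proof -
  have "(\<integral>\<^sup>+z. ennreal (exp ((cmod z)\<^sup>2 / 4)) \<partial>cgauss)
     = (\<integral>\<^sup>+a. \<integral>\<^sup>+b. ennreal (exp (a\<^sup>2 / 4)) * ennreal (exp (b\<^sup>2 / 4)) \<partial>std_normal \<partial>std_normal)"
    by (subst nn_integral_cgauss)
      (auto simp: cmod_power2 add_divide_distrib exp_add ennreal_mult intro!: nn_integral_cong)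
  also have "\<dots> = ennreal (sqrt 2) * ennreal (sqrt 2)"
    by (simp add: nn_integral_cmult nn_integral_multc nn_integral_std_normal_exp_square)
  finally show ?thesis by (simp add: ennreal_mult'[symmetric])
qed

text \<open>\<open>ennreal\<close> cuts off negative values, so a positive part is integrated. The
  inequality y \<le> 4 exp(y / 4) brings in the exponential moment, which is 2 per coordinate, and 6
  is large enough for 2 exp(- 6 / 4) \<le> 1 / 2.\<close>

lemma nn_integral_noise_excess_le:
  assumes fin: "finite I" and J: "J \<subseteq> I"
  shows "(\<integral>\<^sup>+x. ennreal ((\<Sum>i\<in>J. (cmod (x i))\<^sup>2) - 6 * real (card J)) \<partial>PiM I (\<lambda>_. cgauss))
     \<le> ennreal (4 * (1 / 2) ^ card J)"
proof -
  interpret cgauss: prob_space cgauss by (rule prob_space_cgauss)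
  interpret G: product_prob_space "\<lambda>_. cgauss" I by standard
  have finJ: "finite J" using fin J finite_subset by auto
  let ?m = "card J"
  \<comment> \<open>13/8 is 1 + 1/2 + 1/8, the quadratic Taylor bound for exp(1/2), and its cube
    exceeds 4.\<close>
  have "(13 / 8) ^ 3 \<le> (exp (1 / 2) :: real) ^ 3"
    using exp_lower_Taylor_quadratic[of "1/2 :: real"] by (intro power_mono) (auto simp: power2_eq_square)
  also have "\<dots> = exp (3 / 2 :: real)" by (subst exp_of_nat_mult[symmetric]) simp
  finally have "4 \<le> exp (3 / 2 :: real)" by (simp add: power3_eq_cube)
  then have e: "exp (- (3 / 2)) \<le> (1 / 4 :: real)" by (simp add: exp_minus field_simps)
  have "exp (- (6 * real ?m) / 4) = exp (- (3 / 2 :: real)) ^ ?m"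
    by (simp add: exp_of_nat_mult[symmetric])
  also have "\<dots> \<le> (1 / 4) ^ ?m" using e by (intro power_mono) auto
  finally have e2: "exp (- (6 * real ?m) / 4) * 2 ^ ?m \<le> (1 / 4) ^ ?m * 2 ^ ?m" by (intro mult_right_mono) auto
  have "(\<integral>\<^sup>+x. ennreal ((\<Sum>i\<in>J. (cmod (x i))\<^sup>2) - 6 * real ?m) \<partial>PiM I (\<lambda>_. cgauss))
     \<le> (\<integral>\<^sup>+x. ennreal (4 * exp (- (6 * real ?m) / 4)) * (\<Prod>i\<in>I. if i \<in> J then ennreal (exp ((cmod (x i))\<^sup>2 / 4)) else 1) \<partial>PiM I (\<lambda>_. cgauss))"
  proof (intro nn_integral_mono)
    fix x :: "'a \<Rightarrow> complex"
    let ?S = "\<Sum>i\<in>J. (cmod (x i))\<^sup>2"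
    have "y \<le> 4 * exp (y / 4)" for y :: real using exp_ge_add_one_self[of "y / 4"] by linarith
    then have "?S - 6 * real ?m \<le> 4 * exp ((?S - 6 * real ?m) / 4)" .
    also have "\<dots> = 4 * exp (- (6 * real ?m) / 4) * (\<Prod>i\<in>J. exp ((cmod (x i))\<^sup>2 / 4))"
    proof -
      have "(?S - 6 * real ?m) / 4 = - (6 * real ?m) / 4 + (\<Sum>i\<in>J. (cmod (x i))\<^sup>2 / 4)"
        by (simp add: sum_divide_distrib[symmetric] diff_divide_distrib)
      then show ?thesis by (simp only: exp_add exp_sum[OF finJ] mult.assoc)
    qed
    finally have "ennreal (?S - 6 * real ?m) \<le> ennreal (4 * exp (- (6 * real ?m) / 4)) * ennreal (\<Prod>i\<in>J. exp ((cmod (x i))\<^sup>2 / 4))"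
      by (simp add: ennreal_mult'[symmetric] ennreal_leI)
    also have "ennreal (\<Prod>i\<in>J. exp ((cmod (x i))\<^sup>2 / 4)) = (\<Prod>i\<in>I. if i \<in> J then ennreal (exp ((cmod (x i))\<^sup>2 / 4)) else 1)"
      using J fin by (simp add: prod_ennreal[symmetric] prod.inter_restrict[symmetric] Int_absorb1)
    finally show "ennreal (?S - 6 * real ?m) \<le> ennreal (4 * exp (- (6 * real ?m) / 4)) * (\<Prod>i\<in>I. if i \<in> J then ennreal (exp ((cmod (x i))\<^sup>2 / 4)) else 1)" .
  qed
  also have "\<dots> = ennreal (4 * exp (- (6 * real ?m) / 4)) *
      (\<integral>\<^sup>+x. (\<Prod>i\<in>I. if i \<in> J then ennreal (exp ((cmod (x i))\<^sup>2 / 4)) else 1) \<partial>PiM I (\<lambda>_. cgauss))"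
    using fin by (intro nn_integral_cmult) measurable
  also have "(\<integral>\<^sup>+x. (\<Prod>i\<in>I. if i \<in> J then ennreal (exp ((cmod (x i))\<^sup>2 / 4)) else 1) \<partial>PiM I (\<lambda>_. cgauss))
      = (\<Prod>i\<in>I. \<integral>\<^sup>+z. (if i \<in> J then ennreal (exp ((cmod z)\<^sup>2 / 4)) else 1) \<partial>cgauss)"
    using fin by (intro G.product_nn_integral_prod) measurable
  also have "\<dots> = (\<Prod>i\<in>I. if i \<in> J then 2 else 1)"
    using cgauss.emeasure_space_1 by (intro prod.cong) (auto simp: nn_integral_cgauss_exp_square)
  also have "\<dots> = 2 ^ ?m" using J fin by (simp add: prod.inter_restrict[symmetric] Int_absorb1)
  also have "ennreal (4 * exp (- (6 * real ?m) / 4)) * 2 ^ ?m = ennreal (4 * (exp (- (6 * real ?m) / 4) * 2 ^ ?m))"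
    by (simp add: ennreal_mult' ennreal_power[symmetric] mult.assoc)
  also have "\<dots> \<le> ennreal (4 * ((1 / 4) ^ ?m * 2 ^ ?m))"
    using e2 by (intro ennreal_leI mult_left_mono) auto
  also have "(1 / 4 :: real) ^ ?m * 2 ^ ?m = (1 / 2) ^ ?m" by (simp add: power_mult_distrib[symmetric])
  finally show ?thesis .
qed

section \<open>Integration on the cube\<close>

definition unit_int :: "real measure" where
  "unit_int = restrict_space lborel {0..1}"

text \<open>A probability measure whose space is exactly \<open>cube d\<close>: bounded functions
  are integrable, and pointwise claims are needed on the cube only. Integrals over the cube in
  \<open>leb d\<close> are moved here by \<open>set_integral_cube\<close> and
  \<open>nn_integral_cube\<close>.\<close>

definition unif :: "nat \<Rightarrow> (nat \<Rightarrow> real) measure" where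
  "unif d = PiM {..<d} (\<lambda>_. unit_int)"

lemma space_unit_int [simp]: "space unit_int = {0..1}"
  by (simp add: unit_int_def space_restrict_space)

lemma prob_space_unit_int: "prob_space unit_int"
  unfolding unit_int_def by (rule prob_spaceI) (simp add: emeasure_restrict_space space_restrict_space)

lemma space_unif [simp]: "space (unif d) = cube d"
  by (simp add: unif_def cube_def space_PiM)

lemma prob_space_unif: "prob_space (unif d)"
  unfolding unif_def by (intro prob_space_PiM prob_space_unit_int)

lemma measurable_unit_int_lborel [measurable]: "(\<lambda>x. x) \<in> measurable unit_int borel"
  unfolding unit_int_def by (auto intro: measurable_restrict_space1)

lemma cube_in_sets_leb [measurable]: "cube d \<in> sets (leb d)"
  unfolding cube_def leb_def by (intro sets_PiM_I_finite) auto

lemma measurable_unif_leb: "(\<lambda>x. x) \<in> measurable (unif d) (leb d)"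
proof -
  have "(\<lambda>x. \<lambda>i\<in>{..<d}. x i) \<in> measurable (unif d) (leb d)"
    unfolding unif_def leb_def
  proof (intro measurable_restrict)
    fix i assume "i \<in> {..<d}"
    then have "(\<lambda>x. x i) \<in> measurable (PiM {..<d} (\<lambda>_. unit_int)) unit_int"
      by (rule measurable_component_singleton)
    from measurable_compose[OF this measurable_unit_int_lborel]
    show "(\<lambda>x. x i) \<in> measurable (PiM {..<d} (\<lambda>_. unit_int)) lborel" by (simp only: measurable_lborel1)
  qed
  then show ?thesis
    by (rule measurable_cong[THEN iffD1, rotated]) (auto simp: cube_def PiE_def extensional_def fun_eq_iff)
qed

lemma borel_measurable_unif_of_leb:
  "g \<in> borel_measurable (leb d) \<Longrightarrow> g \<in> borel_measurable (unif d)"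
  by (rule measurable_compose[OF measurable_unif_leb])

lemma distr_unif: "distr (unif d) (leb d) (\<lambda>x. x) = density (leb d) (indicator (cube d))"
proof -
  interpret u: prob_space unit_int by (rule prob_space_unit_int)
  interpret U: product_prob_space "\<lambda>_. unit_int" "{..<d}" by standard
  interpret U: finite_product_prob_space "\<lambda>_. unit_int" "{..<d}" by standard auto
  interpret L: product_sigma_finite "\<lambda>_. lborel :: real measure" by standard
  let ?N = "\<lambda>i::nat. density lborel (indicator {0..1::real})"
  have pN: "prob_space (?N i)" for i
    by (rule prob_spaceI) (simp add: emeasure_density)
  interpret N: product_sigma_finite ?N
    unfolding product_sigma_finite_def using pN by (auto intro: prob_space_imp_sigma_finite)
  have sN: "sets (leb d) = sets (PiM {..<d} ?N)" unfolding leb_def by (intro sets_PiM_cong) auto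
  have "distr (unif d) (leb d) (\<lambda>x. x) = PiM {..<d} ?N"
  proof (rule N.PiM_eqI)
    show "sets (distr (unif d) (leb d) (\<lambda>x. x)) = sets (PiM {..<d} ?N)" using sN by simp
    fix A assume "\<And>i. i \<in> {..<d} \<Longrightarrow> A i \<in> sets (?N i)"
    then have A[measurable]: "A i \<in> sets borel" if "i < d" for i using that by simp
    have "emeasure (distr (unif d) (leb d) (\<lambda>x. x)) (Pi\<^sub>E {..<d} A) = emeasure (unif d) (Pi\<^sub>E {..<d} (\<lambda>i. A i \<inter> {0..1}))"
      using A by (subst emeasure_distr[OF measurable_unif_leb])
        (auto intro!: sets_PiM_I_finite arg_cong2[where f=emeasure] simp: leb_def cube_def PiE_iff)
    also have "\<dots> = (\<Prod>i<d. emeasure unit_int (A i \<inter> {0..1}))"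
      unfolding unif_def using A by (subst U.emeasure_PiM) (auto simp: unit_int_def sets_restrict_space)
    also have "\<dots> = (\<Prod>i<d. emeasure (?N i) (A i))"
    proof (intro prod.cong refl)
      fix i assume "i \<in> {..<d}"
      then have [measurable]: "A i \<in> sets borel" using A by simp
      show "emeasure unit_int (A i \<inter> {0..1}) = emeasure (?N i) (A i)"
        by (simp add: unit_int_def emeasure_restrict_space emeasure_density indicator_inter_arith[symmetric] Int_commute)
    qed
    finally show "emeasure (distr (unif d) (leb d) (\<lambda>x. x)) (Pi\<^sub>E {..<d} A) = (\<Prod>i<d. emeasure (?N i) (A i))" .
  qed simp
  moreover have "density (leb d) (indicator (cube d)) = PiM {..<d} ?N"
  proof (rule N.PiM_eqI)
    show "sets (density (leb d) (indicator (cube d))) = sets (PiM {..<d} ?N)" using sN by simp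
    fix A assume "\<And>i. i \<in> {..<d} \<Longrightarrow> A i \<in> sets (?N i)"
    then have A[measurable]: "A i \<in> sets borel" if "i < d" for i using that by simp
    have B: "Pi\<^sub>E {..<d} A \<in> sets (leb d)" unfolding leb_def using A by (intro sets_PiM_I_finite) auto
    have "emeasure (density (leb d) (indicator (cube d))) (Pi\<^sub>E {..<d} A) = emeasure (leb d) (cube d \<inter> Pi\<^sub>E {..<d} A)"
      using B by (simp add: emeasure_density indicator_inter_arith[symmetric])
    also have "cube d \<inter> Pi\<^sub>E {..<d} A = Pi\<^sub>E {..<d} (\<lambda>i. {0..1} \<inter> A i)" by (auto simp: cube_def PiE_iff)
    also have "emeasure (leb d) \<dots> = (\<Prod>i<d. emeasure lborel ({0..1} \<inter> A i))"
      unfolding leb_def using A by (subst L.emeasure_PiM) auto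
    also have "\<dots> = (\<Prod>i<d. emeasure (?N i) (A i))"
      using A by (intro prod.cong) (auto simp: emeasure_density indicator_inter_arith[symmetric])
    finally show "emeasure (density (leb d) (indicator (cube d))) (Pi\<^sub>E {..<d} A) = (\<Prod>i<d. emeasure (?N i) (A i))" .
  qed simp
  ultimately show ?thesis by simp
qed

text \<open>Clamping is a measurable retraction onto the cube; composition with it extends a
  function measurable on the cube to one measurable on all of \<open>leb d\<close>.\<close>

lemma clamp_measurable: "(\<lambda>x. \<lambda>i\<in>{..<d}. max 0 (min 1 (x i))) \<in> measurable (leb d) (unif d)"
  unfolding leb_def unif_def
proof (intro measurable_restrict)
  fix i assume "i \<in> {..<d}"
  then have [measurable]: "(\<lambda>x. x i) \<in> borel_measurable (PiM {..<d} (\<lambda>_. lborel))"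
    by (metis measurable_component_singleton measurable_lborel1)
  show "(\<lambda>x. max 0 (min 1 (x i))) \<in> measurable (PiM {..<d} (\<lambda>_. lborel)) unit_int"
    unfolding unit_int_def by (intro measurable_restrict_space2) auto
qed

lemma clamp_cube: "x \<in> cube d \<Longrightarrow> (\<lambda>i\<in>{..<d}. max 0 (min 1 (x i))) = x"
  by (auto simp: cube_def PiE_iff extensional_def fun_eq_iff)

lemma indicator_cube_measurable:
  fixes g :: "(nat \<Rightarrow> real) \<Rightarrow> 'b::{second_countable_topology, real_normed_vector}"
  assumes "g \<in> borel_measurable (unif d)"
  shows "(\<lambda>x. indicator (cube d) x *\<^sub>R g x) \<in> borel_measurable (leb d)"
proof -
  have [measurable]: "(\<lambda>x. g (\<lambda>i\<in>{..<d}. max 0 (min 1 (x i)))) \<in> borel_measurable (leb d)"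
    using measurable_compose[OF clamp_measurable assms] .
  have "(\<lambda>x. indicator (cube d) x *\<^sub>R g x) = (\<lambda>x. indicator (cube d) x *\<^sub>R g (\<lambda>i\<in>{..<d}. max 0 (min 1 (x i))))"
    by (auto simp: indicator_def clamp_cube fun_eq_iff)
  then show ?thesis by simp
qed

lemma set_integral_cube:
  fixes g :: "(nat \<Rightarrow> real) \<Rightarrow> 'b::{second_countable_topology, banach}"
  assumes g: "g \<in> borel_measurable (unif d)"
  shows "set_lebesgue_integral (leb d) (cube d) g = (\<integral>x. g x \<partial>unif d)"
proof -
  note [measurable] = indicator_cube_measurable[OF g]
  have "set_lebesgue_integral (leb d) (cube d) g = (\<integral>x. indicator (cube d) x *\<^sub>R (indicator (cube d) x *\<^sub>R g x) \<partial>leb d)"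
    unfolding set_lebesgue_integral_def by (intro Bochner_Integration.integral_cong) (auto simp: indicator_def)
  also have "\<dots> = (\<integral>x. indicator (cube d) x *\<^sub>R g x \<partial>density (leb d) (\<lambda>x. ennreal (indicator (cube d) x)))"
    by (subst integral_density) auto
  also have "density (leb d) (\<lambda>x. ennreal (indicator (cube d) x)) = distr (unif d) (leb d) (\<lambda>x. x)"
    unfolding distr_unif by (intro density_cong) (auto simp: indicator_def)
  also have "(\<integral>x. indicator (cube d) x *\<^sub>R g x \<partial>distr (unif d) (leb d) (\<lambda>x. x)) = (\<integral>x. indicator (cube d) x *\<^sub>R g x \<partial>unif d)"
    by (rule integral_distr[OF measurable_unif_leb]) measurable
  also have "\<dots> = (\<integral>x. g x \<partial>unif d)" by (intro Bochner_Integration.integral_cong) auto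
  finally show ?thesis .
qed

lemma nn_integral_cube:
  assumes [measurable]: "u \<in> borel_measurable (leb d)"
  shows "(\<integral>\<^sup>+x. indicator (cube d) x * u x \<partial>leb d) = (\<integral>\<^sup>+x. u x \<partial>unif d)"
proof -
  have "(\<integral>\<^sup>+x. indicator (cube d) x * u x \<partial>leb d) = (\<integral>\<^sup>+x. u x \<partial>density (leb d) (indicator (cube d)))"
    by (subst nn_integral_density) auto
  also have "\<dots> = (\<integral>\<^sup>+x. u x \<partial>unif d)"
    unfolding distr_unif[symmetric] by (subst nn_integral_distr[OF measurable_unif_leb]) auto
  finally show ?thesis .
qed

text \<open>The topology of the function space involves every coordinate. Those from
  \<open>d\<close> on are pinned to \<open>undefined\<close>, so the cube is a full product of
  compact sets and Tychonoff's theorem applies.\<close>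

lemma cube_eq_PiE_UNIV: "cube d = PiE UNIV (\<lambda>i. if i < d then {0..1} else {undefined})"
  by (auto simp: cube_def PiE_def extensional_def Pi_def)

lemma compact_cube: "compact (cube d)"
proof -
  have "compactin (product_topology (\<lambda>i. euclidean) UNIV) (PiE UNIV (\<lambda>i. if i < d then {0..1::real} else {undefined}))"
    unfolding compactin_PiE by auto
  then show ?thesis unfolding cube_eq_PiE_UNIV euclidean_product_topology compactin_euclidean_iff .
qed

text \<open>Continuity refers to the function-space topology, measurability to the product
  sigma-algebra over the first \<open>d\<close> coordinates. The identity between the two is
  measurable coordinate by coordinate, the later coordinates being constant.\<close>

lemma borel_measurable_continuous_on_cube:
  fixes g :: "(nat \<Rightarrow> real) \<Rightarrow> 'b::{second_countable_topology, real_normed_vector}"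
  assumes "continuous_on (cube d) g"
  shows "g \<in> borel_measurable (unif d)"
proof -
  have "(\<lambda>x. x i) \<in> borel_measurable (unif d)" for i
  proof (cases "i < d")
    case True
    then show ?thesis unfolding unif_def
      using measurable_compose[of "\<lambda>x. x i" "PiM {..<d} (\<lambda>_. unit_int)" unit_int "\<lambda>x. x" borel]
      by (simp add: measurable_component_singleton measurable_unit_int_lborel)
  next
    case False
    have "(\<lambda>x. undefined) \<in> borel_measurable (unif d)" by simp
    then show ?thesis by (rule measurable_cong[THEN iffD1, rotated]) (use False in \<open>auto simp: cube_def PiE_iff extensional_def\<close>)
  qed
  then have "(\<lambda>x. x) \<in> borel_measurable (unif d)" by (intro measurable_coordinatewise_then_product)
  then have "(\<lambda>x. x) \<in> measurable (unif d) (restrict_space borel (cube d))"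
    by (intro measurable_restrict_space2) auto
  then show ?thesis
    using measurable_compose[OF _ borel_measurable_continuous_on_restrict[OF assms]] by blast
qed

section \<open>Fourier coefficients\<close>

definition bounded_meas :: "'a measure \<Rightarrow> ('a \<Rightarrow> 'b::{real_normed_field, banach, second_countable_topology}) \<Rightarrow> bool" where
  "bounded_meas M g \<longleftrightarrow> g \<in> borel_measurable M \<and> (\<exists>C. \<forall>x\<in>space M. norm (g x) \<le> C)"

lemma bounded_meas_measurable: "bounded_meas M g \<Longrightarrow> g \<in> borel_measurable M"
  by (simp add: bounded_meas_def)

lemma bounded_meas_const [simp, intro]: "bounded_meas M (\<lambda>_. c)"
  by (auto simp: bounded_meas_def)

lemma bounded_meas_add [simp, intro]:
  assumes "bounded_meas M g" "bounded_meas M h"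
  shows "bounded_meas M (\<lambda>x. g x + h x)"
proof -
  from assms obtain A B where "\<forall>x\<in>space M. norm (g x) \<le> A" "\<forall>x\<in>space M. norm (h x) \<le> B"
    by (auto simp: bounded_meas_def)
  then have "\<forall>x\<in>space M. norm (g x + h x) \<le> A + B" by (meson add_mono norm_triangle_le)
  then show ?thesis using assms by (auto simp: bounded_meas_def)
qed

lemma bounded_meas_mult [simp, intro]:
  assumes "bounded_meas M g" "bounded_meas M h"
  shows "bounded_meas M (\<lambda>x. g x * h x)"
proof -
  from assms obtain A B where *: "\<forall>x\<in>space M. norm (g x) \<le> A" "\<forall>x\<in>space M. norm (h x) \<le> B"
    by (auto simp: bounded_meas_def)
  then have "\<forall>x\<in>space M. norm (g x * h x) \<le> A * B"
    by (auto simp: norm_mult intro!: mult_mono intro: order_trans[OF norm_ge_zero])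
  then show ?thesis using assms by (auto simp: bounded_meas_def)
qed

lemma bounded_meas_power [simp, intro]: "bounded_meas M g \<Longrightarrow> bounded_meas M (\<lambda>x. g x ^ m)"
  by (induction m) simp_all

lemma borel_measurable_cnj [measurable]: "cnj \<in> borel_measurable borel"
  by (intro borel_measurable_continuous_onI continuous_intros)

lemma bounded_meas_cnj [simp, intro]: "bounded_meas M g \<Longrightarrow> bounded_meas M (\<lambda>x. cnj (g x))"
proof -
  assume "bounded_meas M g" then show ?thesis by (auto simp: bounded_meas_def)
qed

lemma bounded_meas_Re [simp, intro]: "bounded_meas M g \<Longrightarrow> bounded_meas M (\<lambda>x. Re (g x))"
  by (auto simp: bounded_meas_def intro: order_trans[OF abs_Re_le_cmod])

lemma bounded_meas_norm [simp, intro]: "bounded_meas M g \<Longrightarrow> bounded_meas M (\<lambda>x. norm (g x))"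
  by (auto simp: bounded_meas_def)

lemma bounded_meas_diff [simp, intro]:
  assumes "bounded_meas M g" "bounded_meas M h"
  shows "bounded_meas M (\<lambda>x. g x - h x)"
  using bounded_meas_add[OF assms(1) bounded_meas_mult[OF bounded_meas_const[of M "-1"] assms(2)]] by simp

lemma bounded_meas_sum [simp, intro]:
  "(\<And>i. i \<in> I \<Longrightarrow> bounded_meas M (g i)) \<Longrightarrow> bounded_meas M (\<lambda>x. \<Sum>i\<in>I. g i x)"
  by (induction I rule: infinite_finite_induct) auto

lemma bounded_meas_compose:
  assumes "bounded_meas N g" "h \<in> measurable M N"
  shows "bounded_meas M (\<lambda>x. g (h x))"
  using assms measurable_space[OF assms(2)] by (auto simp: bounded_meas_def)

lemma (in finite_measure) bounded_meas_integrable: "bounded_meas M g \<Longrightarrow> integrable M g"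
  unfolding bounded_meas_def by (auto intro!: integrable_const_bound AE_I2)

abbreviation cube_bounded :: "nat \<Rightarrow> ((nat \<Rightarrow> real) \<Rightarrow> complex) \<Rightarrow> bool" where
  "cube_bounded d \<equiv> bounded_meas (unif d)"

lemma cube_bounded_integrable: "cube_bounded d g \<Longrightarrow> integrable (unif d) g"
  using finite_measure.bounded_meas_integrable prob_space_unif prob_space.finite_measure by blast

lemma cube_bounded_continuous:
  assumes "continuous_on (cube d) g"
  shows "cube_bounded d g"
proof -
  have "bounded (g ` cube d)" using compact_continuous_image[OF assms compact_cube] compact_imp_bounded by blast
  then show ?thesis using borel_measurable_continuous_on_cube[OF assms] by (auto simp: bounded_meas_def bounded_iff)
qed

section \<open>Characters of the torus and their orthonormality\<close>

lemma continuous_on_phi: "continuous_on S (phi d k)"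
proof -
  have "continuous_on UNIV (phi d k)" unfolding phi_def
    by (intro continuous_intros continuous_on_product_coordinates)
  then show ?thesis using continuous_on_subset by blast
qed

lemma cube_bounded_phi [simp, intro]: "cube_bounded d (phi d k)"
  by (intro cube_bounded_continuous continuous_on_phi)

lemma norm_phi [simp]: "cmod (phi d k x) = 1"
proof -
  have "phi d k x = cis (2 * pi * (\<Sum>i<d. real_of_int (k i) * x i))"
    by (simp add: phi_def cis_conv_exp mult_ac)
  then show ?thesis by simp
qed

lemma phi_prod: "phi d k x = (\<Prod>i<d. exp (2 * complex_of_real pi * \<i> * of_int (k i) * complex_of_real (x i)))"
  by (simp add: phi_def exp_sum[symmetric] sum_distrib_left mult.assoc)

lemma cnj_phi: "cnj (phi d k x) = phi d (\<lambda>i. - k i) x"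
  by (simp add: phi_def exp_cnj sum_negf)

lemma phi_mult: "phi d k x * phi d l x = phi d (\<lambda>i. k i + l i) x"
proof -
  have "(\<Sum>i<d. real_of_int (k i + l i) * x i) = (\<Sum>i<d. real_of_int (k i) * x i) + (\<Sum>i<d. real_of_int (l i) * x i)"
    by (simp add: sum.distrib distrib_right)
  then show ?thesis unfolding phi_def by (simp only: exp_add of_real_add distrib_left)
qed

lemma phi_cong: "(\<And>i. i < d \<Longrightarrow> k i = l i) \<Longrightarrow> phi d k x = phi d l x"
  by (simp add: phi_def)

lemma exp_2pi_int: "exp (2 * complex_of_real pi * \<i> * of_int m) = 1"
  using exp_integer_2pi[of "of_int m"] by (simp add: mult_ac)

lemma integral_unit_int:
  fixes g :: "real \<Rightarrow> 'b::{banach, second_countable_topology}"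
  shows "(\<integral>t. g t \<partial>unit_int) = (\<integral>t. indicator {0..1} t *\<^sub>R g t \<partial>lborel)"
  unfolding unit_int_def by (subst integral_restrict_space) auto

lemma integral_exp_unit_int:
  "(\<integral>t. exp (2 * complex_of_real pi * \<i> * of_int m * complex_of_real t) \<partial>unit_int) = (if m = 0 then 1 else 0)"
proof (cases "m = 0")
  case True
  interpret prob_space unit_int by (rule prob_space_unit_int)
  show ?thesis using True prob_space by simp
next
  case False
  define c where "c = 2 * complex_of_real pi * \<i> * of_int m"
  have c0: "c \<noteq> 0" using False by (simp add: c_def)
  have "(\<integral>t. exp (c * complex_of_real t) \<partial>unit_int) = (\<integral>t. indicator {0..1} t *\<^sub>R exp (c * complex_of_real t) \<partial>lborel)"
    by (rule integral_unit_int)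
  also have "\<dots> = exp (c * complex_of_real 1) / c - exp (c * complex_of_real 0) / c"
  proof (rule integral_FTC_atLeastAtMost)
    fix x :: real
    have "((\<lambda>z. exp (c * z) / c) has_field_derivative exp (c * complex_of_real x)) (at (complex_of_real x))"
      using c0 by (auto intro!: derivative_eq_intros)
    then have "((\<lambda>t. exp (c * complex_of_real t) / c) has_vector_derivative exp (c * complex_of_real x)) (at x)"
      by (rule has_vector_derivative_real_field)
    then show "((\<lambda>t. exp (c * complex_of_real t) / c) has_vector_derivative exp (c * complex_of_real x)) (at x within {0..1})"
      by (rule has_vector_derivative_at_within)
  qed (auto intro!: continuous_intros)
  also have "\<dots> = 0" using exp_2pi_int[of m] by (simp add: c_def)
  finally show ?thesis using False by (simp add: c_def)
qed

lemma integral_phi: "(\<integral>x. phi d k x \<partial>unif d) = (if \<forall>i<d. k i = 0 then 1 else 0)"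
proof -
  interpret u: prob_space unit_int by (rule prob_space_unit_int)
  interpret U: product_prob_space "\<lambda>_. unit_int" "{..<d}" by standard
  have "(\<integral>x. phi d k x \<partial>unif d) = (\<Prod>i<d. \<integral>t. exp (2 * complex_of_real pi * \<i> * of_int (k i) * complex_of_real t) \<partial>unit_int)"
    unfolding unif_def phi_prod
  proof (rule U.product_integral_prod)
    fix i
    have [measurable]: "(\<lambda>x. x) \<in> borel_measurable unit_int" by (rule measurable_unit_int_lborel)
    show "integrable unit_int (\<lambda>t. exp (2 * complex_of_real pi * \<i> * of_int (k i) * complex_of_real t))"
    proof (rule u.integrable_const_bound[where B=1])
      show "(\<lambda>t. exp (2 * complex_of_real pi * \<i> * of_int (k i) * complex_of_real t)) \<in> borel_measurable unit_int"
        by (rule measurable_compose[OF measurable_unit_int_lborel borel_measurable_continuous_onI]) (intro continuous_intros)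
    qed (simp add: norm_exp_eq_Re)
  qed simp
  then show ?thesis by (auto simp: integral_exp_unit_int prod_zero_iff)
qed

lemma integral_phi_cnj_phi:
  assumes "k \<in> Kall d" "l \<in> Kall d"
  shows "(\<integral>x. phi d k x * cnj (phi d l x) \<partial>unif d) = (if k = l then 1 else 0)"
proof -
  have "(\<forall>i<d. k i - l i = 0) \<longleftrightarrow> k = l"
    using assms by (auto simp: Kall_def PiE_iff extensional_def fun_eq_iff) (metis)
  then show ?thesis by (simp add: cnj_phi phi_mult integral_phi)
qed

section \<open>Fourier coefficients: completing the square and Bessel's inequality\<close>

lemma l2inner_unif:
  "cube_bounded d g \<Longrightarrow> cube_bounded d h \<Longrightarrow> l2inner d g h = (\<integral>x. g x * cnj (h x) \<partial>unif d)"
  unfolding l2inner_def by (intro set_integral_cube bounded_meas_measurable) auto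

lemma l2sq_unif:
  assumes "cube_bounded d g"
  shows "complex_of_real (l2sq d g) = (\<integral>x. g x * cnj (g x) \<partial>unif d)" "l2sq d g = (\<integral>x. (cmod (g x))\<^sup>2 \<partial>unif d)"
proof -
  note [measurable] = bounded_meas_measurable[OF assms]
  show *: "l2sq d g = (\<integral>x. (cmod (g x))\<^sup>2 \<partial>unif d)"
    unfolding l2sq_def by (intro set_integral_cube) measurable
  show "complex_of_real (l2sq d g) = (\<integral>x. g x * cnj (g x) \<partial>unif d)"
    unfolding * integral_complex_of_real[symmetric] complex_norm_square ..
qed

lemma l2sq_nonneg: "l2sq d g \<ge> 0"
  unfolding l2sq_def set_lebesgue_integral_def by (intro Bochner_Integration.integral_nonneg) auto

text \<open>Completing the square in the coefficients. The one identity serves as Parseval for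
  trigonometric polynomials (\<open>g = 0\<close>), Bessel (\<open>c\<close> the Fourier
  coefficients), best approximation (drop the last sum) and the bias-variance split of the
  loss.\<close>

lemma l2sq_diff_trig:
  assumes g: "cube_bounded d g" and K: "finite K" "K \<subseteq> Kall d"
  shows "l2sq d (\<lambda>x. g x - (\<Sum>k\<in>K. c k * phi d k x)) =
    l2sq d g - (\<Sum>k\<in>K. (cmod (l2inner d g (phi d k)))\<^sup>2) + (\<Sum>k\<in>K. (cmod (c k - l2inner d g (phi d k)))\<^sup>2)"
proof -
  define \<theta> where "\<theta> k = l2inner d g (phi d k)" for k
  have th: "\<theta> k = (\<integral>x. g x * cnj (phi d k x) \<partial>unif d)" for k
    unfolding \<theta>_def by (rule l2inner_unif) (use g in auto)
  have th': "cnj (\<theta> k) = (\<integral>x. cnj (g x) * phi d k x \<partial>unif d)" for k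
    unfolding th by (subst Bochner_Integration.integral_cnj[symmetric]) simp
  let ?u = "\<lambda>x. \<Sum>k\<in>K. c k * phi d k x"
  have u: "cube_bounded d ?u" by (intro bounded_meas_sum bounded_meas_mult) auto
  have 1: "(\<integral>x. g x * cnj (?u x) \<partial>unif d) = (\<Sum>k\<in>K. cnj (c k) * \<theta> k)"
  proof -
    have "(\<integral>x. g x * cnj (?u x) \<partial>unif d) = (\<integral>x. (\<Sum>k\<in>K. cnj (c k) * (g x * cnj (phi d k x))) \<partial>unif d)"
      by (simp add: sum_distrib_left mult_ac)
    also have "\<dots> = (\<Sum>k\<in>K. cnj (c k) * \<theta> k)"
      unfolding th by (subst Bochner_Integration.integral_sum) (simp_all add: cube_bounded_integrable g)
    finally show ?thesis .
  qed
  have 2: "(\<integral>x. ?u x * cnj (g x) \<partial>unif d) = (\<Sum>k\<in>K. c k * cnj (\<theta> k))"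
  proof -
    have "(\<integral>x. ?u x * cnj (g x) \<partial>unif d) = (\<integral>x. (\<Sum>k\<in>K. c k * (cnj (g x) * phi d k x)) \<partial>unif d)"
      by (simp add: sum_distrib_left sum_distrib_right mult_ac)
    also have "\<dots> = (\<Sum>k\<in>K. c k * cnj (\<theta> k))"
      unfolding th' by (subst Bochner_Integration.integral_sum) (simp_all add: cube_bounded_integrable g)
    finally show ?thesis .
  qed
  have 3: "(\<integral>x. ?u x * cnj (?u x) \<partial>unif d) = (\<Sum>k\<in>K. c k * cnj (c k))"
  proof -
    have "(\<integral>x. ?u x * cnj (?u x) \<partial>unif d) = (\<integral>x. (\<Sum>k\<in>K. \<Sum>l\<in>K. c k * cnj (c l) * (phi d k x * cnj (phi d l x))) \<partial>unif d)"
      by (simp add: sum_product mult_ac)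
    also have "\<dots> = (\<Sum>k\<in>K. \<Sum>l\<in>K. c k * cnj (c l) * (\<integral>x. phi d k x * cnj (phi d l x) \<partial>unif d))"
    proof -
      have "(\<integral>x. (\<Sum>k\<in>K. \<Sum>l\<in>K. c k * cnj (c l) * (phi d k x * cnj (phi d l x))) \<partial>unif d) =
        (\<Sum>k\<in>K. (\<integral>x. (\<Sum>l\<in>K. c k * cnj (c l) * (phi d k x * cnj (phi d l x))) \<partial>unif d))"
        by (rule Bochner_Integration.integral_sum)
          (simp_all add: cube_bounded_integrable)
      also have "\<dots> = (\<Sum>k\<in>K. \<Sum>l\<in>K. \<integral>x. c k * cnj (c l) * (phi d k x * cnj (phi d l x)) \<partial>unif d)"
        by (intro sum.cong refl Bochner_Integration.integral_sum)
          (simp_all add: cube_bounded_integrable)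
      finally show ?thesis by simp
    qed
    also have "\<dots> = (\<Sum>k\<in>K. \<Sum>l\<in>K. c k * cnj (c l) * (if k = l then 1 else 0))"
      using K by (intro sum.cong refl) (subst integral_phi_cnj_phi, auto)
    also have "\<dots> = (\<Sum>k\<in>K. c k * cnj (c k))"
      using K by (simp add: if_distrib[of "\<lambda>z. _ * z"] cong: if_cong)
    finally show ?thesis .
  qed
  have "complex_of_real (l2sq d (\<lambda>x. g x - ?u x)) = (\<integral>x. (g x - ?u x) * cnj (g x - ?u x) \<partial>unif d)"
    by (rule l2sq_unif) (intro bounded_meas_diff g u)
  also have "\<dots> = (\<integral>x. (g x * cnj (g x) - g x * cnj (?u x)) - (?u x * cnj (g x) - ?u x * cnj (?u x)) \<partial>unif d)"
    by (simp add: algebra_simps)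
  also have "\<dots> = ((\<integral>x. g x * cnj (g x) \<partial>unif d) - (\<integral>x. g x * cnj (?u x) \<partial>unif d)) -
      ((\<integral>x. ?u x * cnj (g x) \<partial>unif d) - (\<integral>x. ?u x * cnj (?u x) \<partial>unif d))"
    by (subst Bochner_Integration.integral_diff Bochner_Integration.integral_diff,
        (intro cube_bounded_integrable bounded_meas_diff bounded_meas_mult bounded_meas_cnj g u)+)+ simp
  also have "\<dots> = complex_of_real (l2sq d g) - (\<Sum>k\<in>K. cnj (c k) * \<theta> k) - ((\<Sum>k\<in>K. c k * cnj (\<theta> k)) - (\<Sum>k\<in>K. c k * cnj (c k)))"
    unfolding 1 2 3 l2sq_unif(1)[OF g] ..
  also have "\<dots> = complex_of_real (l2sq d g - (\<Sum>k\<in>K. (cmod (\<theta> k))\<^sup>2) + (\<Sum>k\<in>K. (cmod (c k - \<theta> k))\<^sup>2))"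
    by (simp add: complex_norm_square sum.distrib sum_subtractf algebra_simps del: of_real_power)
  finally show ?thesis unfolding of_real_eq_iff \<theta>_def .
qed

lemma l2sq_trig:
  assumes K: "finite K" "K \<subseteq> Kall d"
  shows "l2sq d (\<lambda>x. \<Sum>k\<in>K. c k * phi d k x) = (\<Sum>k\<in>K. (cmod (c k))\<^sup>2)"
proof -
  have "l2sq d (\<lambda>x. 0 - (\<Sum>k\<in>K. (- c k) * phi d k x)) = (\<Sum>k\<in>K. (cmod (c k))\<^sup>2)"
    using l2sq_diff_trig[of d "\<lambda>_. 0" K "\<lambda>k. - c k"] K
    by (simp add: l2inner_def l2sq_def[of d "\<lambda>_. 0"] set_lebesgue_integral_def)
  then show ?thesis by (simp add: sum_negf)
qed

lemma bessel:
  assumes "cube_bounded d g" and K: "finite K" "K \<subseteq> Kall d"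
  shows "(\<Sum>k\<in>K. (cmod (l2inner d g (phi d k)))\<^sup>2) \<le> l2sq d g"
  using l2sq_diff_trig[OF assms, of "\<lambda>k. l2inner d g (phi d k)"] l2sq_nonneg
  by (smt (verit) diff_self norm_zero power_zero_numeral sum.neutral)

lemma l2inner_trig:
  assumes K: "finite K" "K \<subseteq> Kall d" and l: "l \<in> Kall d"
  shows "l2inner d (\<lambda>x. \<Sum>k\<in>K. c k * phi d k x) (phi d l) = (if l \<in> K then c l else 0)"
proof -
  have "l2inner d (\<lambda>x. \<Sum>k\<in>K. c k * phi d k x) (phi d l) = (\<integral>x. (\<Sum>k\<in>K. c k * phi d k x) * cnj (phi d l x) \<partial>unif d)"
    by (intro l2inner_unif bounded_meas_sum bounded_meas_mult) auto
  also have "\<dots> = (\<integral>x. (\<Sum>k\<in>K. c k * (phi d k x * cnj (phi d l x))) \<partial>unif d)"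
    by (simp add: sum_distrib_right mult.assoc)
  also have "\<dots> = (\<Sum>k\<in>K. c k * (\<integral>x. phi d k x * cnj (phi d l x) \<partial>unif d))"
    by (subst Bochner_Integration.integral_sum)
      (simp_all add: cube_bounded_integrable bounded_meas_mult bounded_meas_cnj)
  also have "\<dots> = (\<Sum>k\<in>K. c k * (if k = l then 1 else 0))"
    using K l by (intro sum.cong refl) (subst integral_phi_cnj_phi, auto)
  also have "\<dots> = (if l \<in> K then c l else 0)"
    using K by (simp add: if_distrib[of "\<lambda>z. _ * z"] cong: if_cong)
  finally show ?thesis .
qed

section \<open>Density of trigonometric polynomials\<close>

text \<open>A continuous map from a compact set to a Hausdorff space is closed, hence a quotient map
  onto its image: the preimage of a closed set under \<open>g\<close> is the \<open>E\<close>-image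
  of a compact set.\<close>

lemma continuous_factor_compact:
  fixes E :: "'a::topological_space \<Rightarrow> 'b::t2_space" and f :: "'a \<Rightarrow> 'c::topological_space"
  assumes K: "compact K" "closed K" and E: "continuous_on K E" and f: "continuous_on K f"
    and eq: "\<And>x y. x \<in> K \<Longrightarrow> y \<in> K \<Longrightarrow> E x = E y \<Longrightarrow> f x = f y"
  obtains g where "continuous_on (E ` K) g" "\<And>x. x \<in> K \<Longrightarrow> g (E x) = f x"
proof -
  define g where "g z = f (SOME x. x \<in> K \<and> E x = z)" for z
  have g: "g (E x) = f x" if "x \<in> K" for x
  proof -
    have "(SOME y. y \<in> K \<and> E y = E x) \<in> K \<and> E (SOME y. y \<in> K \<and> E y = E x) = E x"
      by (rule someI[of _ x]) (use that in auto)
    then show ?thesis unfolding g_def using eq that by blast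
  qed
  have "closed (E ` K)" using compact_continuous_image[OF E K(1)] compact_imp_closed by blast
  moreover have "closed (g -` B \<inter> E ` K)" if "closed B" for B
  proof -
    have "closed (f -` B \<inter> K)" using f that continuous_on_closed_vimage[OF K(2)] by blast
    then have "compact (f -` B \<inter> K)" using compact_Int_closed[OF K(1)] by (metis inf.left_idem inf_commute)
    then have "compact (E ` (f -` B \<inter> K))"
      by (auto intro!: compact_continuous_image continuous_on_subset[OF E])
    also have "E ` (f -` B \<inter> K) = g -` B \<inter> E ` K" using g by auto
    finally show ?thesis using compact_imp_closed by blast
  qed
  ultimately have "continuous_on (E ` K) g" using continuous_on_closed_vimage by blast
  then show ?thesis using g that by blast
qed

definition cube_periodic :: "nat \<Rightarrow> ((nat \<Rightarrow> real) \<Rightarrow> 'b) \<Rightarrow> bool" where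
  "cube_periodic d f \<longleftrightarrow> (\<forall>x\<in>cube d. \<forall>i<d. x i \<in> {0, 1} \<longrightarrow> f x = f (x(i := 1 - x i)))"

text \<open>Glues opposite faces of the cube; coordinates from \<open>d\<close> on are frozen so
  that they never distinguish points.\<close>

definition torus_map :: "nat \<Rightarrow> (nat \<Rightarrow> real) \<Rightarrow> nat \<Rightarrow> complex" where
  "torus_map d x = (\<lambda>i. if i < d then exp (2 * complex_of_real pi * \<i> * complex_of_real (x i)) else 1)"

lemma torus_map_eqD:
  assumes "x \<in> cube d" "y \<in> cube d" "torus_map d x = torus_map d y" "i < d"
  shows "x i = y i \<or> (x i \<in> {0, 1} \<and> y i = 1 - x i)"
proof -
  have "exp (2 * complex_of_real pi * \<i> * complex_of_real (x i)) = exp (2 * complex_of_real pi * \<i> * complex_of_real (y i))"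
    using assms by (auto simp: torus_map_def fun_eq_iff split: if_splits)
  then obtain m :: int where "2 * complex_of_real pi * \<i> * complex_of_real (x i) =
      2 * complex_of_real pi * \<i> * complex_of_real (y i) + (of_int (2 * m) * complex_of_real pi) * \<i>"
    unfolding exp_eq by auto
  then have "2 * complex_of_real pi * \<i> * (complex_of_real (x i) - complex_of_real (y i) - of_int m) = 0"
    by (simp add: algebra_simps)
  then have "complex_of_real (x i - y i - of_int m) = 0" by simp
  then have m: "x i - y i = of_int m" by (simp only: of_real_eq_0_iff)
  have b: "0 \<le> x i" "x i \<le> 1" "0 \<le> y i" "y i \<le> 1"
    using assms by (auto simp: cube_def PiE_iff)
  then have "\<bar>real_of_int m\<bar> \<le> 1" using m by linarith
  then have "m = 0 \<or> m = 1 \<or> m = -1" by linarith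
  then show ?thesis using m b by auto
qed

text \<open>Points with equal image may differ in several coordinates, while periodicity flips one
  coordinate at a time. The hybrids that follow \<open>y\<close> below \<open>m\<close> and
  \<open>x\<close> from \<open>m\<close> on lead from \<open>x\<close> to \<open>y\<close> in single
  flips.\<close>

lemma cube_periodic_torus_map:
  assumes per: "cube_periodic d f" and "x \<in> cube d" "y \<in> cube d" "torus_map d x = torus_map d y"
  shows "f x = f y"
proof -
  have "f x = f (\<lambda>i. if i < m then y i else x i)" if "m \<le> d" for m
    using that
  proof (induction m)
    case (Suc m)
    let ?z = "\<lambda>i. if i < m then y i else x i"
    have z: "?z \<in> cube d" using assms(2,3) Suc.prems by (auto simp: cube_def PiE_iff extensional_def)
    have md: "m < d" using Suc.prems by simp
    have upd: "(\<lambda>i. if i < Suc m then y i else x i) = ?z(m := y m)" by (auto simp: fun_eq_iff less_Suc_eq)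
    from torus_map_eqD[OF assms(2-4) md] have "f (?z(m := y m)) = f ?z"
    proof
      assume "x m = y m"
      then have "?z(m := y m) = ?z" by (auto simp: fun_eq_iff)
      then show ?thesis by simp
    next
      assume *: "x m \<in> {0, 1} \<and> y m = 1 - x m"
      then have "f ?z = f (?z(m := 1 - ?z m))"
        by (intro per[unfolded cube_periodic_def, rule_format, OF z md]) simp
      then show ?thesis using * by simp
    qed
    then show ?case using Suc unfolding upd by simp
  qed simp
  from this[of d] have "f x = f (\<lambda>i. if i < d then y i else x i)" by simp
  also have "(\<lambda>i. if i < d then y i else x i) = y"
    using assms(2,3) by (auto simp: cube_def PiE_iff extensional_def fun_eq_iff)
  finally show ?thesis .
qed

section \<open>Frequency boxes and trigonometric polynomials\<close>

lemma Kset_subset_Kall: "Kset d M \<subseteq> Kall d"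
  by (auto simp: Kset_def Kall_def PiE_iff)

lemma finite_Kset [simp, intro]: "finite (Kset d M)"
  unfolding Kset_def by (intro finite_PiE) auto

lemma Kset_mono: "M \<le> N \<Longrightarrow> Kset d M \<subseteq> Kset d N"
  unfolding Kset_def by (intro PiE_mono) auto

lemma card_Kset: "real (card (Kset d M)) = (2 * real M + 1) ^ d"
  unfolding Kset_def by (simp add: card_PiE nat_add_distrib) (simp add: add.commute)

text \<open>Frequencies are not tied to a box, which makes closure under products an easy induction;
  \<open>trig_poly_Kset\<close> collects them in a box afterwards.\<close>

inductive trig_poly :: "nat \<Rightarrow> ((nat \<Rightarrow> real) \<Rightarrow> complex) \<Rightarrow> bool" for d where
  trig_poly_phi: "trig_poly d (\<lambda>x. c * phi d k x)"
| trig_poly_add: "trig_poly d u \<Longrightarrow> trig_poly d v \<Longrightarrow> trig_poly d (\<lambda>x. u x + v x)"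

lemma trig_poly_const: "trig_poly d (\<lambda>_. c)"
  using trig_poly_phi[of d c "\<lambda>_. 0"] by (simp add: phi_def)

lemma trig_poly_mult:
  assumes "trig_poly d u" "trig_poly d v"
  shows "trig_poly d (\<lambda>x. u x * v x)"
  using assms(1)
proof induction
  case (trig_poly_phi c k)
  show ?case using assms(2)
  proof induction
    case (trig_poly_phi c' k')
    have "trig_poly d (\<lambda>x. (c * c') * phi d (\<lambda>i. k i + k' i) x)" by (rule trig_poly.intros)
    then show ?case by (simp add: phi_mult[symmetric] mult_ac)
  next
    case (trig_poly_add u v)
    then show ?case by (auto simp: distrib_left intro: trig_poly.intros)
  qed
next
  case (trig_poly_add u v)
  then show ?case by (auto simp: distrib_right intro: trig_poly.intros)
qed

lemma trig_poly_Kset: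
  assumes "trig_poly d u"
  shows "\<exists>N. \<forall>M\<ge>N. \<exists>c. \<forall>x. u x = (\<Sum>k\<in>Kset d M. c k * phi d k x)"
  using assms
proof induction
  case (trig_poly_phi c k)
  define N where "N = nat (\<Sum>i<d. \<bar>k i\<bar>)"
  have "\<forall>x. c * phi d k x = (\<Sum>l\<in>Kset d M. (if l = restrict k {..<d} then c else 0) * phi d l x)" if "M \<ge> N" for M
  proof
    fix x
    have "\<bar>k i\<bar> \<le> int M" if "i < d" for i
    proof -
      have "\<bar>k i\<bar> \<le> (\<Sum>i<d. \<bar>k i\<bar>)" using that by (intro member_le_sum) auto
      also have "\<dots> \<le> int N" by (simp add: N_def)
      finally show ?thesis using \<open>M \<ge> N\<close> by linarith
    qed
    then have "restrict k {..<d} \<in> Kset d M" by (force simp: Kset_def PiE_iff abs_le_iff)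
    then have "(\<Sum>l\<in>Kset d M. (if l = restrict k {..<d} then c else 0) * phi d l x) = c * phi d (restrict k {..<d}) x"
      by (simp add: if_distrib[of "\<lambda>z. z * _"] cong: if_cong)
    also have "phi d (restrict k {..<d}) x = phi d k x" by (rule phi_cong) simp
    finally show "c * phi d k x = (\<Sum>l\<in>Kset d M. (if l = restrict k {..<d} then c else 0) * phi d l x)" ..
  qed
  then show ?case
    by (intro exI[of _ N] allI impI exI[of _ "\<lambda>l. if l = restrict k {..<d} then c else 0"]) simp
next
  case (trig_poly_add u v)
  then obtain N1 N2 where 1: "\<forall>M\<ge>N1. \<exists>c. \<forall>x. u x = (\<Sum>k\<in>Kset d M. c k * phi d k x)"
    and 2: "\<forall>M\<ge>N2. \<exists>c. \<forall>x. v x = (\<Sum>k\<in>Kset d M. c k * phi d k x)" by auto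
  show ?case
  proof (intro exI[of _ "max N1 N2"] allI impI)
    fix M assume "M \<ge> max N1 N2"
    then obtain a b where "\<forall>x. u x = (\<Sum>k\<in>Kset d M. a k * phi d k x)" "\<forall>x. v x = (\<Sum>k\<in>Kset d M. b k * phi d k x)"
      using 1 2 by (meson max.boundedE)
    then have "\<forall>x. u x + v x = (\<Sum>k\<in>Kset d M. (a k + b k) * phi d k x)"
      by (simp add: sum.distrib[symmetric] distrib_right)
    then show "\<exists>c. \<forall>x. u x + v x = (\<Sum>k\<in>Kset d M. c k * phi d k x)" by (rule exI[of _ "\<lambda>k. a k + b k"])
  qed
qed

text \<open>Real Stone-Weierstrass on the image of \<open>torus_map\<close>, a compact Hausdorff
  space. The ring \<open>R\<close> holds the continuous real functions whose pull-back to the cube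
  is a trigonometric polynomial; real and imaginary parts of the coordinates separate
  points.\<close>

lemma trig_approx:
  assumes f: "continuous_on (cube d) f" and per: "cube_periodic d f" and e: "e > 0"
  shows "\<exists>u. trig_poly d u \<and> (\<forall>x\<in>cube d. cmod (complex_of_real (f x) - u x) < e)"
proof -
  let ?S = "torus_map d ` cube d"
  have "continuous_on UNIV (\<lambda>x. torus_map d x i)" for i
    unfolding torus_map_def by (cases "i < d") (auto intro!: continuous_intros continuous_on_product_coordinates)
  then have "continuous_on UNIV (torus_map d)" by (rule continuous_on_coordinatewise_then_product)
  then have cE: "continuous_on (cube d) (torus_map d)" using continuous_on_subset by blast
  obtain g where g: "continuous_on ?S g" "\<And>x. x \<in> cube d \<Longrightarrow> g (torus_map d x) = f x"
    using continuous_factor_compact[OF compact_cube compact_imp_closed[OF compact_cube] cE f]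
      cube_periodic_torus_map[OF per] by metis
  define R where "R = {h. continuous_on ?S h \<and> (\<exists>u. trig_poly d u \<and> (\<forall>x\<in>cube d. complex_of_real (h (torus_map d x)) = u x))}"
  interpret function_ring_on R ?S
  proof
    show "compact ?S" by (rule compact_continuous_image[OF cE compact_cube])
    show "continuous_on ?S h" if "h \<in> R" for h using that by (auto simp: R_def)
    show "(\<lambda>x. h1 x + h2 x) \<in> R" if "h1 \<in> R" "h2 \<in> R" for h1 h2
    proof -
      obtain u v where "trig_poly d u" "\<forall>x\<in>cube d. complex_of_real (h1 (torus_map d x)) = u x"
        "trig_poly d v" "\<forall>x\<in>cube d. complex_of_real (h2 (torus_map d x)) = v x" using \<open>h1 \<in> R\<close> \<open>h2 \<in> R\<close> by (auto simp: R_def)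
      then have "trig_poly d (\<lambda>x. u x + v x) \<and> (\<forall>x\<in>cube d. complex_of_real (h1 (torus_map d x) + h2 (torus_map d x)) = u x + v x)"
        by (auto intro: trig_poly.intros)
      then show ?thesis using \<open>h1 \<in> R\<close> \<open>h2 \<in> R\<close> unfolding R_def by (auto intro!: continuous_intros)
    qed
    show "(\<lambda>x. h1 x * h2 x) \<in> R" if "h1 \<in> R" "h2 \<in> R" for h1 h2
    proof -
      obtain u v where "trig_poly d u" "\<forall>x\<in>cube d. complex_of_real (h1 (torus_map d x)) = u x"
        "trig_poly d v" "\<forall>x\<in>cube d. complex_of_real (h2 (torus_map d x)) = v x" using \<open>h1 \<in> R\<close> \<open>h2 \<in> R\<close> by (auto simp: R_def)
      then have "trig_poly d (\<lambda>x. u x * v x) \<and> (\<forall>x\<in>cube d. complex_of_real (h1 (torus_map d x) * h2 (torus_map d x)) = u x * v x)"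
        by (auto intro: trig_poly_mult)
      then show ?thesis using \<open>h1 \<in> R\<close> \<open>h2 \<in> R\<close> unfolding R_def by (auto intro!: continuous_intros)
    qed
    show "(\<lambda>_. c) \<in> R" for c unfolding R_def using trig_poly_const[of d "complex_of_real c"] by auto
    fix z w assume zw: "z \<in> ?S" "w \<in> ?S" "z \<noteq> w"
    then obtain i where i: "z i \<noteq> w i" by auto
    \<comment> \<open>All points of the image have the value \<open>1\<close> from coordinate
      \<open>d\<close> on, so they can differ only below \<open>d\<close>.\<close>
    have id: "i < d" using i zw by (auto simp: torus_map_def split: if_splits)
    have exp_phi: "exp (2 * complex_of_real pi * \<i> * complex_of_real (x i)) = phi d (\<lambda>j. if j = i then 1 else 0) x" for x
      using id by (simp add: phi_def if_distrib[of "\<lambda>y. real_of_int y * _"] cong: if_cong)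
    have cc: "continuous_on ?S (\<lambda>z. z i)" by (rule continuous_on_subset[OF continuous_on_product_coordinates]) auto
    let ?p = "phi d (\<lambda>j. if j = i then 1 else 0)"
    have tc: "trig_poly d (\<lambda>x. c * ?p x + c' * cnj (?p x))" for c c'
      unfolding cnj_phi by (intro trig_poly.intros)
    have "(\<lambda>z. Re (z i)) \<in> R"
    proof -
      have "complex_of_real (Re (torus_map d x i)) = 1/2 * ?p x + 1/2 * cnj (?p x)" for x
        using id by (simp add: torus_map_def exp_phi complex_eq_iff)
      then show ?thesis unfolding R_def using tc[of "1/2" "1/2"] by (auto intro!: continuous_intros cc)
    qed
    moreover have "(\<lambda>z. Im (z i)) \<in> R"
    proof -
      have "complex_of_real (Im (torus_map d x i)) = (- \<i> / 2) * ?p x + (\<i> / 2) * cnj (?p x)" for x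
        using id by (simp add: torus_map_def exp_phi complex_eq_iff)
      then show ?thesis unfolding R_def using tc[of "- \<i> / 2" "\<i> / 2"] by (auto intro!: continuous_intros cc)
    qed
    ultimately show "\<exists>f\<in>R. f z \<noteq> f w"
    proof (cases "Re (z i) = Re (w i)")
      case True
      then have "Im (z i) \<noteq> Im (w i)" using i by (simp add: complex_eq_iff)
      then show ?thesis by (intro bexI[OF _ \<open>(\<lambda>z. Im (z i)) \<in> R\<close>])
    next
      case False
      then show ?thesis by (intro bexI[OF _ \<open>(\<lambda>z. Re (z i)) \<in> R\<close>])
    qed
  qed
  obtain h where h: "h \<in> R" "\<forall>z\<in>?S. \<bar>g z - h z\<bar> < e" using Stone_Weierstrass_basic[OF g(1) e] by blast
  then obtain u where u: "trig_poly d u" "\<forall>x\<in>cube d. complex_of_real (h (torus_map d x)) = u x" by (auto simp: R_def)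
  have "cmod (complex_of_real (f x) - u x) < e" if "x \<in> cube d" for x
  proof -
    have "complex_of_real (f x) - u x = complex_of_real (g (torus_map d x) - h (torus_map d x))"
      using u(2) g(2) that by simp
    then show ?thesis using h(2) that by (simp only: norm_of_real) auto
  qed
  then show ?thesis using u(1) by blast
qed

text \<open>Uniform approximation implies approximation in mean square because \<open>unif d\<close>
  has mass 1, and no element of the span of a box is closer than the Fourier partial sum.\<close>

lemma parseval:
  assumes f: "continuous_on (cube d) f" and per: "cube_periodic d f" and e: "e > 0"
  shows "\<exists>N. \<forall>M\<ge>N. l2sq d (\<lambda>x. complex_of_real (f x)) -
    (\<Sum>k\<in>Kset d M. (cmod (l2inner d (\<lambda>x. complex_of_real (f x)) (phi d k)))\<^sup>2) \<le> e"
proof -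
  interpret prob_space "unif d" by (rule prob_space_unif)
  let ?f = "\<lambda>x. complex_of_real (f x)"
  have fb: "cube_bounded d ?f" using f by (intro cube_bounded_continuous continuous_intros)
  obtain u where u: "trig_poly d u" "\<forall>x\<in>cube d. cmod (?f x - u x) < sqrt e"
    using trig_approx[OF f per, of "sqrt e"] e by auto
  obtain N where N: "\<forall>M\<ge>N. \<exists>c. \<forall>x. u x = (\<Sum>k\<in>Kset d M. c k * phi d k x)" using trig_poly_Kset[OF u(1)] by blast
  show ?thesis
  proof (intro exI[of _ N] allI impI)
    fix M assume "M \<ge> N"
    then obtain c where c: "\<forall>x. u x = (\<Sum>k\<in>Kset d M. c k * phi d k x)" using N by blast
    have "l2sq d ?f - (\<Sum>k\<in>Kset d M. (cmod (l2inner d ?f (phi d k)))\<^sup>2) \<le> l2sq d (\<lambda>x. ?f x - (\<Sum>k\<in>Kset d M. c k * phi d k x))"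
      by (subst l2sq_diff_trig[OF fb finite_Kset Kset_subset_Kall]) (simp add: sum_nonneg)
    also have "\<dots> = (\<integral>x. (cmod (?f x - u x))\<^sup>2 \<partial>unif d)"
      using c by (subst l2sq_unif(2)) (auto intro!: fb)
    also have "\<dots> \<le> (\<integral>x. e \<partial>unif d)"
    proof (rule Bochner_Integration.integral_mono')
      fix x assume "x \<in> space (unif d)"
      then have "(cmod (?f x - u x))\<^sup>2 \<le> (sqrt e)\<^sup>2" using u by (intro power_mono) (auto intro: less_imp_le)
      then show "(cmod (?f x - u x))\<^sup>2 \<le> e" using e by simp
    qed (use e in auto)
    also have "\<dots> = e" using prob_space by simp
    finally show "l2sq d ?f - (\<Sum>k\<in>Kset d M. (cmod (l2inner d ?f (phi d k)))\<^sup>2) \<le> e" .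
  qed
qed

section \<open>Bias under periodic Sobolev smoothness\<close>

lemma phi_fun_upd:
  assumes "i < d"
  shows "phi d k (x(i := t)) = phi d k (x(i := 0)) * exp (2 * complex_of_real pi * \<i> * of_int (k i) * complex_of_real t)"
proof -
  have "phi d k (x(i := t)) = exp (2 * complex_of_real pi * \<i> * of_int (k i) * complex_of_real t) *
     (\<Prod>j\<in>{..<d}-{i}. exp (2 * complex_of_real pi * \<i> * of_int (k j) * complex_of_real (x j)))" for t
    unfolding phi_prod using assms by (subst prod.remove[of _ i]) auto
  from this[of t] this[of 0] show ?thesis by simp
qed

text \<open>Integration by parts along coordinate \<open>i\<close> after Fubini: \<open>F\<close> is
  the derivative in that coordinate of \<open>g\<close> times the conjugated character, so each
  fibre integral is a boundary term, which periodicity annihilates.\<close>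

lemma l2inner_pd:
  fixes g :: "(nat \<Rightarrow> real) \<Rightarrow> real"
  assumes i: "i < d" and cg: "continuous_on (cube d) g" and cp: "continuous_on (cube d) (pd i g)"
    and der: "\<And>x. x \<in> cube d \<Longrightarrow> ((\<lambda>t. g (x(i := t))) has_vector_derivative pd i g x) (at (x i) within {0..1})"
    and per: "\<And>x. x \<in> cube d \<Longrightarrow> x i \<in> {0, 1} \<Longrightarrow> g x = g (x(i := 1 - x i))"
  shows "l2inner d (\<lambda>x. complex_of_real (pd i g x)) (phi d k)
    = 2 * complex_of_real pi * \<i> * of_int (k i) * l2inner d (\<lambda>x. complex_of_real (g x)) (phi d k)"
proof -
  \<comment> \<open>The rate of the conjugated character in coordinate \<open>i\<close>, whence the
    sign.\<close>
  define c where "c = 2 * complex_of_real pi * \<i> * of_int (- k i)"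
  define F where "F x = complex_of_real (pd i g x) * cnj (phi d k x) + c * (complex_of_real (g x) * cnj (phi d k x))" for x
  have bp: "cube_bounded d (\<lambda>x. complex_of_real (pd i g x))" and bg: "cube_bounded d (\<lambda>x. complex_of_real (g x))"
    by (intro cube_bounded_continuous continuous_intros cp cg)+
  have bF: "cube_bounded d F" unfolding F_def[abs_def] by (simp add: bp bg)
  have contF: "continuous_on (cube d) F"
    unfolding F_def[abs_def] cnj_phi by (intro continuous_intros cp cg continuous_on_phi)
  interpret u: prob_space unit_int by (rule prob_space_unit_int)
  interpret U: product_prob_space "\<lambda>_. unit_int" "{..<d}" by standard
  let ?I = "{..<d} - {i}"
  have ins: "insert i ?I = {..<d}" using i by auto
  have "(\<integral>x. F x \<partial>unif d) = (\<integral>x. F x \<partial>PiM (insert i ?I) (\<lambda>_. unit_int))"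
    by (simp only: unif_def ins)
  also have "\<dots> = (\<integral>x. (\<integral>t. F (x(i := t)) \<partial>unit_int) \<partial>PiM ?I (\<lambda>_. unit_int))"
  proof (rule U.product_integral_insert)
    show "integrable (PiM (insert i ?I) (\<lambda>_. unit_int)) F"
      using cube_bounded_integrable[OF bF] by (simp only: unif_def ins)
  qed auto
  also have "\<dots> = (\<integral>x. 0 \<partial>PiM ?I (\<lambda>_. unit_int))"
  proof (rule Bochner_Integration.integral_cong[OF refl])
    fix x assume "x \<in> space (PiM ?I (\<lambda>_. unit_int))"
    then have xc: "x(i := t) \<in> cube d" if "0 \<le> t" "t \<le> 1" for t
      using that i by (auto simp: cube_def space_PiM PiE_iff extensional_def)
    define A where "A = cnj (phi d k (x(i := 0)))"
    have ph: "cnj (phi d k (x(i := t))) = A * exp (c * complex_of_real t)" for t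
      by (subst phi_fun_upd[OF i]) (simp add: A_def exp_cnj c_def)
    define h where "h t = complex_of_real (g (x(i := t))) * (A * exp (c * complex_of_real t))" for t
    have "(\<integral>t. F (x(i := t)) \<partial>unit_int) = (\<integral>t. indicator {0..1} t *\<^sub>R F (x(i := t)) \<partial>lborel)"
      by (rule integral_unit_int)
    also have "\<dots> = h 1 - h 0"
    proof (rule integral_FTC_atLeastAtMost)
      fix t :: real assume t: "0 \<le> t" "t \<le> 1"
      have "((\<lambda>t. g (x(i := t))) has_vector_derivative pd i g (x(i := t))) (at t within {0..1})"
        using der[OF xc[OF t]] by simp
      then have 1: "((\<lambda>t. complex_of_real (g (x(i := t)))) has_vector_derivative complex_of_real (pd i g (x(i := t)))) (at t within {0..1})"
        by (rule bounded_linear.has_vector_derivative[OF bounded_linear_of_real])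
      have "((\<lambda>z. A * exp (c * z)) has_field_derivative A * (exp (c * complex_of_real t) * c)) (at (complex_of_real t))"
        by (auto intro!: derivative_eq_intros)
      then have "((\<lambda>t. A * exp (c * complex_of_real t)) has_vector_derivative A * (exp (c * complex_of_real t) * c)) (at t)"
        by (rule has_vector_derivative_real_field)
      then have 2: "((\<lambda>t. A * exp (c * complex_of_real t)) has_vector_derivative A * (exp (c * complex_of_real t) * c)) (at t within {0..1})"
        by (rule has_vector_derivative_at_within)
      show "(h has_vector_derivative F (x(i := t))) (at t within {0..1})"
        unfolding h_def[abs_def] F_def ph
        by (rule has_vector_derivative_eq_rhs[OF has_vector_derivative_mult[OF 1 2]]) (simp add: algebra_simps)
    next
      have "continuous_on UNIV (\<lambda>t. (x(i := t)) j)" for j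
        by (cases "j = i") (auto intro!: continuous_intros)
      then have "continuous_on UNIV (\<lambda>t. x(i := t))" by (rule continuous_on_coordinatewise_then_product)
      then have "continuous_on {0..1} (\<lambda>t. x(i := t))" by (rule continuous_on_subset) auto
      then show "continuous_on {0..1} (\<lambda>t. F (x(i := t)))"
        by (rule continuous_on_compose2[OF contF]) (use xc in auto)
    qed simp
    also have "h 1 - h 0 = 0"
    proof -
      have "g (x(i := 1)) = g (x(i := 0))" using per[OF xc[of 1]] by simp
      moreover have "exp c = 1" unfolding c_def by (rule exp_2pi_int)
      ultimately show ?thesis by (simp add: h_def)
    qed
    finally show "(\<integral>t. F (x(i := t)) \<partial>unit_int) = 0" .
  qed
  finally have "(\<integral>x. F x \<partial>unif d) = 0" by simp
  moreover have "(\<integral>x. F x \<partial>unif d) = l2inner d (\<lambda>x. complex_of_real (pd i g x)) (phi d k) +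
      c * l2inner d (\<lambda>x. complex_of_real (g x)) (phi d k)"
    unfolding F_def using bp bg
    by (subst Bochner_Integration.integral_add) (simp_all add: cube_bounded_integrable l2inner_unif)
  ultimately show ?thesis by (simp add: c_def eq_neg_iff_add_eq_0[symmetric] add_eq_0_iff)
qed

definition unit_multi :: "nat \<Rightarrow> nat \<Rightarrow> nat \<Rightarrow> nat" where
  "unit_multi m i = (\<lambda>j. if j = i then m else 0)"

lemma unit_multi_MI: "i < d \<Longrightarrow> unit_multi m i \<in> MI d m"
  by (auto simp: MI_def unit_multi_def)

lemma pdiff_unit_multi:
  assumes "i < d"
  shows "pdiff d (unit_multi m i) f = pdl (replicate m i) f"
proof -
  have "concat (map (\<lambda>j. replicate (unit_multi m i j) j) [0..<n]) = (if i < n then replicate m i else [])" for n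
    by (induction n) (auto simp: unit_multi_def less_Suc_eq)
  from this[of d] show ?thesis using assms by (simp add: pdiff_def)
qed

lemma finite_MI: "finite (MI d m)"
proof (rule finite_subset)
  show "MI d m \<subseteq> {\<alpha>. \<forall>i. (i \<in> {..<d} \<longrightarrow> \<alpha> i \<in> {..m}) \<and> (i \<notin> {..<d} \<longrightarrow> \<alpha> i = 0)}"
  proof
    fix \<alpha> assume a: "\<alpha> \<in> MI d m"
    have "\<alpha> i \<le> m" if "i < d" for i
    proof -
      have "\<alpha> i \<le> (\<Sum>i<d. \<alpha> i)" using that by (intro member_le_sum) auto
      then show ?thesis using a by (simp add: MI_def)
    qed
    then show "\<alpha> \<in> {\<alpha>. \<forall>i. (i \<in> {..<d} \<longrightarrow> \<alpha> i \<in> {..m}) \<and> (i \<notin> {..<d} \<longrightarrow> \<alpha> i = 0)}"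
      using a by (auto simp: MI_def)
  qed
qed (rule finite_set_of_finite_funs; simp)

lemma sobolev_per_continuous:
  assumes "sobolev_per d \<beta> L f" "i < d" "m \<le> \<beta>"
  shows "continuous_on (cube d) (pdl (replicate m i) f)"
proof -
  have "\<forall>is. set is \<subseteq> {..<d} \<and> length is \<le> \<beta> \<longrightarrow> continuous_on (cube d) (pdl is f)"
    using assms(1) by (auto simp: sobolev_per_def Cbeta_def)
  from this[rule_format, of "replicate m i"] show ?thesis using assms(2,3) by (simp add: set_replicate_conv_if)
qed

lemma sobolev_per_f:
  assumes "sobolev_per d \<beta> L f" "\<beta> \<ge> 1"
  shows "continuous_on (cube d) f" "cube_periodic d f"
proof -
  have "\<forall>is. set is \<subseteq> {..<d} \<and> length is \<le> \<beta> \<longrightarrow> continuous_on (cube d) (pdl is f)"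
    using assms(1) by (auto simp: sobolev_per_def Cbeta_def)
  from this[rule_format, of "[]"] show "continuous_on (cube d) f" by (simp add: pdl_def)
  \<comment> \<open>Periodicity is imposed on orders strictly below \<open>\<beta>\<close>;
    \<open>\<beta> \<ge> 1\<close> makes order zero, that is \<open>f\<close> itself, one of
    them.\<close>
  have p: "\<forall>\<alpha>\<in>MI d 0. \<forall>x\<in>cube d. \<forall>i<d. x i \<in> {0,1} \<longrightarrow> pdiff d \<alpha> f x = pdiff d \<alpha> f (x(i := 1 - x i))"
    using assms by (auto simp: sobolev_per_def)
  show "cube_periodic d f"
    unfolding cube_periodic_def
  proof (intro ballI allI impI)
    fix x i assume *: "x \<in> cube d" "i < d" "x i \<in> {0, 1}"
    have "pdiff d (unit_multi 0 i) f = f" by (subst pdiff_unit_multi[OF *(2)]) (simp add: pdl_def)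
    then show "f x = f (x(i := 1 - x i))"
      using p[rule_format, OF unit_multi_MI[OF *(2)] *] by simp
  qed
qed

lemma l2inner_pdl:
  assumes sob: "sobolev_per d \<beta> L f" and i: "i < d" and "m \<le> \<beta>"
  shows "l2inner d (\<lambda>x. complex_of_real (pdl (replicate m i) f x)) (phi d k)
    = (2 * complex_of_real pi * \<i> * of_int (k i)) ^ m * l2inner d (\<lambda>x. complex_of_real (f x)) (phi d k)"
  using assms(3)
proof (induction m)
  case 0
  then show ?case by (simp add: pdl_def)
next
  case (Suc m)
  let ?g = "pdl (replicate m i) f"
  have S: "pdl (replicate (Suc m) i) f = pd i ?g" by (simp add: pdl_def)
  have "l2inner d (\<lambda>x. complex_of_real (pd i ?g x)) (phi d k)
    = 2 * complex_of_real pi * \<i> * of_int (k i) * l2inner d (\<lambda>x. complex_of_real (?g x)) (phi d k)"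
  proof (rule l2inner_pd[OF i])
    show "continuous_on (cube d) ?g" using sobolev_per_continuous[OF sob i] Suc.prems by simp
    show "continuous_on (cube d) (pd i ?g)" using sobolev_per_continuous[OF sob i Suc.prems] S by simp
    have "\<forall>is. set is \<subseteq> {..<d} \<and> length is < \<beta> \<longrightarrow> (\<forall>i<d. \<forall>x\<in>cube d.
           ((\<lambda>t. pdl is f (x(i := t))) has_vector_derivative pd i (pdl is f) x) (at (x i) within {0..1}))"
      using sob by (auto simp: sobolev_per_def Cbeta_def)
    from this[rule_format, of "replicate m i" i]
    show "((\<lambda>t. ?g (x(i := t))) has_vector_derivative pd i ?g x) (at (x i) within {0..1})" if "x \<in> cube d" for x
      using that i Suc.prems by (simp add: set_replicate_conv_if)
    have p: "\<forall>\<alpha>\<in>MI d m. \<forall>x\<in>cube d. \<forall>i<d. x i \<in> {0,1} \<longrightarrow> pdiff d \<alpha> f x = pdiff d \<alpha> f (x(i := 1 - x i))"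
      using sob Suc_le_lessD[OF Suc.prems] unfolding sobolev_per_def by blast
    show "?g x = ?g (x(i := 1 - x i))" if "x \<in> cube d" "x i \<in> {0, 1}" for x
      using p[rule_format, OF unit_multi_MI[OF i] that(1) i that(2)] unfolding pdiff_unit_multi[OF i] .
  qed
  then show ?case unfolding S using Suc by (simp add: mult.assoc)
qed

text \<open>Only the pure derivatives are kept from the Sobolev sum. For
  \<open>\<beta> \<ge> 1\<close> their multi-indices are distinct, so every term is used at most
  once and no factor \<open>d\<close> appears.\<close>

lemma sum_l2sq_pdl_le:
  assumes sob: "sobolev_per d \<beta> L f" and "\<beta> \<ge> 1"
  shows "(\<Sum>i<d. l2sq d (\<lambda>x. complex_of_real (pdl (replicate \<beta> i) f x))) \<le> L\<^sup>2"
proof -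
  let ?J = "\<lambda>\<alpha>. set_lebesgue_integral (leb d) (cube d) (\<lambda>x. (pdiff d \<alpha> f x)^2)"
  have "(\<Sum>i<d. l2sq d (\<lambda>x. complex_of_real (pdl (replicate \<beta> i) f x))) = (\<Sum>i<d. ?J (unit_multi \<beta> i))"
    by (intro sum.cong refl) (simp add: l2sq_def pdiff_unit_multi)
  also have "\<dots> = (\<Sum>\<alpha>\<in>unit_multi \<beta> ` {..<d}. ?J \<alpha>)"
    using assms(2) by (subst sum.reindex) (auto simp: inj_on_def unit_multi_def fun_eq_iff split: if_splits)
  also have "\<dots> \<le> (\<Sum>\<alpha>\<in>MI d \<beta>. ?J \<alpha>)"
    by (intro sum_mono2 finite_MI) (auto simp: unit_multi_MI set_lebesgue_integral_def intro!: Bochner_Integration.integral_nonneg)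
  also have "\<dots> \<le> L\<^sup>2" using sob by (simp add: sobolev_per_def)
  finally show ?thesis .
qed

text \<open>A frequency outside the box has a coordinate beyond \<open>M\<close>, and that
  coordinate alone makes the weight \<open>W\<close> at most the sum over \<open>i\<close> of the
  multipliers of the pure derivatives. Bessel for each of these derivatives brings in L^2 without a
  factor in \<open>d\<close>; \<open>parseval\<close> replaces the infinite tail by a finite box at
  the price of \<open>e\<close>.\<close>

lemma sobolev_bias_le:
  assumes sob: "sobolev_per d \<beta> L f" and \<beta>: "\<beta> \<ge> 1" and M: "M \<ge> 1"
  shows "l2sq d (\<lambda>x. complex_of_real (f x)) -
    (\<Sum>k\<in>Kset d M. (cmod (l2inner d (\<lambda>x. complex_of_real (f x)) (phi d k)))\<^sup>2) \<le> L\<^sup>2 / (2 * pi * real M) ^ (2 * \<beta>)"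
proof (rule field_le_epsilon)
  fix e :: real assume e: "e > 0"
  define \<theta> where "\<theta> k = l2inner d (\<lambda>x. complex_of_real (f x)) (phi d k)" for k
  define W where "W = (2 * pi * real M) ^ (2 * \<beta>)"
  have W: "W > 0" using M by (simp add: W_def)
  obtain N0 where N0: "\<forall>N\<ge>N0. l2sq d (\<lambda>x. complex_of_real (f x)) - (\<Sum>k\<in>Kset d N. (cmod (\<theta> k))\<^sup>2) \<le> e"
    using parseval[OF sobolev_per_f[OF sob \<beta>] e] unfolding \<theta>_def by blast
  define N where "N = max N0 M"
  have sub: "Kset d M \<subseteq> Kset d N" by (intro Kset_mono) (simp add: N_def)
  have "W * (\<Sum>k\<in>Kset d N - Kset d M. (cmod (\<theta> k))\<^sup>2) = (\<Sum>k\<in>Kset d N - Kset d M. W * (cmod (\<theta> k))\<^sup>2)"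
    by (rule sum_distrib_left)
  also have "\<dots> \<le> (\<Sum>k\<in>Kset d N - Kset d M. \<Sum>i<d. (2 * pi * \<bar>real_of_int (k i)\<bar>) ^ (2 * \<beta>) * (cmod (\<theta> k))\<^sup>2)"
  proof (intro sum_mono)
    fix k assume k: "k \<in> Kset d N - Kset d M"
    then obtain i where i: "i < d" "k i \<notin> {- int M..int M}" by (auto simp: Kset_def PiE_iff)
    then have "real M \<le> \<bar>real_of_int (k i)\<bar>" by (simp add: abs_if) linarith
    then have "W * (cmod (\<theta> k))\<^sup>2 \<le> (2 * pi * \<bar>real_of_int (k i)\<bar>) ^ (2 * \<beta>) * (cmod (\<theta> k))\<^sup>2"
      unfolding W_def by (intro mult_right_mono power_mono mult_left_mono) auto
    also have "\<dots> \<le> (\<Sum>i<d. (2 * pi * \<bar>real_of_int (k i)\<bar>) ^ (2 * \<beta>) * (cmod (\<theta> k))\<^sup>2)"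
      using i by (intro member_le_sum) auto
    finally show "W * (cmod (\<theta> k))\<^sup>2 \<le> (\<Sum>i<d. (2 * pi * \<bar>real_of_int (k i)\<bar>) ^ (2 * \<beta>) * (cmod (\<theta> k))\<^sup>2)" .
  qed
  also have "\<dots> \<le> (\<Sum>k\<in>Kset d N. \<Sum>i<d. (2 * pi * \<bar>real_of_int (k i)\<bar>) ^ (2 * \<beta>) * (cmod (\<theta> k))\<^sup>2)"
    by (intro sum_mono2) (auto intro!: sum_nonneg)
  also have "\<dots> = (\<Sum>i<d. \<Sum>k\<in>Kset d N. (2 * pi * \<bar>real_of_int (k i)\<bar>) ^ (2 * \<beta>) * (cmod (\<theta> k))\<^sup>2)"
    by (rule sum.swap)
  also have "\<dots> \<le> (\<Sum>i<d. l2sq d (\<lambda>x. complex_of_real (pdl (replicate \<beta> i) f x)))"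
  proof (intro sum_mono)
    fix i assume "i \<in> {..<d}"
    then have i: "i < d" by simp
    have "(\<Sum>k\<in>Kset d N. (2 * pi * \<bar>real_of_int (k i)\<bar>) ^ (2 * \<beta>) * (cmod (\<theta> k))\<^sup>2)
       = (\<Sum>k\<in>Kset d N. (cmod (l2inner d (\<lambda>x. complex_of_real (pdl (replicate \<beta> i) f x)) (phi d k)))\<^sup>2)"
      unfolding l2inner_pdl[OF sob i order.refl] \<theta>_def
      by (intro sum.cong refl) (simp add: norm_mult norm_power power_mult_distrib power_mult[symmetric] mult.commute)
    also have "\<dots> \<le> l2sq d (\<lambda>x. complex_of_real (pdl (replicate \<beta> i) f x))"
      by (intro bessel finite_Kset Kset_subset_Kall cube_bounded_continuous continuous_intros sobolev_per_continuous[OF sob i]) simp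
    finally show "(\<Sum>k\<in>Kset d N. (2 * pi * \<bar>real_of_int (k i)\<bar>) ^ (2 * \<beta>) * (cmod (\<theta> k))\<^sup>2)
      \<le> l2sq d (\<lambda>x. complex_of_real (pdl (replicate \<beta> i) f x))" .
  qed
  also have "\<dots> \<le> L\<^sup>2" by (rule sum_l2sq_pdl_le[OF sob \<beta>])
  finally have "(\<Sum>k\<in>Kset d N - Kset d M. (cmod (\<theta> k))\<^sup>2) \<le> L\<^sup>2 / W"
    using W by (simp add: pos_le_divide_eq mult.commute)
  moreover have "(\<Sum>k\<in>Kset d N - Kset d M. (cmod (\<theta> k))\<^sup>2) = (\<Sum>k\<in>Kset d N. (cmod (\<theta> k))\<^sup>2) - (\<Sum>k\<in>Kset d M. (cmod (\<theta> k))\<^sup>2)"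
    by (intro sum_diff finite_Kset sub)
  moreover have "l2sq d (\<lambda>x. complex_of_real (f x)) - (\<Sum>k\<in>Kset d N. (cmod (\<theta> k))\<^sup>2) \<le> e"
    using N0 by (simp add: N_def)
  ultimately show "l2sq d (\<lambda>x. complex_of_real (f x)) -
    (\<Sum>k\<in>Kset d M. (cmod (l2inner d (\<lambda>x. complex_of_real (f x)) (phi d k)))\<^sup>2) \<le> L\<^sup>2 / (2 * pi * real M) ^ (2 * \<beta>) + e"
    unfolding \<theta>_def[symmetric] W_def[symmetric] by linarith
qed

section \<open>A degenerate U-statistic\<close>

lemma cmod_add_sq: "(cmod (a + b))\<^sup>2 = (cmod a)\<^sup>2 + 2 * Re (a * cnj b) + (cmod b)\<^sup>2"
  unfolding cmod_power2 by (simp add: power2_eq_square algebra_simps)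

lemma (in prob_space) complex_variance_le:
  assumes u: "bounded_meas M (u :: 'a \<Rightarrow> complex)"
  shows "(\<integral>x. (cmod (u x - (\<integral>y. u y \<partial>M)))\<^sup>2 \<partial>M) \<le> (\<integral>x. (cmod (u x))\<^sup>2 \<partial>M)"
proof -
  define m where "m = (\<integral>y. u y \<partial>M)"
  note [simp] = bounded_meas_integrable u
  have "(cmod (u x - m))\<^sup>2 = (cmod (u x))\<^sup>2 - 2 * Re (u x * cnj m) + (cmod m)\<^sup>2" for x
    using cmod_add_sq[of "u x" "- m"] by simp
  then have "(\<integral>x. (cmod (u x - m))\<^sup>2 \<partial>M) = (\<integral>x. (cmod (u x))\<^sup>2 - 2 * Re (u x * cnj m) + (cmod m)\<^sup>2 \<partial>M)"
    by simp
  also have "\<dots> = (\<integral>x. (cmod (u x))\<^sup>2 \<partial>M) - 2 * (\<integral>x. Re (u x * cnj m) \<partial>M) + (cmod m)\<^sup>2"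
    by (simp add: prob_space)
  also have "(\<integral>x. Re (u x * cnj m) \<partial>M) = Re (m * cnj m)"
    by (subst integral_Re) (simp_all add: m_def)
  also have "\<dots> = (cmod m)\<^sup>2" unfolding cmod_power2 by (simp add: power2_eq_square)
  finally show ?thesis unfolding m_def[symmetric] by simp
qed

text \<open>\<open>quad\<close> controls the features as a quadratic form. Cauchy-Schwarz alone
  would give \<open>card K\<close> instead of \<open>B\<close>; in the application \<open>B\<close>
  is the sup norm of the density and stays fixed as the box grows.\<close>

locale bounded_features = prob_space P for P :: "'a measure" +
  fixes K :: "'k set" and e :: "'k \<Rightarrow> 'a \<Rightarrow> complex" and B :: real
  assumes finK: "finite K" and meas_e: "\<And>k. e k \<in> borel_measurable P"
    and norm_e: "\<And>k x. cmod (e k x) \<le> 1"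
    and quad: "\<And>s. (\<integral>x. (cmod (\<Sum>k\<in>K. s k * cnj (e k x)))\<^sup>2 \<partial>P) \<le> B * (\<Sum>k\<in>K. (cmod (s k))\<^sup>2)"
    and B0: "B \<ge> 0"
begin

definition \<psi> where "\<psi> k x = e k x - (\<integral>y. e k y \<partial>P)"

definition S :: "nat \<Rightarrow> 'k \<Rightarrow> (nat \<Rightarrow> 'a) \<Rightarrow> complex" where "S n k X = (\<Sum>j<n. \<psi> k (X j))"

definition V :: "nat \<Rightarrow> (nat \<Rightarrow> 'a) \<Rightarrow> real" where
  "V n X = (\<Sum>k\<in>K. (cmod (S n k X))\<^sup>2) - (\<Sum>j<n. \<Sum>k\<in>K. (cmod (\<psi> k (X j)))\<^sup>2)"

lemma bounded_e [simp]: "bounded_meas P (e k)"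
  using meas_e norm_e by (auto simp: bounded_meas_def)

lemma bounded_psi [simp]: "bounded_meas P (\<psi> k)"
  unfolding \<psi>_def[abs_def] by simp

lemma integral_psi: "(\<integral>x. \<psi> k x \<partial>P) = 0"
  unfolding \<psi>_def by (simp add: bounded_meas_integrable prob_space)

lemma norm_mean_le: "cmod (\<integral>y. e k y \<partial>P) \<le> 1"
proof -
  have "cmod (\<integral>y. e k y \<partial>P) \<le> (\<integral>y. cmod (e k y) \<partial>P)" by (rule integral_norm_bound)
  also have "\<dots> \<le> (\<integral>y. 1 \<partial>P)"
    by (intro integral_mono) (simp_all add: bounded_meas_integrable norm_e)
  finally show ?thesis by (simp add: prob_space)
qed

lemma norm_psi_le: "cmod (\<psi> k x) \<le> 2"
  using norm_triangle_ineq4[of "e k x" "\<integral>y. e k y \<partial>P"] norm_e[of k x] norm_mean_le[of k]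
  by (simp add: \<psi>_def)

lemma integral_psi_sq_le: "(\<integral>x. (cmod (\<psi> k x))\<^sup>2 \<partial>P) \<le> 1"
proof -
  have "(\<integral>x. (cmod (\<psi> k x))\<^sup>2 \<partial>P) \<le> (\<integral>x. (cmod (e k x))\<^sup>2 \<partial>P)"
    unfolding \<psi>_def by (intro complex_variance_le) simp
  also have "\<dots> \<le> (\<integral>x. 1 \<partial>P)"
    by (intro integral_mono) (simp_all add: bounded_meas_integrable norm_e power_le_one)
  finally show ?thesis by (simp add: prob_space)
qed

lemma quad_psi: "(\<integral>x. (cmod (\<Sum>k\<in>K. s k * cnj (\<psi> k x)))\<^sup>2 \<partial>P) \<le> B * (\<Sum>k\<in>K. (cmod (s k))\<^sup>2)"
proof -
  let ?u = "\<lambda>x. \<Sum>k\<in>K. s k * cnj (e k x)"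
  have "(\<integral>y. ?u y \<partial>P) = (\<Sum>k\<in>K. s k * cnj (\<integral>y. e k y \<partial>P))"
    by (subst Bochner_Integration.integral_sum) (simp_all add: bounded_meas_integrable)
  then have "(\<Sum>k\<in>K. s k * cnj (\<psi> k x)) = ?u x - (\<integral>y. ?u y \<partial>P)" for x
    by (simp add: \<psi>_def right_diff_distrib sum_subtractf)
  then have "(\<integral>x. (cmod (\<Sum>k\<in>K. s k * cnj (\<psi> k x)))\<^sup>2 \<partial>P) \<le> (\<integral>x. (cmod (?u x))\<^sup>2 \<partial>P)"
    using complex_variance_le[of ?u] by simp
  also have "\<dots> \<le> B * (\<Sum>k\<in>K. (cmod (s k))\<^sup>2)" by (rule quad)
  finally show ?thesis .
qed

abbreviation PP :: "nat \<Rightarrow> (nat \<Rightarrow> 'a) measure" where "PP n \<equiv> PiM {..<n} (\<lambda>_. P)"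

lemma prob_space_PP: "prob_space (PP n)"
  by (intro prob_space_PiM) unfold_locales

lemma bounded_psi_comp [simp]: "j < n \<Longrightarrow> bounded_meas (PP n) (\<lambda>X. \<psi> k (X j))"
  by (rule bounded_meas_compose[OF bounded_psi]) simp

lemma bounded_S [simp]: "bounded_meas (PP n) (S n k)"
  unfolding S_def[abs_def] by (intro bounded_meas_sum bounded_psi_comp) auto

lemma bounded_V [simp]: "bounded_meas (PP n) (V n)"
  unfolding V_def[abs_def]
  by (intro bounded_meas_diff bounded_meas_sum bounded_meas_power bounded_meas_norm bounded_S bounded_psi_comp) auto

lemma integrable_PP: "bounded_meas (PP n) g \<Longrightarrow> integrable (PP n) g"
  using finite_measure.bounded_meas_integrable prob_space_PP prob_space.finite_measure by blast

lemma S_Suc: "S (Suc n) k (X(n := y)) = S n k X + \<psi> k y"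
  by (simp add: S_def)

text \<open>Removing the diagonal leaves only the cross term as increment. It has mean zero in the
  new observation, so \<open>V\<close> is a martingale in \<open>n\<close>.\<close>

lemma V_Suc: "V (Suc n) (X(n := y)) = V n X + 2 * Re (\<Sum>k\<in>K. S n k X * cnj (\<psi> k y))"
proof -
  show ?thesis by (simp add: V_def S_Suc cmod_add_sq sum.distrib sum_distrib_left)
qed

lemma integral_PP_Suc:
  assumes "bounded_meas (PP (Suc n)) (g :: _ \<Rightarrow> real)"
  shows "(\<integral>X. g X \<partial>PP (Suc n)) = (\<integral>X. (\<integral>y. g (X(n := y)) \<partial>P) \<partial>PP n)"
proof -
  interpret U: product_prob_space "\<lambda>_. P" "{..<n}" by standard
  show ?thesis
    using integrable_PP[OF assms] U.product_integral_insert[of "{..<n}" n g] by (simp add: lessThan_Suc)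
qed

lemma expectation_S_sq_le: "(\<integral>X. (\<Sum>k\<in>K. (cmod (S n k X))\<^sup>2) \<partial>PP n) \<le> real n * real (card K)"
proof (induction n)
  case 0
  then show ?case by (simp add: S_def)
next
  case (Suc n)
  interpret PP: prob_space "PP n" by (rule prob_space_PP)
  have inner: "(\<integral>y. (\<Sum>k\<in>K. (cmod (S (Suc n) k (X(n := y))))\<^sup>2) \<partial>P) \<le> (\<Sum>k\<in>K. (cmod (S n k X))\<^sup>2) + real (card K)" for X
  proof -
    have "(\<integral>y. (\<Sum>k\<in>K. (cmod (S (Suc n) k (X(n := y))))\<^sup>2) \<partial>P)
      = (\<integral>y. (\<Sum>k\<in>K. (cmod (S n k X))\<^sup>2 + 2 * Re (S n k X * cnj (\<psi> k y)) + (cmod (\<psi> k y))\<^sup>2) \<partial>P)"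
      by (simp add: S_Suc cmod_add_sq)
    also have "\<dots> = (\<Sum>k\<in>K. (\<integral>y. (cmod (S n k X))\<^sup>2 + 2 * Re (S n k X * cnj (\<psi> k y)) + (cmod (\<psi> k y))\<^sup>2 \<partial>P))"
      by (rule Bochner_Integration.integral_sum) (simp add: bounded_meas_integrable)
    also have "\<dots> \<le> (\<Sum>k\<in>K. (cmod (S n k X))\<^sup>2 + 1)"
    proof (intro sum_mono)
      fix k
      have "(\<integral>y. Re (S n k X * cnj (\<psi> k y)) \<partial>P) = 0"
        by (subst integral_Re) (simp_all add: bounded_meas_integrable integral_psi)
      then show "(\<integral>y. (cmod (S n k X))\<^sup>2 + 2 * Re (S n k X * cnj (\<psi> k y)) + (cmod (\<psi> k y))\<^sup>2 \<partial>P) \<le> (cmod (S n k X))\<^sup>2 + 1"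
        using integral_psi_sq_le[of k] by (simp add: bounded_meas_integrable prob_space)
    qed
    finally show ?thesis by (simp add: sum.distrib)
  qed
  have bd: "bounded_meas (PP (Suc n)) (\<lambda>X. \<Sum>k\<in>K. (cmod (S (Suc n) k X))\<^sup>2)" by simp
  have "(\<integral>X. (\<Sum>k\<in>K. (cmod (S (Suc n) k X))\<^sup>2) \<partial>PP (Suc n))
    = (\<integral>X. (\<integral>y. (\<Sum>k\<in>K. (cmod (S (Suc n) k (X(n := y))))\<^sup>2) \<partial>P) \<partial>PP n)"
    by (rule integral_PP_Suc[OF bd])
  also have "\<dots> \<le> (\<integral>X. (\<Sum>k\<in>K. (cmod (S n k X))\<^sup>2) + real (card K) \<partial>PP n)"
    by (rule integral_mono') (auto simp: integrable_PP inner intro!: add_nonneg_nonneg sum_nonneg)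
  also have "\<dots> = (\<integral>X. (\<Sum>k\<in>K. (cmod (S n k X))\<^sup>2) \<partial>PP n) + real (card K)"
    by (subst Bochner_Integration.integral_add) (simp_all add: integrable_PP PP.prob_space)
  finally show ?case using Suc by (simp add: algebra_simps)
qed

text \<open>Martingale increments are orthogonal. By \<open>quad_psi\<close> and
  \<open>expectation_S_sq_le\<close>, the increment after m observations has second moment at most 4
  B m times the number of features; summing over m < n turns the 4 into a 2.\<close>

lemma expectation_V_sq_le: "(\<integral>X. (V n X)\<^sup>2 \<partial>PP n) \<le> 2 * B * real (card K) * (real n)\<^sup>2"
proof (induction n)
  case 0
  then show ?case by (simp add: V_def S_def)
next
  case (Suc n)
  interpret PP: prob_space "PP n" by (rule prob_space_PP)
  have inner: "(\<integral>y. (V (Suc n) (X(n := y)))\<^sup>2 \<partial>P) \<le> (V n X)\<^sup>2 + 4 * B * (\<Sum>k\<in>K. (cmod (S n k X))\<^sup>2)" for X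
  proof -
    let ?u = "\<lambda>y. \<Sum>k\<in>K. S n k X * cnj (\<psi> k y)"
    have bu: "bounded_meas P ?u" by simp
    have "(\<integral>y. ?u y \<partial>P) = 0"
      by (subst Bochner_Integration.integral_sum) (simp_all add: bounded_meas_integrable integral_psi)
    then have "(\<integral>y. Re (?u y) \<partial>P) = 0"
      using bu by (subst integral_Re) (simp_all only: bounded_meas_integrable zero_complex.sel)
    moreover have "(\<integral>y. (Re (?u y))\<^sup>2 \<partial>P) \<le> (\<integral>y. (cmod (?u y))\<^sup>2 \<partial>P)"
    proof (rule integral_mono)
      show "integrable P (\<lambda>y. (Re (?u y))\<^sup>2)" "integrable P (\<lambda>y. (cmod (?u y))\<^sup>2)"
        by (intro bounded_meas_integrable bounded_meas_power bounded_meas_Re bounded_meas_norm bu)+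
      show "(Re (?u y))\<^sup>2 \<le> (cmod (?u y))\<^sup>2" for y using abs_Re_le_cmod[of "?u y"] by (simp add: abs_le_square_iff[symmetric])
    qed
    moreover have "(\<integral>y. (V (Suc n) (X(n := y)))\<^sup>2 \<partial>P) = (V n X)\<^sup>2 + 4 * V n X * (\<integral>y. Re (?u y) \<partial>P) + 4 * (\<integral>y. (Re (?u y))\<^sup>2 \<partial>P)"
    proof -
      have "(V (Suc n) (X(n := y)))\<^sup>2 = (V n X)\<^sup>2 + 4 * V n X * Re (?u y) + 4 * (Re (?u y))\<^sup>2" for y
        unfolding V_Suc by (simp add: power2_eq_square algebra_simps del: Re_sum)
      moreover have "integrable P (\<lambda>y. Re (?u y))" "integrable P (\<lambda>y. (Re (?u y))\<^sup>2)"
        by (intro bounded_meas_integrable bounded_meas_power bounded_meas_Re bu)+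
      ultimately show ?thesis by (simp add: prob_space del: Re_sum)
    qed
    ultimately show ?thesis using quad_psi[of "\<lambda>k. S n k X"] by (simp del: Re_sum)
  qed
  have bd: "bounded_meas (PP (Suc n)) (\<lambda>X. (V (Suc n) X)\<^sup>2)" by simp
  have "(\<integral>X. (V (Suc n) X)\<^sup>2 \<partial>PP (Suc n)) = (\<integral>X. (\<integral>y. (V (Suc n) (X(n := y)))\<^sup>2 \<partial>P) \<partial>PP n)"
    by (rule integral_PP_Suc[OF bd])
  also have "\<dots> \<le> (\<integral>X. (V n X)\<^sup>2 + 4 * B * (\<Sum>k\<in>K. (cmod (S n k X))\<^sup>2) \<partial>PP n)"
    using B0 by (intro integral_mono') (auto simp: integrable_PP inner intro!: add_nonneg_nonneg mult_nonneg_nonneg sum_nonneg)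
  also have "\<dots> = (\<integral>X. (V n X)\<^sup>2 \<partial>PP n) + 4 * B * (\<integral>X. (\<Sum>k\<in>K. (cmod (S n k X))\<^sup>2) \<partial>PP n)"
    by (subst Bochner_Integration.integral_add) (simp_all add: integrable_PP)
  also have "\<dots> \<le> 2 * B * real (card K) * (real n)\<^sup>2 + 4 * B * (real n * real (card K))"
    using B0 by (intro add_mono Suc mult_left_mono expectation_S_sq_le) auto
  also have "\<dots> \<le> 2 * B * real (card K) * (real (Suc n))\<^sup>2"
    using B0 by (simp add: power2_eq_square algebra_simps)
  finally show ?case .
qed

text \<open>With the diagonal terms removed, \<open>V\<close> is a degenerate U-statistic whose second moment is
  small enough for \<open>(u - t)\<^sub>+ \<le> u\<^sup>2 / (4 t)\<close> to replace a Talagrand-type concentration inequality.\<close>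

lemma nn_integral_excess_le:
  assumes n: "n > 0" and K: "K \<noteq> {}"
  shows "(\<integral>\<^sup>+X. ennreal ((\<Sum>k\<in>K. (cmod ((\<Sum>j<n. e k (X j)) / of_nat n - (\<integral>y. e k y \<partial>P)))\<^sup>2) - 24 * real (card K) / real n) \<partial>PP n)
    \<le> ennreal (B / (40 * real n))"
proof -
  let ?D = "real (card K)"
  have D: "?D > 0" using K finK by (simp add: card_gt_0_iff)
  \<comment> \<open>This is the quadratic bound with u = V / n^2 and t = 20 D / n. The remaining 4
    out of 24 pays for the diagonal, since \<open>norm_psi_le\<close> bounds each squared entry by
    4.\<close>
  define c where "c = 1 / (80 * ?D * real n ^ 3)"
  have c: "c \<ge> 0" using D by (simp add: c_def)
  have pt: "(\<Sum>k\<in>K. (cmod ((\<Sum>j<n. e k (X j)) / of_nat n - (\<integral>y. e k y \<partial>P)))\<^sup>2) - 24 * ?D / real n \<le> c * (V n X)\<^sup>2" for X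
  proof -
    have S: "(\<Sum>j<n. e k (X j)) / of_nat n - (\<integral>y. e k y \<partial>P) = S n k X / of_nat n" for k
      using n by (simp add: S_def \<psi>_def sum_subtractf diff_divide_distrib)
    have "(\<Sum>j<n. \<Sum>k\<in>K. (cmod (\<psi> k (X j)))\<^sup>2) \<le> (\<Sum>j<n. \<Sum>k\<in>K. 2\<^sup>2)"
      by (intro sum_mono power_mono norm_psi_le) auto
    then have "(\<Sum>k\<in>K. (cmod (S n k X))\<^sup>2) \<le> V n X + 4 * ?D * real n" by (simp add: V_def mult_ac)
    then have "(\<Sum>k\<in>K. (cmod (S n k X))\<^sup>2) / (real n)\<^sup>2 - 24 * ?D / real n \<le> (V n X + 4 * ?D * real n) / (real n)\<^sup>2 - 24 * ?D / real n"
      by (intro diff_right_mono divide_right_mono) auto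
    also have "\<dots> = V n X / (real n)\<^sup>2 - 20 * ?D / real n"
      using n by (simp add: field_simps power2_eq_square)
    also have "\<dots> \<le> c * (V n X)\<^sup>2"
    proof -
      have "0 \<le> (V n X - 40 * ?D * real n)\<^sup>2" by simp
      then have "80 * ?D * real n * V n X - 1600 * ?D\<^sup>2 * (real n)\<^sup>2 \<le> (V n X)\<^sup>2"
        by (simp add: power2_eq_square algebra_simps)
      then have "c * (80 * ?D * real n * V n X - 1600 * ?D\<^sup>2 * (real n)\<^sup>2) \<le> c * (V n X)\<^sup>2" using c by (intro mult_left_mono)
      moreover have "c * (80 * ?D * real n * V n X - 1600 * ?D\<^sup>2 * (real n)\<^sup>2) = V n X / (real n)\<^sup>2 - 20 * ?D / real n"
        using n D unfolding c_def by (simp add: field_simps power2_eq_square power3_eq_cube)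
      ultimately show ?thesis by simp
    qed
    finally show ?thesis unfolding S by (simp add: norm_divide power_divide sum_divide_distrib)
  qed
  have "(\<integral>\<^sup>+X. ennreal ((\<Sum>k\<in>K. (cmod ((\<Sum>j<n. e k (X j)) / of_nat n - (\<integral>y. e k y \<partial>P)))\<^sup>2) - 24 * ?D / real n) \<partial>PP n)
     \<le> (\<integral>\<^sup>+X. ennreal (c * (V n X)\<^sup>2) \<partial>PP n)"
    by (intro nn_integral_mono ennreal_leI pt)
  also have "\<dots> = ennreal (\<integral>X. c * (V n X)\<^sup>2 \<partial>PP n)"
    using c by (intro nn_integral_eq_integral) (simp_all add: integrable_PP)
  also have "\<dots> \<le> ennreal (c * (2 * B * ?D * (real n)\<^sup>2))"
    using c expectation_V_sq_le[of n] by (intro ennreal_leI) (simp add: mult_left_mono)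
  also have "c * (2 * B * ?D * (real n)\<^sup>2) = B / (40 * real n)"
    using n D by (simp add: c_def field_simps power2_eq_square power3_eq_cube)
  finally show ?thesis .
qed

end

section \<open>The empirical coefficients\<close>

lemma borel_measurable_phi_leb [measurable]: "phi d k \<in> borel_measurable (leb d)"
proof -
  have [measurable]: "(\<lambda>x. \<Sum>i<d. real_of_int (k i) * x i) \<in> borel_measurable (leb d)"
  proof (intro borel_measurable_sum)
    fix i assume "i \<in> {..<d}"
    then have "(\<lambda>x. x i) \<in> measurable (leb d) lborel"
      unfolding leb_def by (rule measurable_component_singleton)
    then have [measurable]: "(\<lambda>x. x i) \<in> borel_measurable (leb d)" by (simp only: measurable_lborel1)
    show "(\<lambda>x. real_of_int (k i) * x i) \<in> borel_measurable (leb d)" by measurable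
  qed
  have "(\<lambda>t. exp (2 * complex_of_real pi * \<i> * complex_of_real t)) \<in> borel_measurable borel"
    by (intro borel_measurable_continuous_onI continuous_intros)
  then show ?thesis unfolding phi_def[abs_def] by (rule measurable_compose[rotated]) measurable
qed

lemma le_supnorm:
  assumes "continuous_on (cube d) f" "x \<in> cube d"
  shows "\<bar>f x\<bar> \<le> supnorm d f"
proof -
  have "bounded (f ` cube d)" using compact_continuous_image[OF assms(1) compact_cube] compact_imp_bounded by blast
  then obtain C where "\<forall>x\<in>cube d. \<bar>f x\<bar> \<le> C" by (auto simp: bounded_iff)
  then have "bdd_above ((\<lambda>x. \<bar>f x\<bar>) ` cube d)" by (auto simp: bdd_above_def)
  then show ?thesis unfolding supnorm_def using assms(2) by (intro cSUP_upper)
qed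

locale density_on_cube =
  fixes d :: nat and f :: "(nat \<Rightarrow> real) \<Rightarrow> real"
  assumes cont: "continuous_on (cube d) f" and dens: "is_density d f"
begin

lemma f_measurable [measurable]: "f \<in> borel_measurable (leb d)"
  using dens by (simp add: is_density_def)

lemma f_nonneg: "x \<in> cube d \<Longrightarrow> 0 \<le> f x"
  using dens by (simp add: is_density_def)

lemma bounded_f [simp]: "bounded_meas (unif d) f"
proof -
  have "\<forall>x\<in>cube d. norm (f x) \<le> supnorm d f" using le_supnorm[OF cont] by simp
  then show ?thesis using borel_measurable_unif_of_leb[OF f_measurable] by (auto simp: bounded_meas_def)
qed

lemma bounded_of_real_f [simp]: "cube_bounded d (\<lambda>x. complex_of_real (f x))"
  using bounded_f by (auto simp: bounded_meas_def)

lemma sets_obs_law [simp, measurable_cong]: "sets (obs_law d f) = sets (leb d)"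
  by (simp add: obs_law_def)

lemma integral_obs_law:
  fixes u :: "_ \<Rightarrow> 'b::{banach, second_countable_topology}"
  assumes [measurable]: "u \<in> borel_measurable (leb d)"
  shows "(\<integral>x. u x \<partial>obs_law d f) = (\<integral>x. f x *\<^sub>R u x \<partial>unif d)"
proof -
  have "(\<integral>x. u x \<partial>obs_law d f) = (\<integral>x. (indicator (cube d) x * f x) *\<^sub>R u x \<partial>leb d)"
    unfolding obs_law_def by (subst integral_density) (auto simp: indicator_def f_nonneg)
  also have "\<dots> = set_lebesgue_integral (leb d) (cube d) (\<lambda>x. f x *\<^sub>R u x)"
    by (simp add: set_lebesgue_integral_def)
  also have "\<dots> = (\<integral>x. f x *\<^sub>R u x \<partial>unif d)"
    by (intro set_integral_cube borel_measurable_unif_of_leb) measurable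
  finally show ?thesis .
qed

lemma prob_space_obs_law: "prob_space (obs_law d f)"
proof
  interpret prob_space "unif d" by (rule prob_space_unif)
  have "emeasure (obs_law d f) (space (obs_law d f)) = (\<integral>\<^sup>+x. ennreal (indicator (cube d) x * f x) \<partial>leb d)"
    unfolding obs_law_def by (subst emeasure_density) (auto intro!: nn_integral_cong simp: indicator_def)
  also have "\<dots> = (\<integral>\<^sup>+x. indicator (cube d) x * ennreal (f x) \<partial>leb d)"
    by (intro nn_integral_cong) (simp add: indicator_def)
  also have "\<dots> = (\<integral>\<^sup>+x. ennreal (f x) \<partial>unif d)" by (rule nn_integral_cube) measurable
  also have "\<dots> = ennreal (\<integral>x. f x \<partial>unif d)"
    by (intro nn_integral_eq_integral bounded_meas_integrable bounded_f AE_I2) (simp add: f_nonneg)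
  also have "(\<integral>x. f x \<partial>unif d) = 1"
    using dens set_integral_cube[OF borel_measurable_unif_of_leb[OF f_measurable]] by (simp add: is_density_def)
  finally show "emeasure (obs_law d f) (space (obs_law d f)) = 1" by simp
qed

lemma mean_cnj_phi:
  "(\<integral>x. cnj (phi d k x) \<partial>obs_law d f) = l2inner d (\<lambda>x. complex_of_real (f x)) (phi d k)"
  by (subst integral_obs_law) (simp_all add: l2inner_unif scaleR_conv_of_real)

text \<open>Replacing the density by its sup norm leaves the quadratic form under the uniform law,
  which orthonormality evaluates exactly.\<close>

lemma bounded_features: "bounded_features (obs_law d f) (Kset d M) (\<lambda>k x. cnj (phi d k x)) (supnorm d f)"
proof -
  interpret P: prob_space "obs_law d f" by (rule prob_space_obs_law)
  interpret U: prob_space "unif d" by (rule prob_space_unif)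
  have ne: "(\<lambda>i\<in>{..<d}. 0) \<in> cube d" by (auto simp: cube_def)
  show ?thesis
  proof (unfold_locales)
    show "finite (Kset d M)" by simp
    show "(\<lambda>x. cnj (phi d k x)) \<in> borel_measurable (obs_law d f)" for k by measurable
    show "cmod (cnj (phi d k x)) \<le> 1" for k x by simp
    show "0 \<le> supnorm d f" using order_trans[OF abs_ge_zero le_supnorm[OF cont ne]] .
    fix s :: "(nat \<Rightarrow> int) \<Rightarrow> complex"
    let ?u = "\<lambda>x. \<Sum>k\<in>Kset d M. s k * phi d k x"
    have bu: "cube_bounded d ?u" by simp
    have "(\<integral>x. (cmod (\<Sum>k\<in>Kset d M. s k * cnj (cnj (phi d k x))))\<^sup>2 \<partial>obs_law d f)
       = (\<integral>x. f x *\<^sub>R (cmod (?u x))\<^sup>2 \<partial>unif d)"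
      by (subst integral_obs_law) simp_all
    also have "\<dots> \<le> (\<integral>x. supnorm d f * (cmod (?u x))\<^sup>2 \<partial>unif d)"
    proof (rule integral_mono)
      show "integrable (unif d) (\<lambda>x. f x *\<^sub>R (cmod (?u x))\<^sup>2)"
        unfolding real_scaleR_def
        by (intro U.bounded_meas_integrable bounded_meas_mult bounded_meas_power bounded_meas_norm bu bounded_f)
      show "integrable (unif d) (\<lambda>x. supnorm d f * (cmod (?u x))\<^sup>2)"
        by (intro U.bounded_meas_integrable bounded_meas_mult bounded_meas_const bounded_meas_power bounded_meas_norm bu)
      fix x assume "x \<in> space (unif d)"
      then have "f x \<le> supnorm d f" using le_supnorm[OF cont, of x] by simp
      then show "f x *\<^sub>R (cmod (?u x))\<^sup>2 \<le> supnorm d f * (cmod (?u x))\<^sup>2"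
        by (simp add: mult_right_mono)
    qed
    also have "\<dots> = supnorm d f * l2sq d ?u" by (simp add: l2sq_unif(2)[OF bu])
    also have "l2sq d ?u = (\<Sum>k\<in>Kset d M. (cmod (s k))\<^sup>2)" by (intro l2sq_trig finite_Kset Kset_subset_Kall)
    finally show "(\<integral>x. (cmod (\<Sum>k\<in>Kset d M. s k * cnj (cnj (phi d k x))))\<^sup>2 \<partial>obs_law d f)
      \<le> supnorm d f * (\<Sum>k\<in>Kset d M. (cmod (s k))\<^sup>2)" .
  qed
qed

lemma prob_space_sample_law: "prob_space (sample_law d n f)"
  unfolding sample_law_def by (intro prob_space_PiM prob_space_obs_law)

lemma nn_integral_sample_excess_le:
  assumes n: "n > 0"
  shows "(\<integral>\<^sup>+X. ennreal ((\<Sum>k\<in>Kset d M. (cmod (theta_emp d n X k - l2inner d (\<lambda>x. complex_of_real (f x)) (phi d k)))\<^sup>2)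
      - 24 * (2 * real M + 1) ^ d / real n) \<partial>sample_law d n f) \<le> ennreal (supnorm d f / (40 * real n))"
proof -
  interpret bounded_features "obs_law d f" "Kset d M" "\<lambda>k x. cnj (phi d k x)" "supnorm d f" by (rule bounded_features)
  have "Kset d M \<noteq> {}" using card_Kset[of d M] by auto
  from nn_integral_excess_le[OF n this] show ?thesis
    by (simp only: theta_emp_def sample_law_def mean_cnj_phi card_Kset)
qed

lemma borel_measurable_theta_emp [measurable]: "(\<lambda>X. theta_emp d n X k) \<in> borel_measurable (sample_law d n f)"
proof -
  have "(\<lambda>X. cnj (phi d k (X j))) \<in> borel_measurable (sample_law d n f)" if "j < n" for j
  proof (rule measurable_compose[of "\<lambda>X. X j" _ "obs_law d f" "\<lambda>x. cnj (phi d k x)"])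
    show "(\<lambda>X. X j) \<in> measurable (sample_law d n f) (obs_law d f)"
      unfolding sample_law_def using that by (intro measurable_component_singleton) simp
  qed measurable
  then show ?thesis unfolding theta_emp_def by (intro borel_measurable_divide borel_measurable_sum) auto
qed

end

section \<open>The selection procedure\<close>

lemma l2sq_minus_commute: "l2sq d (\<lambda>x. g x - h x) = l2sq d (\<lambda>x. h x - g x)"
  by (simp add: l2sq_def norm_minus_commute)

lemma l2sq_add_le:
  assumes "cube_bounded d g" "cube_bounded d h"
  shows "l2sq d (\<lambda>x. g x + h x) \<le> 2 * l2sq d g + 2 * l2sq d h"
proof -
  interpret U: prob_space "unif d" by (rule prob_space_unif)
  have i: "integrable (unif d) (\<lambda>x. (cmod (g x))\<^sup>2)" "integrable (unif d) (\<lambda>x. (cmod (h x))\<^sup>2)"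
    "integrable (unif d) (\<lambda>x. (cmod (g x + h x))\<^sup>2)"
    using assms by (simp_all add: U.bounded_meas_integrable)
  have "l2sq d (\<lambda>x. g x + h x) = (\<integral>x. (cmod (g x + h x))\<^sup>2 \<partial>unif d)"
    using assms by (intro l2sq_unif) simp
  also have "\<dots> \<le> (\<integral>x. 2 * (cmod (g x))\<^sup>2 + 2 * (cmod (h x))\<^sup>2 \<partial>unif d)"
  proof (rule integral_mono)
    fix x
    have "(cmod (g x + h x))\<^sup>2 \<le> (cmod (g x) + cmod (h x))\<^sup>2" by (intro power_mono norm_triangle_ineq) simp
    also have "\<dots> \<le> 2 * (cmod (g x))\<^sup>2 + 2 * (cmod (h x))\<^sup>2"
      using sum_squares_bound[of "cmod (g x)" "cmod (h x)"] by (simp add: power2_sum)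
    finally show "(cmod (g x + h x))\<^sup>2 \<le> 2 * (cmod (g x))\<^sup>2 + 2 * (cmod (h x))\<^sup>2" .
  qed (use i in auto)
  also have "\<dots> = 2 * l2sq d g + 2 * l2sq d h"
    using i assms by (simp add: l2sq_unif)
  finally show ?thesis .
qed

lemma cmod_diff_sq_le: "(cmod (a - b))\<^sup>2 \<le> 2 * (cmod a)\<^sup>2 + 2 * (cmod b)\<^sup>2"
proof -
  have "(cmod (a - b))\<^sup>2 \<le> (cmod a + cmod b)\<^sup>2" by (intro power_mono norm_triangle_ineq4) simp
  also have "\<dots> \<le> 2 * (cmod a)\<^sup>2 + 2 * (cmod b)\<^sup>2"
    using sum_squares_bound[of "cmod a" "cmod b"] by (simp add: power2_sum)
  finally show ?thesis .
qed

lemma cmod_add_sq_le: "(cmod (a + b))\<^sup>2 \<le> 2 * (cmod a)\<^sup>2 + 2 * (cmod b)\<^sup>2"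
  using cmod_diff_sq_le[of a "- b"] by simp

lemma fhat_expand:
  assumes "M \<le> M'"
  shows "fhat d n \<rho> Ms X \<xi> M x = (\<Sum>k\<in>Kset d M'. (if k \<in> Kset d M then coef d n \<rho> Ms X \<xi> M k else 0) * phi d k x)"
  unfolding fhat_def using Kset_mono[OF assms, of d]
  by (intro sum.mono_neutral_cong_left) auto

lemma proj_fhat:
  "proj d M' (fhat d n \<rho> Ms X \<xi> M) x = (\<Sum>k\<in>Kset d M'. (if k \<in> Kset d M then coef d n \<rho> Ms X \<xi> M k else 0) * phi d k x)"
proof -
  have "l2inner d (fhat d n \<rho> Ms X \<xi> M) (phi d k) = (if k \<in> Kset d M then coef d n \<rho> Ms X \<xi> M k else 0)" if "k \<in> Kset d M'" for k
    unfolding fhat_def using that Kset_subset_Kall by (intro l2inner_trig) auto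
  then show ?thesis unfolding proj_def by simp
qed

text \<open>Coefficient form of the distance inside \<open>B2\<close>. It shows that the selection
  sees data and noise only through \<open>coef\<close>, on which both measurability and privacy
  rest.\<close>

definition comparison :: "nat \<Rightarrow> nat \<Rightarrow> real \<Rightarrow> nat set \<Rightarrow> (nat \<Rightarrow> (nat \<Rightarrow> real)) \<Rightarrow>
    (nat \<times> (nat \<Rightarrow> int) \<Rightarrow> complex) \<Rightarrow> nat \<Rightarrow> nat \<Rightarrow> real" where
  "comparison d n \<rho> Ms X \<xi> M M' = (\<Sum>k\<in>Kset d M'.
     (cmod ((if k \<in> Kset d M then coef d n \<rho> Ms X \<xi> M k else 0) - coef d n \<rho> Ms X \<xi> M' k))\<^sup>2)"

lemma l2sq_comparison:
  "l2sq d (\<lambda>x. proj d M' (fhat d n \<rho> Ms X \<xi> M) x - fhat d n \<rho> Ms X \<xi> M' x) = comparison d n \<rho> Ms X \<xi> M M'"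
proof -
  have "proj d M' (fhat d n \<rho> Ms X \<xi> M) x - fhat d n \<rho> Ms X \<xi> M' x =
     (\<Sum>k\<in>Kset d M'. ((if k \<in> Kset d M then coef d n \<rho> Ms X \<xi> M k else 0) - coef d n \<rho> Ms X \<xi> M' k) * phi d k x)" for x
    unfolding proj_fhat by (simp add: fhat_def sum_subtractf left_diff_distrib)
  then show ?thesis unfolding comparison_def by (simp only: l2sq_trig[OF finite_Kset Kset_subset_Kall])
qed

lemma B2_comparison:
  "B2 d n \<rho> Ms X \<xi> M = Max ((\<lambda>M'. comparison d n \<rho> Ms X \<xi> M M' - Lam1 d n \<rho> Ms M') ` Ms)"
  unfolding B2_def l2sq_comparison ..

lemma l2sq_fhat_diff:
  assumes "M \<le> M'"
  shows "l2sq d (\<lambda>x. fhat d n \<rho> Ms X \<xi> M x - fhat d n \<rho> Ms X \<xi> M' x) = comparison d n \<rho> Ms X \<xi> M M'"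
  unfolding l2sq_comparison[symmetric] proj_fhat fhat_expand[OF assms] ..

lemma Lam1_mono:
  assumes "\<rho> > 0" "M \<le> M'"
  shows "Lam1 d n \<rho> Ms M \<le> Lam1 d n \<rho> Ms M'"
  unfolding Lam1_def using assms
  by (intro add_mono divide_right_mono mult_left_mono power_mono) auto

lemma Lam1_nonneg: "\<rho> > 0 \<Longrightarrow> Lam1 d n \<rho> Ms M \<ge> 0"
  unfolding Lam1_def by (intro add_nonneg_nonneg divide_nonneg_nonneg) auto

lemma Lam1_le_Lam2: "\<rho> > 0 \<Longrightarrow> Lam1 d n \<rho> Ms M \<le> Lam2 d n \<rho> Ms M"
  unfolding Lam2_def by simp

lemma Mhat:
  assumes "finite Ms" "Ms \<noteq> {}"
  shows "Mhat d n \<rho> Ms X \<xi> \<in> Ms"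
    "M' \<in> Ms \<Longrightarrow> B2 d n \<rho> Ms X \<xi> (Mhat d n \<rho> Ms X \<xi>) + Lam2 d n \<rho> Ms (Mhat d n \<rho> Ms X \<xi>)
      \<le> B2 d n \<rho> Ms X \<xi> M' + Lam2 d n \<rho> Ms M'"
proof -
  let ?g = "\<lambda>M. B2 d n \<rho> Ms X \<xi> M + Lam2 d n \<rho> Ms M"
  obtain M where "M \<in> Ms" "\<forall>M'\<in>Ms. ?g M \<le> ?g M'"
    using arg_min_if_finite[OF assms, of ?g] by (meson not_le)
  then have "Mhat d n \<rho> Ms X \<xi> \<in> Ms \<and> (\<forall>M'\<in>Ms. ?g (Mhat d n \<rho> Ms X \<xi>) \<le> ?g M')"
    unfolding Mhat_def by (intro LeastI[where P="\<lambda>M. M \<in> Ms \<and> (\<forall>M'\<in>Ms. ?g M \<le> ?g M')"]) auto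
  then show "Mhat d n \<rho> Ms X \<xi> \<in> Ms" "M' \<in> Ms \<Longrightarrow> ?g (Mhat d n \<rho> Ms X \<xi>) \<le> ?g M'" by auto
qed

lemma comparison_le_B2:
  assumes "finite Ms" "M' \<in> Ms"
  shows "comparison d n \<rho> Ms X \<xi> M M' - Lam1 d n \<rho> Ms M' \<le> B2 d n \<rho> Ms X \<xi> M"
  unfolding B2_comparison using assms by (intro Max_ge) auto

lemma comparison_nonneg: "comparison d n \<rho> Ms X \<xi> M M' \<ge> 0"
  unfolding comparison_def by (intro sum_nonneg) simp

text \<open>\<open>B2\<close> is not truncated at \<open>0\<close>; the smallest element of the grid bounds it below by \<open>- Lam1 (Min Ms)\<close>,
  which is what prevents a large \<open>Mhat\<close>.\<close>

lemma B2_lower: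
  assumes "\<rho> > 0" "finite Ms" "Ms \<noteq> {}" "M' \<in> Ms"
  shows "- Lam1 d n \<rho> Ms M' \<le> B2 d n \<rho> Ms X \<xi> M"
proof -
  have "- Lam1 d n \<rho> Ms M' \<le> - Lam1 d n \<rho> Ms (Min Ms)" using assms by (simp add: Lam1_mono)
  also have "\<dots> \<le> comparison d n \<rho> Ms X \<xi> M (Min Ms) - Lam1 d n \<rho> Ms (Min Ms)" by (simp add: comparison_nonneg)
  also have "\<dots> \<le> B2 d n \<rho> Ms X \<xi> M" using assms by (intro comparison_le_B2) auto
  finally show ?thesis .
qed

text \<open>The distance is read off from \<open>B2\<close> at the smaller of the two indices, and
  minimality exchanges the selected index for \<open>m\<close>. The coefficient 3 absorbs a negative
  \<open>B2\<close> at \<open>m\<close>: by \<open>B2_lower\<close>, \<open>B2 + Lam2\<close> is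
  nonnegative there.\<close>

lemma l2sq_fhat_fsel_le:
  assumes \<rho>: "\<rho> > 0" and fin: "finite Ms" and ne: "Ms \<noteq> {}" and m: "m \<in> Ms"
  shows "l2sq d (\<lambda>x. fhat d n \<rho> Ms X \<xi> m x - fsel d n \<rho> Ms X \<xi> x)
    \<le> 2 * B2 d n \<rho> Ms X \<xi> m + 3 * Lam2 d n \<rho> Ms m"
proof -
  define h where "h = Mhat d n \<rho> Ms X \<xi>"
  note H = Mhat[OF fin ne, where d=d and n=n and \<rho>=\<rho> and X=X and \<xi>=\<xi>, folded h_def]
  have opt: "B2 d n \<rho> Ms X \<xi> h + Lam2 d n \<rho> Ms h \<le> B2 d n \<rho> Ms X \<xi> m + Lam2 d n \<rho> Ms m" by (rule H(2)[OF m])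
  have lo: "- Lam1 d n \<rho> Ms m \<le> B2 d n \<rho> Ms X \<xi> h" "- Lam1 d n \<rho> Ms m \<le> B2 d n \<rho> Ms X \<xi> m"
    by (rule B2_lower[OF \<rho> fin ne m])+
  have L: "Lam1 d n \<rho> Ms m \<le> Lam2 d n \<rho> Ms m" "Lam1 d n \<rho> Ms h \<le> Lam2 d n \<rho> Ms h" "0 \<le> Lam1 d n \<rho> Ms h" "0 \<le> Lam1 d n \<rho> Ms m"
    using \<rho> by (simp_all add: Lam1_le_Lam2 Lam1_nonneg)
  show ?thesis
  proof (cases "m \<le> h")
    \<comment> \<open>The penalty at \<open>h\<close> produced by the comparison is bounded through
      minimality, which needs the lower bound on \<open>B2\<close> at \<open>h\<close>.\<close>
    case True
    then have "l2sq d (\<lambda>x. fhat d n \<rho> Ms X \<xi> m x - fsel d n \<rho> Ms X \<xi> x) = comparison d n \<rho> Ms X \<xi> m h"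
      unfolding fsel_def h_def[symmetric] by (rule l2sq_fhat_diff)
    then show ?thesis using comparison_le_B2[OF fin H(1), of d n \<rho> X \<xi> m] opt lo L by linarith
  next
    case False
    then have "l2sq d (\<lambda>x. fhat d n \<rho> Ms X \<xi> m x - fsel d n \<rho> Ms X \<xi> x) = comparison d n \<rho> Ms X \<xi> h m"
      unfolding fsel_def h_def[symmetric] by (subst l2sq_minus_commute, intro l2sq_fhat_diff) simp
    then show ?thesis using comparison_le_B2[OF fin m, of d n \<rho> X \<xi> h] opt lo L by linarith
  qed
qed

lemma sigmaM_sq:
  assumes "n > 0" "\<rho> > 0" "finite Ms" "Ms \<noteq> {}"
  shows "(sigmaM d n \<rho> Ms M)\<^sup>2 = 4 * (2 * real M + 1) ^ d * real (card Ms) / ((real n)\<^sup>2 * \<rho>)"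
proof -
  have "(sqrt (\<rho> / real (card Ms)))\<^sup>2 = \<rho> / real (card Ms)" "(sqrt ((2 * real M + 1) ^ d))\<^sup>2 = (2 * real M + 1) ^ d"
    using assms by (auto intro!: real_sqrt_pow2)
  then show ?thesis unfolding sigmaM_def power_divide power_mult_distrib by simp
qed

lemma noise_component_measurable:
  assumes "i \<in> Sigma Ms (Kset d)"
  shows "(\<lambda>\<xi>. \<xi> i) \<in> borel_measurable (noise_law d Ms)"
proof -
  have "(\<lambda>\<xi>. \<xi> i) \<in> measurable (noise_law d Ms) cgauss"
    unfolding noise_law_def using assms by (rule measurable_component_singleton)
  also have "measurable (noise_law d Ms) cgauss = borel_measurable (noise_law d Ms)"
    by (rule measurable_cong_sets) simp_all
  finally show ?thesis .
qed

lemma ennreal_max_0 [simp]: "ennreal (max 0 x) = ennreal x"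
  by (simp add: max_def ennreal_neg)

section \<open>Oracle inequality: the loss against bias, variance and excess terms\<close>

locale selection = density_on_cube +
  fixes n :: nat and \<rho> :: real and Ms :: "nat set"
  assumes n: "n > 0" and \<rho>: "\<rho> > 0" and finMs: "finite Ms" and neMs: "Ms \<noteq> {}" and d: "d \<ge> 1"
begin

definition \<theta> where "\<theta> k = l2inner d (\<lambda>x. complex_of_real (f x)) (phi d k)"

text \<open>The number of characters in the box, by \<open>card_Kset\<close>, hence the dimension of
  their span.\<close>

definition D :: "nat \<Rightarrow> real" where "D M = (2 * real M + 1) ^ d"

definition \<sigma>2 :: "nat \<Rightarrow> real" where "\<sigma>2 M = (sigmaM d n \<rho> Ms M)\<^sup>2"

definition Z2 where "Z2 X M = (\<Sum>k\<in>Kset d M. (cmod (theta_emp d n X k - \<theta> k))\<^sup>2)"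

definition N2 :: "(nat \<times> (nat \<Rightarrow> int) \<Rightarrow> complex) \<Rightarrow> nat \<Rightarrow> real" where
  "N2 \<xi> M = (\<Sum>k\<in>Kset d M. (cmod (\<xi> (M, k)))\<^sup>2)"

definition bias :: "nat \<Rightarrow> real" where
  "bias M = l2sq d (\<lambda>x. complex_of_real (f x)) - (\<Sum>k\<in>Kset d M. (cmod (\<theta> k))\<^sup>2)"

text \<open>Summing over the grid rather than taking a maximum keeps expectations simple, and the
  one quantity serves every \<open>M\<close>, the random one included.\<close>

definition R1 where "R1 X = (\<Sum>M\<in>Ms. max 0 (Z2 X M - 24 * D M / real n))"

definition R2 where "R2 \<xi> = (\<Sum>M\<in>Ms. \<sigma>2 M * max 0 (N2 \<xi> M - 6 * D M))"

lemma \<sigma>2_eq: "\<sigma>2 M = 4 * D M * real (card Ms) / ((real n)\<^sup>2 * \<rho>)"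
  unfolding \<sigma>2_def D_def by (rule sigmaM_sq[OF n \<rho> finMs neMs])

lemma D_ge_1: "D M \<ge> 1" unfolding D_def by (simp add: one_le_power)

lemma \<sigma>2_nonneg: "\<sigma>2 M \<ge> 0" by (simp add: \<sigma>2_def)

text \<open>The penalty in the form that matches \<open>comparison_le\<close>: its factor 4, and
  inside it the levels above which \<open>R1\<close> and \<open>R2\<close> count.\<close>

lemma Lam1_eq: "Lam1 d n \<rho> Ms M = 4 * (24 * D M / real n + 6 * (D M * \<sigma>2 M))"
  unfolding Lam1_def \<sigma>2_eq D_def by (simp add: power_mult power2_eq_square mult.commute[of 2] mult_ac)

lemma Lam2_le: "Lam2 d n \<rho> Ms M \<le> 8 * (24 * D M / real n + 6 * (D M * \<sigma>2 M))"
proof -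
  have "Lam2 d n \<rho> Ms M = Lam1 d n \<rho> Ms M + 4 * (D M * \<sigma>2 M)"
    unfolding Lam2_def \<sigma>2_eq D_def by (simp add: power_mult power2_eq_square mult.commute[of 2] mult_ac)
  moreover have "0 \<le> 24 * D M / real n" "0 \<le> D M * \<sigma>2 M" using D_ge_1[of M] \<sigma>2_nonneg[of M] by auto
  ultimately show ?thesis unfolding Lam1_eq by argo
qed

lemma R1_nonneg: "R1 X \<ge> 0" unfolding R1_def by (intro sum_nonneg) simp

lemma R2_nonneg: "R2 \<xi> \<ge> 0" unfolding R2_def by (intro sum_nonneg mult_nonneg_nonneg \<sigma>2_nonneg) simp

lemma Z2_le: "M \<in> Ms \<Longrightarrow> Z2 X M \<le> 24 * D M / real n + R1 X"
proof -
  assume "M \<in> Ms"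
  then have "max 0 (Z2 X M - 24 * D M / real n) \<le> R1 X"
    unfolding R1_def using finMs by (intro member_le_sum) auto
  then show ?thesis by simp
qed

lemma \<sigma>2_N2_le: "M \<in> Ms \<Longrightarrow> \<sigma>2 M * N2 \<xi> M \<le> 6 * (D M * \<sigma>2 M) + R2 \<xi>"
proof -
  assume "M \<in> Ms"
  then have 1: "\<sigma>2 M * max 0 (N2 \<xi> M - 6 * D M) \<le> R2 \<xi>"
    unfolding R2_def using finMs by (intro member_le_sum) (auto intro!: mult_nonneg_nonneg \<sigma>2_nonneg)
  have "\<sigma>2 M * (N2 \<xi> M - 6 * D M) \<le> \<sigma>2 M * max 0 (N2 \<xi> M - 6 * D M)"
    by (intro mult_left_mono \<sigma>2_nonneg) simp
  then show ?thesis using 1 by (simp add: algebra_simps)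
qed

lemma bias_ge: "(\<Sum>k\<in>Kset d M' - Kset d M. (cmod (\<theta> k))\<^sup>2) \<le> bias M"
proof -
  have "(\<Sum>k\<in>Kset d M' - Kset d M. (cmod (\<theta> k))\<^sup>2) + (\<Sum>k\<in>Kset d M. (cmod (\<theta> k))\<^sup>2) = (\<Sum>k\<in>Kset d M' \<union> Kset d M. (cmod (\<theta> k))\<^sup>2)"
    by (subst sum.union_disjoint[symmetric]) (auto intro!: sum.cong)
  also have "\<dots> \<le> l2sq d (\<lambda>x. complex_of_real (f x))"
    unfolding \<theta>_def using Kset_subset_Kall by (intro bessel) auto
  finally show ?thesis by (simp add: bias_def)
qed

text \<open>On the common box the empirical coefficients cancel, both estimators being built from
  the same data, and only two noises remain. Elsewhere one noise, the empirical error and the true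
  coefficient remain; splitting the square twice gives the factor 4.\<close>

lemma comparison_le:
  assumes m: "m \<in> Ms" and M: "M \<in> Ms"
  shows "comparison d n \<rho> Ms X \<xi> m M \<le> 4 * (\<sigma>2 m * N2 \<xi> m + \<sigma>2 M * N2 \<xi> M + Z2 X M + bias m)"
proof -
  let ?s = "\<lambda>M k. complex_of_real (sigmaM d n \<rho> Ms M) * \<xi> (M, k)"
  let ?e = "\<lambda>k. theta_emp d n X k - \<theta> k"
  have sq: "(cmod (?s M k))\<^sup>2 = \<sigma>2 M * (cmod (\<xi> (M, k)))\<^sup>2" for M k
    by (simp add: norm_mult power_mult_distrib \<sigma>2_def)
  have "comparison d n \<rho> Ms X \<xi> m M \<le> (\<Sum>k\<in>Kset d M. 4 * ((if k \<in> Kset d m then (cmod (?s m k))\<^sup>2 else 0) +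
      (cmod (?s M k))\<^sup>2 + (cmod (?e k))\<^sup>2 + (if k \<in> Kset d m then 0 else (cmod (\<theta> k))\<^sup>2)))"
    unfolding comparison_def
  proof (intro sum_mono)
    fix k assume "k \<in> Kset d M"
    show "(cmod ((if k \<in> Kset d m then coef d n \<rho> Ms X \<xi> m k else 0) - coef d n \<rho> Ms X \<xi> M k))\<^sup>2
      \<le> 4 * ((if k \<in> Kset d m then (cmod (?s m k))\<^sup>2 else 0) +
      (cmod (?s M k))\<^sup>2 + (cmod (?e k))\<^sup>2 + (if k \<in> Kset d m then 0 else (cmod (\<theta> k))\<^sup>2))"
    proof (cases "k \<in> Kset d m")
      case True
      have "coef d n \<rho> Ms X \<xi> m k - coef d n \<rho> Ms X \<xi> M k = ?s m k - ?s M k" by (simp add: coef_def)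
      moreover have "(cmod (?s m k - ?s M k))\<^sup>2 \<le> 2 * (cmod (?s m k))\<^sup>2 + 2 * (cmod (?s M k))\<^sup>2" by (rule cmod_diff_sq_le)
      moreover have "x \<le> 4 * (a + b + c + 0)" if "x \<le> 2 * a + 2 * b" "0 \<le> a" "0 \<le> b" "0 \<le> c" for x a b c :: real
        using that by simp
      ultimately show ?thesis using True by (simp only: if_True zero_le_power2)
    next
      case False
      have c: "coef d n \<rho> Ms X \<xi> M k = ?s M k + (?e k + \<theta> k)" by (simp add: coef_def)
      have 1: "(cmod (?s M k + (?e k + \<theta> k)))\<^sup>2 \<le> 2 * (cmod (?s M k))\<^sup>2 + 2 * (cmod (?e k + \<theta> k))\<^sup>2"
        by (rule cmod_add_sq_le)
      have 2: "(cmod (?e k + \<theta> k))\<^sup>2 \<le> 2 * (cmod (?e k))\<^sup>2 + 2 * (cmod (\<theta> k))\<^sup>2" by (rule cmod_add_sq_le)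
      have "0 \<le> (cmod (?s M k))\<^sup>2" by simp
      with 1 2 have "(cmod (?s M k + (?e k + \<theta> k)))\<^sup>2 \<le> 4 * ((cmod (?s M k))\<^sup>2 + (cmod (?e k))\<^sup>2 + (cmod (\<theta> k))\<^sup>2)" by argo
      then show ?thesis using False by (simp only: c if_False diff_0 norm_minus_cancel add_0)
    qed
  qed
  also have "\<dots> = 4 * ((\<Sum>k\<in>Kset d M. if k \<in> Kset d m then (cmod (?s m k))\<^sup>2 else 0) + \<sigma>2 M * N2 \<xi> M + Z2 X M
      + (\<Sum>k\<in>Kset d M. if k \<in> Kset d m then 0 else (cmod (\<theta> k))\<^sup>2))"
    by (simp only: sum_distrib_left[symmetric] sum.distrib sq N2_def Z2_def)
  also have "(\<Sum>k\<in>Kset d M. if k \<in> Kset d m then 0 else (cmod (\<theta> k))\<^sup>2) = (\<Sum>k\<in>Kset d M - Kset d m. (cmod (\<theta> k))\<^sup>2)"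
    by (intro sum.mono_neutral_cong_right) auto
  also have "(\<Sum>k\<in>Kset d M. if k \<in> Kset d m then (cmod (?s m k))\<^sup>2 else 0) = (\<Sum>k\<in>Kset d M \<inter> Kset d m. (cmod (?s m k))\<^sup>2)"
    by (simp add: sum.inter_restrict)
  finally have "comparison d n \<rho> Ms X \<xi> m M \<le> 4 * ((\<Sum>k\<in>Kset d M \<inter> Kset d m. (cmod (?s m k))\<^sup>2) + \<sigma>2 M * N2 \<xi> M + Z2 X M
      + (\<Sum>k\<in>Kset d M - Kset d m. (cmod (\<theta> k))\<^sup>2))" .
  moreover have "(\<Sum>k\<in>Kset d M \<inter> Kset d m. (cmod (?s m k))\<^sup>2) \<le> \<sigma>2 m * N2 \<xi> m"
    unfolding N2_def sum_distrib_left sq[symmetric] by (intro sum_mono2) auto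
  ultimately show ?thesis using bias_ge[of M m] by (smt (verit))
qed

text \<open>\<open>Lam1\<close> at \<open>M\<close> absorbs the whole part of
  \<open>comparison_le\<close> that grows with \<open>M\<close>, so the maximum over the grid
  retains only terms at \<open>m\<close> and excesses. \<open>R2\<close> enters twice, for the noise
  at \<open>m\<close> and at \<open>M\<close>.\<close>

lemma B2_le:
  assumes m: "m \<in> Ms"
  shows "B2 d n \<rho> Ms X \<xi> m \<le> 4 * (24 * D m / real n + 6 * (D m * \<sigma>2 m)) + 4 * bias m + 4 * R1 X + 8 * R2 \<xi>"
proof -
  have "comparison d n \<rho> Ms X \<xi> m M - Lam1 d n \<rho> Ms M \<le> 4 * (24 * D m / real n + 6 * (D m * \<sigma>2 m)) + 4 * bias m + 4 * R1 X + 8 * R2 \<xi>" if M: "M \<in> Ms" for M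
  proof -
    have "0 \<le> 24 * D m / real n" using D_ge_1[of m] by auto
    then show ?thesis
      using comparison_le[OF m M, of X \<xi>] Z2_le[OF M, of X] \<sigma>2_N2_le[OF M, of \<xi>] \<sigma>2_N2_le[OF m, of \<xi>]
      unfolding Lam1_eq by argo
  qed
  then show ?thesis unfolding B2_comparison using finMs neMs by (intro Max.boundedI) auto
qed

lemma l2sq_f_fhat_le:
  assumes m: "m \<in> Ms"
  shows "l2sq d (\<lambda>x. complex_of_real (f x) - fhat d n \<rho> Ms X \<xi> m x) \<le> bias m + 2 * (24 * D m / real n + 6 * (D m * \<sigma>2 m)) + 2 * R1 X + 2 * R2 \<xi>"
proof -
  let ?s = "\<lambda>k. complex_of_real (sigmaM d n \<rho> Ms m) * \<xi> (m, k)"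
  have "l2sq d (\<lambda>x. complex_of_real (f x) - fhat d n \<rho> Ms X \<xi> m x) = bias m + (\<Sum>k\<in>Kset d m. (cmod (coef d n \<rho> Ms X \<xi> m k - \<theta> k))\<^sup>2)"
    unfolding fhat_def bias_def \<theta>_def by (intro l2sq_diff_trig finite_Kset Kset_subset_Kall) simp
  also have "(\<Sum>k\<in>Kset d m. (cmod (coef d n \<rho> Ms X \<xi> m k - \<theta> k))\<^sup>2) \<le> (\<Sum>k\<in>Kset d m. 2 * (cmod (theta_emp d n X k - \<theta> k))\<^sup>2 + 2 * (\<sigma>2 m * (cmod (\<xi> (m, k)))\<^sup>2))"
  proof (intro sum_mono)
    fix k
    have c: "coef d n \<rho> Ms X \<xi> m k - \<theta> k = (theta_emp d n X k - \<theta> k) + ?s k" by (simp add: coef_def)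
    show "(cmod (coef d n \<rho> Ms X \<xi> m k - \<theta> k))\<^sup>2 \<le> 2 * (cmod (theta_emp d n X k - \<theta> k))\<^sup>2 + 2 * (\<sigma>2 m * (cmod (\<xi> (m, k)))\<^sup>2)"
      using cmod_add_sq_le[of "theta_emp d n X k - \<theta> k" "?s k"] unfolding c by (simp add: norm_mult power_mult_distrib \<sigma>2_def)
  qed
  also have "\<dots> = 2 * Z2 X m + 2 * (\<sigma>2 m * N2 \<xi> m)"
    by (simp add: sum.distrib Z2_def N2_def sum_distrib_left)
  finally have "l2sq d (\<lambda>x. complex_of_real (f x) - fhat d n \<rho> Ms X \<xi> m x) \<le> bias m + (2 * Z2 X m + 2 * (\<sigma>2 m * N2 \<xi> m))"
    by simp
  then show ?thesis using Z2_le[OF m, of X] \<sigma>2_N2_le[OF m, of \<xi>] by argo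
qed

text \<open>68 is the coefficient of the variance term: 2 times 2 from
  \<open>l2sq_f_fhat_le\<close>, and 2 times (2 times 4 + 3 times 8) from
  \<open>l2sq_fhat_fsel_le\<close> with \<open>B2_le\<close> and \<open>Lam2_le\<close>. The other
  terms have smaller coefficients.\<close>

lemma l2sq_f_fsel_le:
  assumes m: "m \<in> Ms"
  shows "l2sq d (\<lambda>x. complex_of_real (f x) - fsel d n \<rho> Ms X \<xi> x)
    \<le> 68 * (bias m + (24 * D m / real n + 6 * (D m * \<sigma>2 m)) + R1 X + R2 \<xi>)"
proof -
  let ?v = "24 * D m / real n + 6 * (D m * \<sigma>2 m)"
  have bf: "cube_bounded d (fhat d n \<rho> Ms X \<xi> M)" for M unfolding fhat_def[abs_def] by simp
  have "l2sq d (\<lambda>x. complex_of_real (f x) - fsel d n \<rho> Ms X \<xi> x) =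
      l2sq d (\<lambda>x. (complex_of_real (f x) - fhat d n \<rho> Ms X \<xi> m x) + (fhat d n \<rho> Ms X \<xi> m x - fsel d n \<rho> Ms X \<xi> x))"
    by simp
  also have "\<dots> \<le> 2 * l2sq d (\<lambda>x. complex_of_real (f x) - fhat d n \<rho> Ms X \<xi> m x) + 2 * l2sq d (\<lambda>x. fhat d n \<rho> Ms X \<xi> m x - fsel d n \<rho> Ms X \<xi> x)"
    unfolding fsel_def by (intro l2sq_add_le bounded_meas_diff bounded_of_real_f bf)
  finally have main: "l2sq d (\<lambda>x. complex_of_real (f x) - fsel d n \<rho> Ms X \<xi> x) \<le>
     2 * l2sq d (\<lambda>x. complex_of_real (f x) - fhat d n \<rho> Ms X \<xi> m x) + 2 * l2sq d (\<lambda>x. fhat d n \<rho> Ms X \<xi> m x - fsel d n \<rho> Ms X \<xi> x)" .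
  have "0 \<le> bias m" using bias_ge[of m m] by simp
  then show ?thesis
    using main l2sq_fhat_fsel_le[OF \<rho> finMs neMs m, of d n X \<xi>] l2sq_f_fhat_le[OF m, of X \<xi>] B2_le[OF m, of X \<xi>]
      Lam2_le[of m] R1_nonneg[of X] R2_nonneg[of \<xi>] by argo
qed

section \<open>Expected excesses and the resulting risk bound\<close>

lemma sum_card_decay_le: "(\<Sum>M\<in>Ms. D M * (1 / 2) ^ card (Kset d M)) \<le> 2"
proof -
  define c where "c M = card (Kset d M)" for M
  have c: "real (c M) = D M" for M unfolding c_def D_def by (rule card_Kset)
  \<comment> \<open>Since \<open>d \<ge> 1\<close>, different grid elements have different
    dimensions, so the series of m / 2^m, with total 2, dominates whatever the size of the
    grid.\<close>
  have inj: "inj_on c Ms"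
  proof (rule inj_onI)
    fix x y assume "c x = c y"
    then have "(2 * real x + 1) ^ d = (2 * real y + 1) ^ d" using c unfolding D_def by metis
    then show "x = y" using d by (subst (asm) power_eq_iff_eq_base) auto
  qed
  have s: "(\<Sum>m\<le>K. real m * (1 / 2) ^ m) = 2 - (real K + 2) * (1 / 2) ^ K" for K
    by (induction K) (simp_all add: field_simps)
  have "(\<Sum>M\<in>Ms. D M * (1 / 2) ^ card (Kset d M)) = (\<Sum>M\<in>Ms. real (c M) * (1 / 2) ^ c M)"
    by (simp add: c) (simp add: c_def)
  also have "\<dots> = (\<Sum>m\<in>c ` Ms. real m * (1 / 2) ^ m)" by (subst sum.reindex[OF inj]) simp
  also have "\<dots> \<le> (\<Sum>m\<le>Max (c ` Ms). real m * (1 / 2) ^ m)"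
    using finMs by (intro sum_mono2) auto
  also have "\<dots> \<le> 2" unfolding s by simp
  finally show ?thesis .
qed

text \<open>The bound is the same at every grid element, so the grid size survives as a factor;
  being logarithmic in \<open>n\<close>, it is absorbed in \<open>selection_risk\<close>.\<close>

lemma nn_integral_R1_le:
  "(\<integral>\<^sup>+X. ennreal (R1 X) \<partial>sample_law d n f) \<le> ennreal (real (card Ms) * supnorm d f / (40 * real n))"
proof -
  have [measurable]: "(\<lambda>X. Z2 X M) \<in> borel_measurable (sample_law d n f)" for M unfolding Z2_def by measurable
  interpret bounded_features "obs_law d f" "Kset d 0" "\<lambda>k x. cnj (phi d k x)" "supnorm d f" by (rule bounded_features)
  have "ennreal (R1 X) = (\<Sum>M\<in>Ms. ennreal (max 0 (Z2 X M - 24 * D M / real n)))" for X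
    unfolding R1_def by (rule sum_ennreal[symmetric]) simp
  then have "(\<integral>\<^sup>+X. ennreal (R1 X) \<partial>sample_law d n f) = (\<integral>\<^sup>+X. (\<Sum>M\<in>Ms. ennreal (Z2 X M - 24 * D M / real n)) \<partial>sample_law d n f)"
    by simp
  also have "\<dots> = (\<Sum>M\<in>Ms. \<integral>\<^sup>+X. ennreal (Z2 X M - 24 * D M / real n) \<partial>sample_law d n f)"
    by (intro nn_integral_sum) measurable
  also have "\<dots> \<le> (\<Sum>M\<in>Ms. ennreal (supnorm d f / (40 * real n)))"
    unfolding Z2_def D_def \<theta>_def by (intro sum_mono nn_integral_sample_excess_le n)
  also have "\<dots> = ennreal (\<Sum>M\<in>Ms. supnorm d f / (40 * real n))"
    using B0 by (intro sum_ennreal) auto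
  finally show ?thesis by simp
qed

lemma nn_integral_R2_le:
  "(\<integral>\<^sup>+\<xi>. ennreal (R2 \<xi>) \<partial>noise_law d Ms) \<le> ennreal (32 * real (card Ms) / ((real n)\<^sup>2 * \<rho>))"
proof -
  have comp: "(\<lambda>\<xi>. \<xi> (M, k)) \<in> borel_measurable (noise_law d Ms)" if "M \<in> Ms" "k \<in> Kset d M" for M k
    using that by (intro noise_component_measurable) auto
  have N2m: "(\<lambda>\<xi>. N2 \<xi> M) \<in> borel_measurable (noise_law d Ms)" if "M \<in> Ms" for M
    unfolding N2_def using comp[OF that] by (intro borel_measurable_sum borel_measurable_power borel_measurable_norm) auto
  have "ennreal (R2 \<xi>) = (\<Sum>M\<in>Ms. ennreal (\<sigma>2 M * max 0 (N2 \<xi> M - 6 * D M)))" for \<xi>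
    unfolding R2_def by (rule sum_ennreal[symmetric]) (simp add: \<sigma>2_nonneg)
  then have "(\<integral>\<^sup>+\<xi>. ennreal (R2 \<xi>) \<partial>noise_law d Ms) = (\<integral>\<^sup>+\<xi>. (\<Sum>M\<in>Ms. ennreal (\<sigma>2 M) * ennreal (N2 \<xi> M - 6 * D M)) \<partial>noise_law d Ms)"
    by (simp add: ennreal_mult' \<sigma>2_nonneg)
  also have "\<dots> = (\<Sum>M\<in>Ms. \<integral>\<^sup>+\<xi>. ennreal (\<sigma>2 M) * ennreal (N2 \<xi> M - 6 * D M) \<partial>noise_law d Ms)"
    using N2m by (intro nn_integral_sum borel_measurable_times_ennreal measurable_compose[OF _ measurable_ennreal] borel_measurable_diff) auto
  also have "\<dots> \<le> (\<Sum>M\<in>Ms. ennreal (\<sigma>2 M) * ennreal (4 * (1 / 2) ^ card (Kset d M)))"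
  proof (intro sum_mono)
    fix M assume M: "M \<in> Ms"
    let ?I = "Sigma Ms (Kset d)"
    have N2': "N2 \<xi> M = (\<Sum>i\<in>Pair M ` Kset d M. (cmod (\<xi> i))\<^sup>2)" for \<xi>
      unfolding N2_def by (subst sum.reindex) (auto simp: inj_on_def)
    have cJ: "card (Pair M ` Kset d M) = card (Kset d M)" by (intro card_image) (auto simp: inj_on_def)
    have DJ: "D M = real (card (Kset d M))" by (simp add: card_Kset D_def)
    have "(\<integral>\<^sup>+\<xi>. ennreal (\<sigma>2 M) * ennreal (N2 \<xi> M - 6 * D M) \<partial>noise_law d Ms) = ennreal (\<sigma>2 M) * (\<integral>\<^sup>+\<xi>. ennreal (N2 \<xi> M - 6 * D M) \<partial>noise_law d Ms)"
      using N2m[OF M] by (intro nn_integral_cmult measurable_compose[OF _ measurable_ennreal] borel_measurable_diff) auto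
    also have "(\<integral>\<^sup>+\<xi>. ennreal (N2 \<xi> M - 6 * D M) \<partial>noise_law d Ms) \<le> ennreal (4 * (1 / 2) ^ card (Kset d M))"
      using nn_integral_noise_excess_le[of ?I "Pair M ` Kset d M"] M finMs
      unfolding cJ DJ N2' noise_law_def by auto
    finally show "(\<integral>\<^sup>+\<xi>. ennreal (\<sigma>2 M) * ennreal (N2 \<xi> M - 6 * D M) \<partial>noise_law d Ms) \<le> ennreal (\<sigma>2 M) * ennreal (4 * (1 / 2) ^ card (Kset d M))"
      by (simp add: mult_left_mono)
  qed
  also have "\<dots> = ennreal (\<Sum>M\<in>Ms. \<sigma>2 M * (4 * (1 / 2) ^ card (Kset d M)))"
    by (subst sum_ennreal[symmetric]) (auto simp: \<sigma>2_nonneg ennreal_mult' intro!: sum.cong)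
  also have "(\<Sum>M\<in>Ms. \<sigma>2 M * (4 * (1 / 2) ^ card (Kset d M))) = 16 * real (card Ms) / ((real n)\<^sup>2 * \<rho>) * (\<Sum>M\<in>Ms. D M * (1 / 2) ^ card (Kset d M))"
    unfolding \<sigma>2_eq sum_distrib_left by (intro sum.cong) (auto simp: field_simps)
  also have "ennreal \<dots> \<le> ennreal (16 * real (card Ms) / ((real n)\<^sup>2 * \<rho>) * 2)"
    using \<rho> by (intro ennreal_leI mult_left_mono sum_card_decay_le) auto
  finally show ?thesis by simp
qed

lemma prob_space_noise_law: "prob_space (noise_law d Ms)"
  unfolding noise_law_def by (rule prob_space_PiM_cgauss)

lemma R1_measurable [measurable]: "R1 \<in> borel_measurable (sample_law d n f)"
  unfolding R1_def[abs_def] Z2_def by measurable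

lemma risk_le:
  assumes m: "m \<in> Ms"
  shows "risk d n \<rho> Ms f \<le> ennreal (68 * (bias m + (24 * D m / real n + 6 * (D m * \<sigma>2 m))
     + real (card Ms) * supnorm d f / (40 * real n) + 32 * real (card Ms) / ((real n)\<^sup>2 * \<rho>)))"
proof -
  interpret S: prob_space "sample_law d n f" by (rule prob_space_sample_law)
  interpret N: prob_space "noise_law d Ms" by (rule prob_space_noise_law)
  interpret SN: pair_prob_space "sample_law d n f" "noise_law d Ms" ..
  interpret bounded_features "obs_law d f" "Kset d 0" "\<lambda>k x. cnj (phi d k x)" "supnorm d f" by (rule bounded_features)
  have comp: "(\<lambda>\<xi>. \<xi> (M, k)) \<in> borel_measurable (noise_law d Ms)" if "M \<in> Ms" "k \<in> Kset d M" for M k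
    using that by (intro noise_component_measurable) auto
  have R2m[measurable]: "R2 \<in> borel_measurable (noise_law d Ms)"
    unfolding R2_def[abs_def] N2_def using comp
    by (intro borel_measurable_sum borel_measurable_times borel_measurable_max borel_measurable_diff borel_measurable_power borel_measurable_norm) auto
  let ?c = "bias m + (24 * D m / real n + 6 * (D m * \<sigma>2 m))"
  have "0 \<le> bias m" using bias_ge[of m m] by simp
  then have c0: "0 \<le> ?c" using D_ge_1[of m] \<sigma>2_nonneg[of m] by auto
  let ?SN = "sample_law d n f \<Otimes>\<^sub>M noise_law d Ms"
  \<comment> \<open>\<open>nn_integral_mono\<close> compares pointwise and asks for no
    measurability, so the loss at the random index is replaced before measurability matters;
    afterwards only \<open>R1\<close> and \<open>R2\<close> have to be measurable.\<close>
  have "risk d n \<rho> Ms f \<le> (\<integral>\<^sup>+p. ennreal (68 * ?c) + (ennreal 68 * ennreal (R1 (fst p)) + ennreal 68 * ennreal (R2 (snd p))) \<partial>?SN)"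
    unfolding risk_def
  proof (intro nn_integral_mono)
    fix p :: "(nat \<Rightarrow> nat \<Rightarrow> real) \<times> (nat \<times> (nat \<Rightarrow> int) \<Rightarrow> complex)"
    have "ennreal (l2sq d (\<lambda>x. complex_of_real (f x) - fsel d n \<rho> Ms (fst p) (snd p) x)) \<le> ennreal (68 * (?c + R1 (fst p) + R2 (snd p)))"
      by (intro ennreal_leI l2sq_f_fsel_le m)
    also have "68 * (?c + R1 (fst p) + R2 (snd p)) = 68 * ?c + (68 * R1 (fst p) + 68 * R2 (snd p))" by simp
    also have "ennreal \<dots> = ennreal (68 * ?c) + (ennreal 68 * ennreal (R1 (fst p)) + ennreal 68 * ennreal (R2 (snd p)))"
      using c0 R1_nonneg[of "fst p"] R2_nonneg[of "snd p"] by (subst ennreal_plus; simp add: ennreal_plus ennreal_mult')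
    finally show "ennreal (l2sq d (\<lambda>x. complex_of_real (f x) - fsel d n \<rho> Ms (fst p) (snd p) x))
      \<le> ennreal (68 * ?c) + (ennreal 68 * ennreal (R1 (fst p)) + ennreal 68 * ennreal (R2 (snd p)))" .
  qed
  also have "\<dots> = ennreal (68 * ?c) + (ennreal 68 * (\<integral>\<^sup>+p. ennreal (R1 (fst p)) \<partial>?SN) + ennreal 68 * (\<integral>\<^sup>+p. ennreal (R2 (snd p)) \<partial>?SN))"
    by (simp add: nn_integral_add nn_integral_cmult SN.emeasure_space_1)
  also have "(\<integral>\<^sup>+p. ennreal (R1 (fst p)) \<partial>?SN) = (\<integral>\<^sup>+X. ennreal (R1 X) \<partial>sample_law d n f)"
    by (subst N.nn_integral_fst[symmetric]) (simp_all add: N.emeasure_space_1)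
  also have "(\<integral>\<^sup>+p. ennreal (R2 (snd p)) \<partial>?SN) = (\<integral>\<^sup>+\<xi>. ennreal (R2 \<xi>) \<partial>noise_law d Ms)"
    by (subst N.nn_integral_fst[symmetric]) (simp_all add: S.emeasure_space_1)
  also have "ennreal (68 * ?c) + (ennreal 68 * (\<integral>\<^sup>+X. ennreal (R1 X) \<partial>sample_law d n f) + ennreal 68 * (\<integral>\<^sup>+\<xi>. ennreal (R2 \<xi>) \<partial>noise_law d Ms))
    \<le> ennreal (68 * ?c) + (ennreal 68 * ennreal (real (card Ms) * supnorm d f / (40 * real n)) + ennreal 68 * ennreal (32 * real (card Ms) / ((real n)\<^sup>2 * \<rho>)))"
    by (intro add_mono mult_left_mono nn_integral_R1_le nn_integral_R2_le) auto
  also have "\<dots> = ennreal (68 * ?c + (68 * (real (card Ms) * supnorm d f / (40 * real n)) + 68 * (32 * real (card Ms) / ((real n)\<^sup>2 * \<rho>))))"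
    using c0 B0 \<rho> by (subst ennreal_plus; simp add: ennreal_plus ennreal_mult' del: times_divide_eq_right)
  also have "68 * ?c + (68 * (real (card Ms) * supnorm d f / (40 * real n)) + 68 * (32 * real (card Ms) / ((real n)\<^sup>2 * \<rho>)))
    = 68 * (?c + real (card Ms) * supnorm d f / (40 * real n) + 32 * real (card Ms) / ((real n)\<^sup>2 * \<rho>))"
    by (simp only: distrib_left add.assoc)
  finally show ?thesis .
qed

end

section \<open>Privacy\<close>

lemma comparison_cong:
  assumes "\<And>k. k \<in> Kset d M \<Longrightarrow> coef d n \<rho> Ms X \<xi> M k = coef d n \<rho> Ms X' \<xi>' M k"
    and "\<And>k. k \<in> Kset d M' \<Longrightarrow> coef d n \<rho> Ms X \<xi> M' k = coef d n \<rho> Ms X' \<xi>' M' k"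
  shows "comparison d n \<rho> Ms X \<xi> M M' = comparison d n \<rho> Ms X' \<xi>' M M'"
  unfolding comparison_def using assms by (intro sum.cong refl) simp

lemma Mhat_cong:
  assumes "\<And>M k. M \<in> Ms \<Longrightarrow> k \<in> Kset d M \<Longrightarrow> coef d n \<rho> Ms X \<xi> M k = coef d n \<rho> Ms X' \<xi>' M k"
  shows "Mhat d n \<rho> Ms X \<xi> = Mhat d n \<rho> Ms X' \<xi>'"
proof -
  have "B2 d n \<rho> Ms X \<xi> M = B2 d n \<rho> Ms X' \<xi>' M" if "M \<in> Ms" for M
    unfolding B2_comparison using that assms comparison_cong[of d M n \<rho> Ms X \<xi> X' \<xi>']
    by (intro arg_cong[where f=Max] image_cong refl) simp
  then show ?thesis unfolding Mhat_def by (intro arg_cong[where f=Least] ext) auto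
qed

text \<open>The output depends on data and noise only through the noisy coefficients, so a change of
  the data can be traded for a translation of the noise.\<close>

lemma fsel_coefs_cong:
  assumes "finite Ms" "Ms \<noteq> {}"
    and "\<And>M k. M \<in> Ms \<Longrightarrow> k \<in> Kset d M \<Longrightarrow> coef d n \<rho> Ms X \<xi> M k = coef d n \<rho> Ms X' \<xi>' M k"
  shows "fsel_coefs d n \<rho> Ms X \<xi> = fsel_coefs d n \<rho> Ms X' \<xi>'"
proof -
  have M: "Mhat d n \<rho> Ms X \<xi> = Mhat d n \<rho> Ms X' \<xi>'" using assms(3) by (rule Mhat_cong)
  show ?thesis unfolding fsel_coefs_def M
    using assms(3)[OF Mhat(1)[OF assms(1,2)]] by (intro restrict_ext) simp
qed

lemma coef_measurable:
  assumes "M \<in> Ms" "k \<in> Kset d M"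
  shows "(\<lambda>\<xi>. coef d n \<rho> Ms X \<xi> M k) \<in> borel_measurable (noise_law d Ms)"
  unfolding coef_def using assms
  by (intro borel_measurable_add borel_measurable_times noise_component_measurable) auto

lemma B2_measurable:
  assumes "finite Ms" "M \<in> Ms"
  shows "(\<lambda>\<xi>. B2 d n \<rho> Ms X \<xi> M) \<in> borel_measurable (noise_law d Ms)"
proof -
  have "(\<lambda>\<xi>. comparison d n \<rho> Ms X \<xi> M M') \<in> borel_measurable (noise_law d Ms)" if M': "M' \<in> Ms" for M'
    unfolding comparison_def
  proof (rule borel_measurable_sum)
    fix k assume "k \<in> Kset d M'"
    then have [measurable]: "(\<lambda>\<xi>. coef d n \<rho> Ms X \<xi> M' k) \<in> borel_measurable (noise_law d Ms)" by (intro coef_measurable M')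
    have [measurable]: "(\<lambda>\<xi>. if k \<in> Kset d M then coef d n \<rho> Ms X \<xi> M k else 0) \<in> borel_measurable (noise_law d Ms)"
      using coef_measurable[OF assms(2)] by (cases "k \<in> Kset d M") auto
    show "(\<lambda>\<xi>. (cmod ((if k \<in> Kset d M then coef d n \<rho> Ms X \<xi> M k else 0) - coef d n \<rho> Ms X \<xi> M' k))\<^sup>2) \<in> borel_measurable (noise_law d Ms)"
      by measurable
  qed
  then show ?thesis unfolding B2_comparison using assms
    by (intro borel_measurable_Max borel_measurable_diff) auto
qed

lemma Mhat_measurable:
  assumes "finite Ms" "Ms \<noteq> {}"
  shows "(\<lambda>\<xi>. Mhat d n \<rho> Ms X \<xi>) \<in> measurable (noise_law d Ms) (count_space UNIV)"
  unfolding Mhat_def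
proof (rule measurable_Least)
  fix M
  show "Measurable.pred (noise_law d Ms) (\<lambda>\<xi>. M \<in> Ms \<and> (\<forall>M'\<in>Ms. B2 d n \<rho> Ms X \<xi> M + Lam2 d n \<rho> Ms M \<le> B2 d n \<rho> Ms X \<xi> M' + Lam2 d n \<rho> Ms M'))"
  proof (cases "M \<in> Ms")
    case True
    have "Measurable.pred (noise_law d Ms) (\<lambda>\<xi>. B2 d n \<rho> Ms X \<xi> M + Lam2 d n \<rho> Ms M \<le> B2 d n \<rho> Ms X \<xi> M' + Lam2 d n \<rho> Ms M')" if "M' \<in> Ms" for M'
      unfolding pred_def
      by (intro borel_measurable_le borel_measurable_add borel_measurable_const B2_measurable assms(1) True that)
    then show ?thesis using True assms(1) by (simp add: pred_intros_finite)
  qed simp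
qed

lemma fsel_coefs_measurable:
  assumes "finite Ms" "Ms \<noteq> {}"
  shows "fsel_coefs d n \<rho> Ms X \<in> measurable (noise_law d Ms) (PiM (Kall d) (\<lambda>_. borel))"
  unfolding fsel_coefs_def[abs_def]
proof (rule measurable_restrict)
  fix k assume "k \<in> Kall d"
  \<comment> \<open>\<open>Mhat\<close> takes countably many values, so measurability for each fixed
    \<open>M\<close> suffices. The guard \<open>M \<in> Ms\<close> excludes indices without a noise
    coordinate, which \<open>Mhat\<close> never returns.\<close>
  have "(\<lambda>\<xi>. (\<lambda>M \<xi>. if M \<in> Ms \<and> k \<in> Kset d M then coef d n \<rho> Ms X \<xi> M k else 0) (Mhat d n \<rho> Ms X \<xi>) \<xi>) \<in> borel_measurable (noise_law d Ms)"
  proof (rule measurable_compose_countable[OF _ Mhat_measurable[OF assms]])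
    fix M show "(\<lambda>\<xi>. if M \<in> Ms \<and> k \<in> Kset d M then coef d n \<rho> Ms X \<xi> M k else 0) \<in> borel_measurable (noise_law d Ms)"
      using coef_measurable[of M Ms k d n \<rho> X] by (cases "M \<in> Ms \<and> k \<in> Kset d M") auto
  qed
  then show "(\<lambda>\<xi>. if k \<in> Kset d (Mhat d n \<rho> Ms X \<xi>) then coef d n \<rho> Ms X \<xi> (Mhat d n \<rho> Ms X \<xi>) k else 0) \<in> borel_measurable (noise_law d Ms)"
    using Mhat(1)[OF assms] by simp
qed

lemma theta_emp_sensitivity:
  assumes "\<forall>j<n. j \<noteq> j0 \<longrightarrow> X j = X' j"
  shows "cmod (theta_emp d n X k - theta_emp d n X' k) \<le> 2 / real n"
proof -
  have "cmod (\<Sum>j<n. cnj (phi d k (X j)) - cnj (phi d k (X' j))) \<le> (\<Sum>j<n. if j = j0 then 2 else 0)"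
  proof (rule order_trans[OF norm_sum sum_mono])
    fix j assume "j \<in> {..<n}"
    then show "cmod (cnj (phi d k (X j)) - cnj (phi d k (X' j))) \<le> (if j = j0 then 2 else 0)"
      using assms norm_triangle_ineq4[of "cnj (phi d k (X j))" "cnj (phi d k (X' j))"] by (cases "j = j0") auto
  qed
  \<comment> \<open>An inequality, since \<open>j0\<close> may lie outside \<open>{..<n}\<close>,
    and then the two data sets agree on all entries that count.\<close>
  also have "\<dots> \<le> 2" by simp
  finally have "cmod ((\<Sum>j<n. cnj (phi d k (X j)) - cnj (phi d k (X' j))) / of_nat n) \<le> 2 / real n"
    by (simp add: norm_divide divide_right_mono)
  then show ?thesis unfolding theta_emp_def by (simp add: sum_subtractf diff_divide_distrib)
qed

text \<open>With the data change absorbed into the noise, both outputs are images under the same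
  map, \<open>fsel_coefs\<close> at \<open>X'\<close>, of translated and untranslated Gaussian
  noise; \<open>renyi_distr_density_le\<close> then leaves a Gaussian computation.\<close>

lemma zCDP_mech:
  assumes n: "n > 0" and \<rho>: "\<rho> > 0" and fin: "finite Ms" and ne: "Ms \<noteq> {}"
  shows "zCDP d n \<rho> (mech d n \<rho> Ms)"
  unfolding zCDP_def
proof (intro allI impI, elim conjE exE)
  fix X X' :: "nat \<Rightarrow> nat \<Rightarrow> real" and \<alpha> :: real and j0
  assume adj: "\<forall>j<n. j \<noteq> j0 \<longrightarrow> X j = X' j" and \<alpha>: "\<alpha> > 1"
  let ?I = "Sigma Ms (Kset d)" and ?N = "PiM (Kall d) (\<lambda>_. borel)"
  have finI: "finite ?I" using fin by auto
  have \<sigma>pos: "(sigmaM d n \<rho> Ms M)\<^sup>2 > 0" for M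
    using n \<rho> fin ne by (simp add: sigmaM_sq[OF n \<rho> fin ne] card_gt_0_iff zero_less_mult_iff)
  \<comment> \<open>The change of the empirical coefficients in units of the noise level.\<close>
  define s where "s = (\<lambda>(M, k). (theta_emp d n X k - theta_emp d n X' k) / complex_of_real (sigmaM d n \<rho> Ms M))"
  define h where "h \<xi> = (\<Prod>i\<in>?I. gauss_ratio (s i) (\<xi> i))" for \<xi>
  have sens: "(\<Sum>i\<in>?I. (cmod (s i))\<^sup>2) \<le> \<rho>"
  proof -
    have "(\<Sum>i\<in>?I. (cmod (s i))\<^sup>2) = (\<Sum>M\<in>Ms. \<Sum>k\<in>Kset d M. (cmod (s (M, k)))\<^sup>2)"
      using fin by (subst sum.Sigma) (auto intro!: sum.cong)
    also have "\<dots> \<le> (\<Sum>M\<in>Ms. \<Sum>k\<in>Kset d M. (2 / real n)\<^sup>2 / (sigmaM d n \<rho> Ms M)\<^sup>2)"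
    proof (intro sum_mono)
      fix M k
      have "(cmod (s (M, k)))\<^sup>2 = (cmod (theta_emp d n X k - theta_emp d n X' k))\<^sup>2 / (sigmaM d n \<rho> Ms M)\<^sup>2"
        by (simp add: s_def norm_divide power_divide)
      also have "\<dots> \<le> (2 / real n)\<^sup>2 / (sigmaM d n \<rho> Ms M)\<^sup>2"
        by (intro divide_right_mono power_mono theta_emp_sensitivity[OF adj]) auto
      finally show "(cmod (s (M, k)))\<^sup>2 \<le> (2 / real n)\<^sup>2 / (sigmaM d n \<rho> Ms M)\<^sup>2" .
    qed
    \<comment> \<open>The noise level gives every grid element an equal share of the budget: the box
      size in the squared level offsets the number of coefficients, and its factor 4 offsets the
      squared sensitivity 4 / n^2.\<close>
    also have "\<dots> = (\<Sum>M\<in>Ms. \<rho> / real (card Ms))"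
    proof (intro sum.cong refl)
      fix M
      have "(2 * real M + 1) ^ d > 0" by (intro zero_less_power) simp
      then show "(\<Sum>k\<in>Kset d M. (2 / real n)\<^sup>2 / (sigmaM d n \<rho> Ms M)\<^sup>2) = \<rho> / real (card Ms)"
        using n \<rho> ne fin by (simp add: card_Kset sigmaM_sq[OF n \<rho> fin ne] power_divide field_simps)
    qed
    also have "\<dots> = \<rho>" using fin ne by simp
    finally show ?thesis .
  qed
  have shift: "fsel_coefs d n \<rho> Ms X \<xi> = fsel_coefs d n \<rho> Ms X' (\<lambda>i\<in>?I. \<xi> i + s i)" for \<xi>
  proof (rule fsel_coefs_cong[OF fin ne])
    fix M k assume "M \<in> Ms" "k \<in> Kset d M"
    moreover have "sigmaM d n \<rho> Ms M \<noteq> 0" using \<sigma>pos[of M] by auto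
    ultimately show "coef d n \<rho> Ms X \<xi> M k = coef d n \<rho> Ms X' (\<lambda>i\<in>?I. \<xi> i + s i) M k"
      by (simp add: coef_def s_def distrib_left)
  qed
  have P0: "prob_space (noise_law d Ms)" unfolding noise_law_def by (rule prob_space_PiM_cgauss)
  have comp: "(\<lambda>\<xi>. \<xi> i) \<in> borel_measurable (noise_law d Ms)" if "i \<in> ?I" for i using that by (rule noise_component_measurable)
  have sm: "(\<lambda>\<xi>. \<lambda>i\<in>?I. \<xi> i + s i) \<in> measurable (noise_law d Ms) (noise_law d Ms)"
  proof -
    have "(\<lambda>\<xi>. \<lambda>i\<in>?I. \<xi> i + s i) \<in> measurable (noise_law d Ms) (PiM ?I (\<lambda>_. borel))"
      using comp by (intro measurable_restrict borel_measurable_add) auto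
    also have "measurable (noise_law d Ms) (PiM ?I (\<lambda>_. borel)) = measurable (noise_law d Ms) (noise_law d Ms)"
      unfolding noise_law_def by (intro measurable_cong_sets refl sets_PiM_cong) simp_all
    finally show ?thesis .
  qed
  have ds: "distr (noise_law d Ms) (noise_law d Ms) (\<lambda>\<xi>. \<lambda>i\<in>?I. \<xi> i + s i) = density (noise_law d Ms) (\<lambda>\<xi>. ennreal (h \<xi>))"
    unfolding noise_law_def h_def by (rule distr_PiM_cgauss_shift[OF finI])
  have "mech d n \<rho> Ms X = distr (noise_law d Ms) ?N (\<lambda>\<xi>. fsel_coefs d n \<rho> Ms X' (\<lambda>i\<in>?I. \<xi> i + s i))"
    unfolding mech_def shift ..
  also have "\<dots> = distr (distr (noise_law d Ms) (noise_law d Ms) (\<lambda>\<xi>. \<lambda>i\<in>?I. \<xi> i + s i)) ?N (fsel_coefs d n \<rho> Ms X')"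
    by (subst distr_distr[OF fsel_coefs_measurable[OF fin ne] sm]) (simp add: comp_def)
  finally have mX: "mech d n \<rho> Ms X = distr (density (noise_law d Ms) (\<lambda>\<xi>. ennreal (h \<xi>))) ?N (fsel_coefs d n \<rho> Ms X')"
    unfolding ds .
  show "renyi \<alpha> (mech d n \<rho> Ms X) (mech d n \<rho> Ms X') \<le> ereal (\<rho> * \<alpha>)"
    unfolding mX unfolding mech_def
  proof (rule renyi_distr_density_le)
    show "prob_space (noise_law d Ms)" by (rule P0)
    show "h \<in> borel_measurable (noise_law d Ms)"
      unfolding h_def[abs_def]
      by (intro borel_measurable_prod measurable_compose[OF comp borel_measurable_gauss_ratio])
    show "h \<xi> \<ge> 0" for \<xi> unfolding h_def by (intro prod_nonneg) (simp add: less_imp_le[OF gauss_ratio_pos])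
    show "prob_space (density (noise_law d Ms) (\<lambda>\<xi>. ennreal (h \<xi>)))"
      unfolding ds[symmetric] using P0 sm by (rule prob_space.prob_space_distr)
    show "fsel_coefs d n \<rho> Ms X' \<in> measurable (noise_law d Ms) ?N" by (rule fsel_coefs_measurable[OF fin ne])
    show "\<alpha> > 1" by (rule \<alpha>)
    show "0 \<le> \<rho> * \<alpha>" using \<rho> \<alpha> by simp
    have "\<alpha> * (\<alpha> - 1) / 2 * (\<Sum>i\<in>?I. (cmod (s i))\<^sup>2) \<le> \<alpha> * (\<alpha> - 1) / 2 * \<rho>"
      using sens \<alpha> by (intro mult_left_mono) auto
    \<comment> \<open>The Gaussian shift attains half of the permitted divergence; the factor 2 is
      slack.\<close>
    also have "\<dots> \<le> \<alpha> * (\<alpha> - 1) * \<rho>" using \<alpha> \<rho> by simp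
    finally have "\<alpha> * (\<alpha> - 1) / 2 * (\<Sum>i\<in>?I. (cmod (s i))\<^sup>2) \<le> (\<alpha> - 1) * (\<rho> * \<alpha>)" by (simp add: mult_ac)
    then show "(\<integral>\<^sup>+\<xi>. ennreal (h \<xi> powr \<alpha>) \<partial>noise_law d Ms) \<le> ennreal (exp ((\<alpha> - 1) * (\<rho> * \<alpha>)))"
      unfolding h_def noise_law_def nn_integral_prod_gauss_ratio_powr[OF finI] by (intro ennreal_leI) simp
  qed
qed

section \<open>Rates\<close>

lemma dyadic_bracket:
  fixes y :: real
  assumes "y \<ge> 1"
  obtains j :: nat where "2 ^ j \<le> y" "y < 2 ^ Suc j"
proof -
  obtain i where "y < 2 ^ i" using real_arch_pow[of 2 y] by auto
  then have ex: "y < 2 ^ Suc i" by (rule less_le_trans) simp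
  define j where "j = (LEAST j. y < 2 ^ Suc j)"
  have 1: "y < 2 ^ Suc j" unfolding j_def by (rule LeastI[where P="\<lambda>j. y < 2 ^ Suc j", OF ex])
  have "2 ^ j \<le> y"
  proof (cases j)
    case (Suc k)
    then have "\<not> y < 2 ^ Suc k" using not_less_Least[of k "\<lambda>j. y < 2 ^ Suc j"] by (simp add: j_def)
    then show ?thesis using Suc by simp
  qed (use assms in simp)
  then show ?thesis using 1 that by blast
qed

lemma powr_root_power: "x > 0 \<Longrightarrow> (x powr (1 / p)) ^ q = x powr (real q / p)"
  by (simp add: powr_realpow[symmetric] powr_powr)

lemma Mgrid_memI:
  assumes "d \<ge> 1" "2 * 2 ^ j + 1 \<le> real n powr (1 / real d)"
  shows "2 ^ j \<in> Mgrid d n"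
proof -
  have "2 powr real j \<le> (real n powr (1 / real d) - 1) / 2" using assms by (simp add: powr_realpow)
  moreover have "0 < (2::real) powr real j" by simp
  ultimately have "real j \<le> log 2 ((real n powr (1 / real d) - 1) / 2)"
    by (metis le_log_iff less_le_trans one_less_numeral_iff semiring_norm(76))
  then have "int j \<le> \<lfloor>log 2 ((real n powr (1 / real d) - 1) / 2)\<rfloor>" by (simp add: le_floor_iff)
  then show ?thesis unfolding Mgrid_def by blast
qed

lemma finite_Mgrid: "finite (Mgrid d n)"
proof (rule finite_subset)
  show "Mgrid d n \<subseteq> (\<lambda>j. 2 ^ j) ` {..nat \<lfloor>log 2 ((real n powr (1 / real d) - 1) / 2)\<rfloor>}"
    by (auto simp: Mgrid_def)
qed simp

lemma card_Mgrid_le: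
  assumes d: "d \<ge> 1" and n3: "real n powr (1 / real d) \<ge> 3"
  shows "real (card (Mgrid d n)) \<le> log 2 (real n)"
proof -
  let ?x = "real n powr (1 / real d)"
  let ?l = "log 2 ((?x - 1) / 2)"
  have n0: "real n > 0" using n3 by (cases "n = 0") auto
  have n1: "real n \<ge> 1" using n0 by simp
  have l0: "?l \<ge> 0" using n3 by (simp add: zero_le_log_cancel_iff)
  have "Mgrid d n \<subseteq> (\<lambda>j. 2 ^ j) ` {..nat \<lfloor>?l\<rfloor>}" by (auto simp: Mgrid_def)
  then have "card (Mgrid d n) \<le> card {..nat \<lfloor>?l\<rfloor>}"
    by (intro order_trans[OF card_mono card_image_le]) auto
  then have "real (card (Mgrid d n)) \<le> real (nat \<lfloor>?l\<rfloor>) + 1" by simp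
  also have "real (nat \<lfloor>?l\<rfloor>) \<le> ?l" using l0 by simp
  \<comment> \<open>The exponents start at 0, which costs one extra element; the halving inside the
    grid's logarithm pays for it exactly.\<close>
  also have "?l + 1 = log 2 (?x - 1)" using n3 by (simp add: log_divide)
  also have "\<dots> \<le> log 2 ?x" using n0 n3 by (subst log_le_cancel_iff) auto
  also have "\<dots> = log 2 (real n) / real d" using n0 by (simp add: log_powr)
  also have "\<dots> \<le> log 2 (real n)" using d n1 by (simp add: divide_le_eq mult_le_cancel_left1 zero_le_log_cancel_iff)
  finally show ?thesis by simp
qed

text \<open>Half of the exponent dominates the logarithm and the other half the constant
  \<open>B\<close>, which explains the power \<open>2 / a\<close> in the threshold.\<close>

lemma log_absorb:
  fixes a B x :: real
  assumes a: "a > 0" and x: "x \<ge> 1" "x \<ge> (2 * \<bar>B\<bar> / (a * ln 2)) powr (2 / a)"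
  shows "B * log 2 x \<le> x powr a"
proof -
  let ?y = "2 * \<bar>B\<bar> / (a * ln 2)"
  have y: "?y \<ge> 0" using a by simp
  have "?y = (?y powr (2 / a)) powr (a / 2)" using y a by (simp add: powr_powr)
  also have "\<dots> \<le> x powr (a / 2)" using x a by (intro powr_mono2) auto
  finally have yx: "?y \<le> x powr (a / 2)" .
  have "B * log 2 x \<le> \<bar>B\<bar> * log 2 x" using x by (intro mult_right_mono) (auto simp: zero_le_log_cancel_iff)
  also have "\<dots> = \<bar>B\<bar> / ln 2 * ln x" by (simp add: log_def)
  also have "\<dots> \<le> \<bar>B\<bar> / ln 2 * (x powr (a / 2) / (a / 2))"
    using x a by (intro mult_left_mono ln_powr_bound) auto
  also have "\<dots> = ?y * x powr (a / 2)" by (simp add: field_simps)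
  also have "\<dots> \<le> x powr (a / 2) * x powr (a / 2)" using yx by (intro mult_right_mono) auto
  also have "\<dots> = x powr a" by (simp add: powr_add[symmetric])
  finally show ?thesis .
qed

text \<open>At the reference element all contributions are multiples of \<open>R\<close>: L^2 from
  the bias, and 24 + 24 + 1 + 32 = 81 from \<open>b2\<close> to \<open>b5\<close>.\<close>

lemma selection_risk:
  fixes \<beta> d n :: nat and L \<rho> :: real
  defines "N \<equiv> real n * sqrt (\<rho> / log 2 (real n))"
    and "a \<equiv> real d / (2 * real \<beta> + real d)"
    and "R \<equiv> max (real n powr (- (2 * real \<beta>) / (2 * real \<beta> + real d)))
      ((real n * sqrt (\<rho> / log 2 (real n))) powr (- (2 * real \<beta>) / (real \<beta> + real d)))"
  assumes \<beta>: "\<beta> \<ge> 1" and d: "d \<ge> 1" and \<rho>: "\<rho> > 0"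
    and sob: "sobolev_per d \<beta> L f" and dens: "is_density d f"
    and n3: "real n \<ge> 3 ^ (2 * \<beta> + d)" and N3: "N \<ge> 3 ^ (2 * \<beta> + d)"
    and nB: "real n \<ge> (2 * \<bar>supnorm d f\<bar> / (a * ln 2)) powr (2 / a)"
  shows "Mgrid d n \<noteq> {}" and "risk d n \<rho> (Mgrid d n) f \<le> ennreal (68 * (L\<^sup>2 + 81) * R)"
proof -
  define p where "p = 2 * real \<beta> + real d"
  define q where "q = real \<beta> + real d"
  have pq: "p > 0" "q > 0" "p \<ge> q" "q \<ge> 1" "p \<ge> real d" using \<beta> d by (auto simp: p_def q_def)
  have "(3::real) ^ 1 \<le> 3 ^ (2 * \<beta> + d)" using \<beta> by (intro power_increasing) auto
  then have n1: "real n \<ge> 3" and N1: "N \<ge> 3" 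
    using order_trans[OF _ n3] order_trans[OF _ N3] by (simp_all only: power_one_right)
  have lg: "log 2 (real n) \<ge> 1" using n1 by simp
  have N2: "N\<^sup>2 = (real n)\<^sup>2 * \<rho> / log 2 (real n)"
    unfolding N_def power_mult_distrib using \<rho> lg by simp
  \<comment> \<open>The threshold is 3 to the power \<open>p\<close>; since \<open>q \<le> p\<close>
    and the base is at least 1, it serves both roots that define \<open>T\<close>.\<close>
  have three: "3 \<le> x powr (1 / r)" if "x \<ge> 3 ^ (2 * \<beta> + d)" "0 < r" "r \<le> p" for x r :: real
  proof -
    have x1: "x \<ge> 1" using that(1) one_le_power[of "3::real" "2 * \<beta> + d"] by linarith
    have "3 = (3 powr p) powr (1 / p)" using pq by (simp add: powr_powr)
    also have "3 powr p = (3::real) ^ (2 * \<beta> + d)" unfolding p_def by (subst powr_realpow[symmetric]) auto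
    also have "\<dots> powr (1 / p) \<le> x powr (1 / p)" using that pq by (intro powr_mono2) auto
    also have "\<dots> \<le> x powr (1 / r)" using x1 that pq by (intro powr_mono) (auto simp: frac_le)
    finally show ?thesis .
  qed
  define T where "T = min (real n powr (1 / p)) (N powr (1 / q))"
  have T3: "T \<ge> 3" unfolding T_def using three[OF n3, of p] three[OF N3, of q] pq by auto
  have Tn: "T ^ k \<le> real n powr (real k / p)" for k
  proof -
    have "T ^ k \<le> (real n powr (1 / p)) ^ k" using T3 by (intro power_mono) (auto simp: T_def)
    then show ?thesis using n1 by (simp add: powr_root_power)
  qed
  have TN: "T ^ k \<le> N powr (real k / q)" for k
  proof -
    have "T ^ k \<le> (N powr (1 / q)) ^ k" using T3 by (intro power_mono) (auto simp: T_def)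
    then show ?thesis using N1 by (simp add: powr_root_power)
  qed
  have R1: "real n powr (- (2 * real \<beta>) / p) \<le> R" "N powr (- (2 * real \<beta>) / q) \<le> R"
    unfolding R_def p_def q_def N_def by auto
  have TR: "1 / T ^ (2 * \<beta>) \<le> R"
  proof (cases "real n powr (1 / p) \<le> N powr (1 / q)")
    case True
    then have "T ^ (2 * \<beta>) = real n powr (2 * real \<beta> / p)" using n1 by (simp add: T_def powr_root_power)
    then show ?thesis using R1 by (simp add: powr_minus_divide)
  next
    case False
    then have "T ^ (2 * \<beta>) = N powr (2 * real \<beta> / q)" using N1 by (simp add: T_def powr_root_power)
    then show ?thesis using R1 by (simp add: powr_minus_divide)
  qed
  \<comment> \<open>\<open>T \<ge> 3\<close> makes room for the exponent 0; the choice gives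
    \<open>2 * M + 1 \<le> T\<close>.\<close>
  obtain j where j: "2 ^ j \<le> (T - 1) / 2" "(T - 1) / 2 < 2 ^ Suc j" using dyadic_bracket[of "(T - 1) / 2"] T3 by auto
  define M where "M = (2::nat) ^ j"
  have M1: "M \<ge> 1" by (simp add: M_def)
  have MT: "2 * real M + 1 \<le> T" "T < 4 * real M + 1" using j by (simp_all add: M_def)
  have "T \<le> real n powr (1 / p)" by (simp add: T_def)
  also have "\<dots> \<le> real n powr (1 / real d)" using n1 pq d by (intro powr_mono) (auto simp: frac_le)
  finally have Td: "T \<le> real n powr (1 / real d)" .
  have Mm: "M \<in> Mgrid d n" unfolding M_def by (rule Mgrid_memI[OF d]) (use MT Td in \<open>simp add: M_def\<close>)
  then show ne: "Mgrid d n \<noteq> {}" by auto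
  have card: "real (card (Mgrid d n)) \<le> log 2 (real n)" using T3 Td by (intro card_Mgrid_le d) auto
  interpret sel: selection d f n \<rho> "Mgrid d n"
    by unfold_locales (use sobolev_per_f[OF sob \<beta>] dens n1 \<rho> finite_Mgrid ne d in auto)
  \<comment> \<open>Any constant in front of \<open>T\<close> would be raised to the power
    \<open>d\<close> here.\<close>
  have DT: "sel.D M \<le> T ^ d" unfolding sel.D_def using MT by (intro power_mono) auto
  have D0: "sel.D M \<ge> 0" using sel.D_ge_1[of M] by simp

  \<comment> \<open>\<open>T < 4 * M + 1 \<le> 5 * M\<close>, and 5 is below 2 \<pi>:
    differentiation gains more than dyadic rounding loses, so the bias carries no further
    constant.\<close>
  have "T \<le> 2 * pi * real M"
  proof -
    have "real M \<ge> 1" using M1 by simp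
    then have "T \<le> 5 * real M" using MT by linarith
    also have "\<dots> \<le> 2 * pi * real M" using pi_gt3 by (intro mult_right_mono) auto
    finally show ?thesis .
  qed
  then have "sel.bias M \<le> L\<^sup>2 / T ^ (2 * \<beta>)"
    unfolding sel.bias_def sel.\<theta>_def using T3
    by (intro order_trans[OF sobolev_bias_le[OF sob \<beta> M1]] divide_left_mono power_mono) auto
  also have "\<dots> \<le> L\<^sup>2 * R" using mult_left_mono[OF TR, of "L\<^sup>2"] by simp
  finally have b1: "sel.bias M \<le> L\<^sup>2 * R" .

  have nR: "real n powr (real d / p) / real n \<le> R"
  proof -
    have e: "real d / p - 1 = - (2 * real \<beta>) / p" using pq by (simp add: field_simps p_def)
    have "real n powr (real d / p) / real n = real n powr (real d / p - 1)"
      using n1 by (simp add: powr_diff)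
    then show ?thesis using R1 unfolding e by simp
  qed
  have "24 * sel.D M / real n \<le> 24 * (real n powr (real d / p) / real n)"
    using DT Tn[of d] n1 by (simp add: divide_right_mono)
  then have b2: "24 * sel.D M / real n \<le> 24 * R" using nR by linarith

  have cN: "real (card (Mgrid d n)) / ((real n)\<^sup>2 * \<rho>) \<le> 1 / N\<^sup>2"
    unfolding N2 using card \<rho> n1 by (simp add: divide_right_mono)
  have "6 * (sel.D M * sel.\<sigma>2 M) = 24 * ((sel.D M)\<^sup>2 * (real (card (Mgrid d n)) / ((real n)\<^sup>2 * \<rho>)))"
    unfolding sel.\<sigma>2_eq by (simp add: power2_eq_square)
  also have "\<dots> \<le> 24 * ((T ^ d)\<^sup>2 * (1 / N\<^sup>2))"
    using DT D0 cN \<rho> by (intro mult_left_mono mult_mono power_mono) auto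
  also have "\<dots> \<le> 24 * (N powr (real (2 * d) / q) * (1 / N\<^sup>2))"
    using TN[of "2 * d"] by (intro mult_left_mono mult_right_mono) (auto simp: power_mult mult.commute[of 2])
  also have "N powr (real (2 * d) / q) * (1 / N\<^sup>2) = N powr (- (2 * real \<beta>) / q)"
  proof -
    have e: "real (2 * d) / q - 2 = - (2 * real \<beta>) / q" using pq by (simp add: field_simps q_def)
    have "N powr (real (2 * d) / q) * (1 / N\<^sup>2) = N powr (real (2 * d) / q - 2)"
      using N1 by (simp add: powr_diff powr_numeral)
    then show ?thesis unfolding e .
  qed
  finally have b3: "6 * (sel.D M * sel.\<sigma>2 M) \<le> 24 * R" using R1 by linarith

  have B0: "supnorm d f \<ge> 0" using bounded_features.B0[OF sel.bounded_features] .
  have "real (card (Mgrid d n)) * supnorm d f / (40 * real n) \<le> supnorm d f * log 2 (real n) / real n"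
  proof -
    have "real (card (Mgrid d n)) * supnorm d f / (40 * real n) \<le> real (card (Mgrid d n)) * supnorm d f / real n"
      using B0 n1 by (intro divide_left_mono) auto
    also have "\<dots> \<le> log 2 (real n) * supnorm d f / real n"
      using B0 card by (intro divide_right_mono mult_right_mono) auto
    finally show ?thesis by (simp add: mult.commute)
  qed
  \<comment> \<open>The exponent \<open>a\<close> is such that the right-hand side is the
    non-private rate; this is where the sup norm enters the condition on \<open>n\<close>.\<close>
  also have "\<dots> \<le> real n powr a / real n"
    using n1 nB d by (intro divide_right_mono log_absorb) (auto simp: a_def)
  also have "\<dots> \<le> R" using nR by (simp add: a_def p_def)
  finally have b4: "real (card (Mgrid d n)) * supnorm d f / (40 * real n) \<le> R" .

  have "32 * real (card (Mgrid d n)) / ((real n)\<^sup>2 * \<rho>) \<le> 32 * (1 / N\<^sup>2)" using cN by simp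
  also have "1 / N\<^sup>2 = N powr (- 2)" using N1 by (simp add: powr_minus_divide powr_numeral)
  also have "\<dots> \<le> N powr (- (2 * real \<beta>) / q)" using N1 pq by (intro powr_mono) (auto simp: field_simps q_def)
  finally have b5: "32 * real (card (Mgrid d n)) / ((real n)\<^sup>2 * \<rho>) \<le> 32 * R" using R1 by linarith

  have "risk d n \<rho> (Mgrid d n) f \<le> ennreal (68 * (sel.bias M + (24 * sel.D M / real n + 6 * (sel.D M * sel.\<sigma>2 M))
     + real (card (Mgrid d n)) * supnorm d f / (40 * real n) + 32 * real (card (Mgrid d n)) / ((real n)\<^sup>2 * \<rho>)))"
    by (rule sel.risk_le[OF Mm])
  also have "\<dots> \<le> ennreal (68 * (L\<^sup>2 + 81) * R)"
  proof (rule ennreal_leI)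
    have "sel.bias M + (24 * sel.D M / real n + 6 * (sel.D M * sel.\<sigma>2 M))
     + real (card (Mgrid d n)) * supnorm d f / (40 * real n) + 32 * real (card (Mgrid d n)) / ((real n)\<^sup>2 * \<rho>)
     \<le> (L\<^sup>2 + 81) * R"
      unfolding distrib_right using b1 b2 b3 b4 b5 by linarith
    from mult_left_mono[OF this, of 68]
    show "68 * (sel.bias M + (24 * sel.D M / real n + 6 * (sel.D M * sel.\<sigma>2 M))
     + real (card (Mgrid d n)) * supnorm d f / (40 * real n) + 32 * real (card (Mgrid d n)) / ((real n)\<^sup>2 * \<rho>))
     \<le> 68 * (L\<^sup>2 + 81) * R" by (simp only: mult.assoc)
  qed
  finally show "risk d n \<rho> (Mgrid d n) f \<le> ennreal (68 * (L\<^sup>2 + 81) * R)" .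
qed

theorem theorem6p3:
  shows "\<exists>C1 C2 :: nat \<Rightarrow> _ .
    (\<forall>\<beta> (L::real). C1 \<beta> L > 0) \<and> (\<forall>\<beta> d (B::real). C2 \<beta> d B > (0::real)) \<and>
    (\<forall>(\<beta>::nat) (L::real) (d::nat) (f :: (nat \<Rightarrow> real) \<Rightarrow> real) (n::nat) (\<rho>::real).
       \<beta> \<ge> 1 \<and> L > 0 \<and> d \<ge> 1 \<and> \<rho> > 0 \<and>
       sobolev_per d \<beta> L f \<and> is_density d f \<and>
       min (real n) (real n * sqrt (\<rho> / log 2 (real n))) \<ge> C2 \<beta> d (supnorm d f)
       \<longrightarrow>
       zCDP d n \<rho> (mech d n \<rho> (Mgrid d n)) \<and>
       risk d n \<rho> (Mgrid d n) f \<le> ennreal (C1 \<beta> L *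
          max (real n powr (- (2 * real \<beta>) / (2 * real \<beta> + real d)))
              ((real n * sqrt \<rho> / sqrt (log 2 (real n))) powr (- (2 * real \<beta>) / (real \<beta> + real d)))))"
proof -
  define C1 where "C1 = (\<lambda>(\<beta>::nat) (L::real). 68 * (L\<^sup>2 + 81))"
  \<comment> \<open>The first entry ensures that the oracle frequency is at least 3, the second is
    the threshold of \<open>log_absorb\<close> for the empirical excess.\<close>
  define C2 where "C2 = (\<lambda>(\<beta>::nat) (d::nat) (B::real).
    max (3 ^ (2 * \<beta> + d)) ((2 * \<bar>B\<bar> / (real d / (2 * real \<beta> + real d) * ln 2)) powr (2 / (real d / (2 * real \<beta> + real d)))))"
  have "zCDP d n \<rho> (mech d n \<rho> (Mgrid d n)) \<and>
       risk d n \<rho> (Mgrid d n) f \<le> ennreal (C1 \<beta> L *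
          max (real n powr (- (2 * real \<beta>) / (2 * real \<beta> + real d)))
              ((real n * sqrt \<rho> / sqrt (log 2 (real n))) powr (- (2 * real \<beta>) / (real \<beta> + real d))))"
    if H: "\<beta> \<ge> 1 \<and> L > 0 \<and> d \<ge> 1 \<and> \<rho> > 0 \<and> sobolev_per d \<beta> L f \<and> is_density d f \<and>
       min (real n) (real n * sqrt (\<rho> / log 2 (real n))) \<ge> C2 \<beta> d (supnorm d f)" for \<beta> L d f n \<rho>
  proof
    have *: "\<beta> \<ge> 1" "d \<ge> 1" "\<rho> > 0" "sobolev_per d \<beta> L f" "is_density d f"
      "real n \<ge> 3 ^ (2 * \<beta> + d)" "real n * sqrt (\<rho> / log 2 (real n)) \<ge> 3 ^ (2 * \<beta> + d)"
      "real n \<ge> (2 * \<bar>supnorm d f\<bar> / (real d / (2 * real \<beta> + real d) * ln 2)) powr (2 / (real d / (2 * real \<beta> + real d)))"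
      using H by (auto simp: C2_def)
    have "0 < real n" by (rule less_le_trans[OF _ *(6)]) simp
    then have n: "n > 0" by simp
    show "zCDP d n \<rho> (mech d n \<rho> (Mgrid d n))"
      by (rule zCDP_mech[OF n *(3) finite_Mgrid selection_risk(1)[OF *]])
    show "risk d n \<rho> (Mgrid d n) f \<le> ennreal (C1 \<beta> L *
          max (real n powr (- (2 * real \<beta>) / (2 * real \<beta> + real d)))
              ((real n * sqrt \<rho> / sqrt (log 2 (real n))) powr (- (2 * real \<beta>) / (real \<beta> + real d))))"
      using selection_risk(2)[OF *] by (simp add: C1_def real_sqrt_divide)
  qed
  moreover have "C1 \<beta> L > 0" for \<beta> L
    unfolding C1_def by (intro mult_pos_pos add_nonneg_pos) auto
  moreover have "C2 \<beta> d B > 0" for \<beta> d B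
    unfolding C2_def by (intro less_le_trans[OF _ max.cobounded1]) simp
  ultimately show ?thesis by blast
qed

end
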